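(* The flux correction method with the "extended Galerkin formula" on a 1-periodic simplicial mesh of $\mathbb{R}^d$ (as defined in the context) has zero mean error on the third order polynomials, i.e. $$\sum_{j\in\mathcal{N}^1}|K_j|\,\epsilon_j(f,\Pi)=0\quad\text{for each } f\in(P_3)^n.$$
   Context: System: $\partial_t w+\boldsymbol{A}\cdot\nabla w=0$ in $\mathbb{R}^d$, $d\in\mathbb N$, $\boldsymbol{A}=(A_1,\dots,A_d)$ constant real $n\times n$ matrices, $\boldsymbol{A}\cdot\boldsymbol e=\sum_i e_iA_i$ diagonalizable over $\mathbb{R}$ for each $\boldsymbol e\in\mathbb{R}^d$; $\boldsymbol{A}\cdot\nabla f=\sum_iA_i\partial f/\partial x_i$. For $B=S\Lambda S^{-1}$ with $\Lambda$ real diagonal, $|B|=S|\Lambda|S^{-1}$. $P_q$: polynomials in $d$ variables of degree at most $q$. Mesh: a conforming simplicial mesh of $\mathbb{R}^d$ invariant under translations by integer vectors, with finitely many nodes per unit cube; $\mathcal{N}$ is the set of nodes, $\boldsymbol r_j$ the radius-vector of node $j$, $\mathcal{N}^1$ the set of nodes modulo integer translations. Control volume of node $j$: $$K_j=\bigcup_{e\ni j}\Bigl\{\sum_{l\in e}\alpha_l\boldsymbol r_l:\ \alpha_l\in[0,1],\ \sum_{l\in e}\alpha_l=1,\ \alpha_j=\max_{l\in e}\alpha_l\Bigr\},$$ the union being over simplexes $e$ having $j$ as a vertex. $N(j)$ is the set of nodes connected to $j$ by an edge; $\boldsymbol n_{jk}=\int_{\partial K_j\cap\partial K_k}\boldsymbol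 n\,dS$ with $\boldsymbol n$ the unit normal pointing into $K_k$. $\Pi$ maps a continuous function to its values at the nodes. Scheme: $$\sum_{k\in N(j)}v_{jk}\,s_{jk}\!\left[\frac{du}{dt}\right]+\sum_{k\in N(j)}F_{jk}[u]=0,\qquad v_{jk}=\frac{1}{2d}(\boldsymbol r_k-\boldsymbol r_j)\cdot\boldsymbol n_{jk},$$ $$F_{jk}[u]=\frac{\boldsymbol A\cdot\boldsymbol n_{jk}+|\boldsymbol A\cdot\boldsymbol n_{jk}|}{2}\mathcal{R}_{jk}[u]+\frac{\boldsymbol A\cdot\boldsymbol n_{jk}-|\boldsymbol A\cdot\boldsymbol n_{jk}|}{2}\mathcal{R}_{kj}[u],\qquad \mathcal{R}_{jk}[u]=u_j+\frac{\boldsymbol r_k-\boldsymbol r_j}{2}\cdot(\boldsymbol G u)_j.$$ Here $\boldsymbol G$ is a linear, finite-stencil, 2-exact approximation of the gradient acting componentwise ($\boldsymbol G\Pi f=\Pi\nabla f$ for each $f\in(P_2)^n$), and $s_{jk}$ are linear functionals (depending on finitely many values, acting componentwise) satisfying $$s_{jk}[\Pi q]=q(\boldsymbol r_j)-\frac{d}{4(d+2)}\bigl((\boldsymbol r_k-\boldsymbol r_j)\cdot\nabla\bigr)^2q\quad\text{for each } q\in(P_2)^n.$$ $\boldsymbol G$ and $s_{jk}$ are invariant with respect to translations preserving the mesh. Truncation error: $|K_j|\,\epsilon_j(f,\Pi)=-\sum_{k\in N(j)}v_{jk}\,s_{jk}[\Pi(\boldsymbol A\cdot\nabla f)]+\sum_{k\in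 N(j)}F_{jk}[\Pi f]$. *)

theory Defs
  imports "HOL-Analysis.Analysis"
begin

section \<open>The hyperbolic system\<close>

definition partial_deriv :: "'d::finite \<Rightarrow> (real^'d \<Rightarrow> 'b::real_normed_vector) \<Rightarrow> real^'d \<Rightarrow> 'b" where
  "partial_deriv i f x = frechet_derivative f (at x) (axis i 1)"

definition gradient :: "(real^'d::finite \<Rightarrow> real) \<Rightarrow> real^'d \<Rightarrow> real^'d" where
  "gradient q x = (\<chi> i. partial_deriv i q x)"

definition directional_deriv :: "real^'d::finite \<Rightarrow> (real^'d \<Rightarrow> real) \<Rightarrow> real^'d \<Rightarrow> real" where
  "directional_deriv v q x = (\<Sum>i\<in>UNIV. v $ i * partial_deriv i q x)"

definition matrix_dot :: "('d::finite \<Rightarrow> real^'n::finite^'n) \<Rightarrow> real^'d \<Rightarrow> real^'n^'n" where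
  "matrix_dot A e = (\<Sum>i\<in>UNIV. e $ i *\<^sub>R A i)"

definition advection :: "('d::finite \<Rightarrow> real^'n::finite^'n) \<Rightarrow> (real^'d \<Rightarrow> real^'n) \<Rightarrow> real^'d \<Rightarrow> real^'n" where
  "advection A f x = (\<Sum>i\<in>UNIV. A i *v partial_deriv i f x)"

definition diagonal_matrix :: "real^'n^'n \<Rightarrow> bool" where
  "diagonal_matrix L \<longleftrightarrow> (\<forall>i j. i \<noteq> j \<longrightarrow> L $ i $ j = 0)"

definition diagonalized_by :: "real^'n::finite^'n \<Rightarrow> real^'n^'n \<Rightarrow> real^'n^'n \<Rightarrow> bool" where
  "diagonalized_by B S L \<longleftrightarrow> invertible S \<and> diagonal_matrix L \<and> B = S ** L ** matrix_inv S"

definition real_diagonalizable :: "real^'n::finite^'n \<Rightarrow> bool" where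
  "real_diagonalizable B \<longleftrightarrow> (\<exists>S L. diagonalized_by B S L)"

definition matrix_abs :: "real^'n::finite^'n \<Rightarrow> real^'n^'n" where
  "matrix_abs B = (THE C. \<exists>S L. diagonalized_by B S L \<and>
     C = S ** (\<chi> i j. \<bar>L $ i $ j\<bar>) ** matrix_inv S)"

text \<open>The matrix absolute value does not depend on the chosen diagonalization.\<close>

lemma matrix_inv_inverse:
  fixes S :: "real^'n::finite^'n"
  assumes "invertible S"
  shows "S ** matrix_inv S = mat 1" and "matrix_inv S ** S = mat 1"
proof -
  have "S ** matrix_inv S = mat 1 \<and> matrix_inv S ** S = mat 1"
    unfolding matrix_inv_def by (rule someI_ex) (use assms in \<open>simp add: invertible_def\<close>)
  then show "S ** matrix_inv S = mat 1" and "matrix_inv S ** S = mat 1" by auto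
qed

lemma abs_diagonal_unique:
  fixes B :: "real^'n::finite^'n"
  assumes "diagonalized_by B S L" and "diagonalized_by B S' L'"
  shows "S ** (\<chi> i j. \<bar>L $ i $ j\<bar>) ** matrix_inv S = S' ** (\<chi> i j. \<bar>L' $ i $ j\<bar>) ** matrix_inv S'"
proof -
  define M where "M = matrix_inv S' ** S"
  let ?a = "\<lambda>L::real^'n^'n. (\<chi> i j. \<bar>L $ i $ j\<bar>)"
  have inv: "S ** matrix_inv S = mat 1" "matrix_inv S ** S = mat 1"
            "S' ** matrix_inv S' = mat 1" "matrix_inv S' ** S' = mat 1"
    using assms matrix_inv_inverse by (auto simp: diagonalized_by_def)
  have D: "diagonal_matrix L" "diagonal_matrix L'" using assms by (auto simp: diagonalized_by_def)
  have "S ** L ** matrix_inv S = S' ** L' ** matrix_inv S'"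
    using assms by (simp add: diagonalized_by_def)
  then have "matrix_inv S' ** (S ** L ** matrix_inv S) ** S = matrix_inv S' ** (S' ** L' ** matrix_inv S') ** S"
    by simp
  moreover have "matrix_inv S' ** (S ** L ** matrix_inv S) ** S = M ** L"
    by (simp add: M_def matrix_mul_assoc[symmetric] inv)
  moreover have "matrix_inv S' ** (S' ** L' ** matrix_inv S') ** S = L' ** M"
    by (simp add: M_def matrix_mul_assoc inv)
  ultimately have comm: "M ** L = L' ** M" by simp
  have right: "(M ** X) $ i $ j = M $ i $ j * X $ j $ j" if "diagonal_matrix X" for X i j
  proof -
    have "(M ** X) $ i $ j = (\<Sum>k\<in>UNIV. if k = j then M $ i $ j * X $ j $ j else 0)"
      unfolding matrix_matrix_mult_def vec_lambda_beta
      by (rule sum.cong) (use that in \<open>auto simp: diagonal_matrix_def\<close>)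
    then show ?thesis by simp
  qed
  have left: "(X ** M) $ i $ j = X $ i $ i * M $ i $ j" if "diagonal_matrix X" for X i j
  proof -
    have "(X ** M) $ i $ j = (\<Sum>k\<in>UNIV. if k = i then X $ i $ i * M $ i $ j else 0)"
      unfolding matrix_matrix_mult_def vec_lambda_beta
      by (rule sum.cong) (use that in \<open>auto simp: diagonal_matrix_def\<close>)
    then show ?thesis by simp
  qed
  have Da: "diagonal_matrix (?a L)" "diagonal_matrix (?a L')" using D by (auto simp: diagonal_matrix_def)
  have "M ** ?a L = ?a L' ** M"
  proof -
    have "M $ i $ j * \<bar>L $ j $ j\<bar> = \<bar>L' $ i $ i\<bar> * M $ i $ j" for i j
    proof (cases "M $ i $ j = 0")
      case False
      have "M $ i $ j * L $ j $ j = L' $ i $ i * M $ i $ j"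
        using comm right[OF D(1)] left[OF D(2)] by metis
      then have "L $ j $ j = L' $ i $ i" using False by simp
      then show ?thesis by simp
    qed simp
    then show ?thesis by (simp add: vec_eq_iff right[OF Da(1)] left[OF Da(2)])
  qed
  then have "S' ** (M ** ?a L) ** matrix_inv S = S' ** (?a L' ** M) ** matrix_inv S" by simp
  moreover have "S' ** (M ** ?a L) ** matrix_inv S = S ** ?a L ** matrix_inv S"
    by (simp add: M_def matrix_mul_assoc inv)
  moreover have "S' ** (?a L' ** M) ** matrix_inv S = S' ** ?a L' ** matrix_inv S'"
    by (simp add: M_def matrix_mul_assoc[symmetric] inv)
  ultimately show ?thesis by simp
qed

lemma matrix_abs_eq:
  assumes "diagonalized_by B S L"
  shows "matrix_abs B = S ** (\<chi> i j. \<bar>L $ i $ j\<bar>) ** matrix_inv S"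
  unfolding matrix_abs_def
  by (rule the_equality) (use assms abs_diagonal_unique in blast)+

text \<open>Real polynomial functions of total degree at most \<open>q\<close>, written out in monomials;
  the sum is over the finitely many multi-indices of length at most \<open>q\<close>.\<close>

definition polynomials_upto :: "nat \<Rightarrow> (real^'d::finite \<Rightarrow> real) set" where
  "polynomials_upto q =
     {p. \<exists>c. \<forall>x. p x = (\<Sum>\<alpha> | (\<Sum>i\<in>UNIV. \<alpha> i) \<le> q. c \<alpha> * (\<Prod>i\<in>UNIV. (x $ i) ^ \<alpha> i))}"

definition vector_polynomials_upto :: "nat \<Rightarrow> (real^'d::finite \<Rightarrow> real^'n::finite) set" where
  "vector_polynomials_upto q = {f. \<forall>c. (\<lambda>x. f x $ c) \<in> polynomials_upto q}"

lemma finite_multi_indices: "finite {\<alpha> :: 'd::finite \<Rightarrow> nat. (\<Sum>i\<in>UNIV. \<alpha> i) \<le> q}"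
proof (rule finite_subset)
  show "{\<alpha>. (\<Sum>i\<in>UNIV. \<alpha> i) \<le> q} \<subseteq> (UNIV :: 'd set) \<rightarrow>\<^sub>E {..q}"
  proof
    fix \<alpha> :: "'d \<Rightarrow> nat" assume "\<alpha> \<in> {\<alpha>. (\<Sum>i\<in>UNIV. \<alpha> i) \<le> q}"
    moreover have "\<alpha> i \<le> (\<Sum>i\<in>UNIV. \<alpha> i)" for i by (rule member_le_sum) auto
    ultimately have "\<alpha> i \<le> q" for i using order_trans by blast
    then show "\<alpha> \<in> UNIV \<rightarrow>\<^sub>E {..q}" by (simp add: PiE_UNIV_domain)
  qed
  show "finite ((UNIV :: 'd set) \<rightarrow>\<^sub>E {..q})" by (intro finite_PiE) auto
qed

section \<open>The mesh\<close>

text \<open>A mesh is the set of its simplexes, each represented by its set of vertices.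
  A node is identified with its radius-vector.\<close>

definition integer_vector :: "real^'d \<Rightarrow> bool" where
  "integer_vector z \<longleftrightarrow> (\<forall>i. z $ i \<in> \<int>)"

definition nodes :: "(real^'d) set set \<Rightarrow> (real^'d) set" where
  "nodes T = \<Union>T"

definition conforming_simplicial_mesh :: "(real^'d::finite) set set \<Rightarrow> bool" where
  "conforming_simplicial_mesh T \<longleftrightarrow>
     (\<forall>e\<in>T. \<not> affine_dependent e \<and> card e = CARD('d) + 1) \<and>
     (\<Union>e\<in>T. convex hull e) = UNIV \<and>
     (\<forall>e\<in>T. \<forall>e'\<in>T. (convex hull e \<inter> convex hull e') face_of convex hull e) \<and>
     (\<forall>j\<in>nodes T. finite {e\<in>T. j \<in> e})"

definition periodic_simplicial_mesh :: "(real^'d::finite) set set \<Rightarrow> bool" where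
  "periodic_simplicial_mesh T \<longleftrightarrow>
     conforming_simplicial_mesh T \<and>
     (\<forall>z. integer_vector z \<longrightarrow> (\<lambda>e. (+) z ` e) ` T = T) \<and>
     finite (nodes T \<inter> cbox 0 1)"

text \<open>A complete system of representatives of the nodes modulo integer translations.\<close>

definition node_representatives :: "(real^'d::finite) set set \<Rightarrow> (real^'d) set \<Rightarrow> bool" where
  "node_representatives T R \<longleftrightarrow>
     R \<subseteq> nodes T \<and> (\<forall>j\<in>nodes T. \<exists>!i. i \<in> R \<and> integer_vector (j - i))"

definition neighbours :: "(real^'d) set set \<Rightarrow> real^'d \<Rightarrow> (real^'d) set" where
  "neighbours T j = {k. k \<noteq> j \<and> (\<exists>e\<in>T. j \<in> e \<and> k \<in> e)}"

definition control_volume :: "(real^'d::finite) set set \<Rightarrow> real^'d \<Rightarrow> (real^'d) set" where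
  "control_volume T j = (\<Union>e\<in>{e\<in>T. j \<in> e}.
     {(\<Sum>l\<in>e. \<alpha> l *\<^sub>R l) | \<alpha>.
        (\<forall>l\<in>e. \<alpha> l \<in> {0..1}) \<and> (\<Sum>l\<in>e. \<alpha> l) = 1 \<and> \<alpha> j = Max (\<alpha> ` e)})"

lemma finite_neighbours:
  assumes "conforming_simplicial_mesh T" and "j \<in> nodes T"
  shows "finite (neighbours T j)"
proof (rule finite_subset)
  show "neighbours T j \<subseteq> \<Union>{e\<in>T. j \<in> e}" by (auto simp: neighbours_def)
  show "finite (\<Union>{e\<in>T. j \<in> e})"
  proof (rule finite_Union)
    show "finite {e\<in>T. j \<in> e}" using assms by (simp add: conforming_simplicial_mesh_def)
    show "finite M" if "M \<in> {e\<in>T. j \<in> e}" for M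
      using that assms(1) by (intro aff_independent_finite) (simp add: conforming_simplicial_mesh_def)
  qed
qed

lemma finite_node_representatives:
  assumes "periodic_simplicial_mesh T" and R: "node_representatives T R"
  shows "finite R"
proof -
  define h :: "real^'a \<Rightarrow> real^'a" where "h x = (\<chi> i. frac (x $ i))" for x
  have h: "integer_vector (x - h x)" for x by (simp add: integer_vector_def h_def frac_def)
  have "h ` R \<subseteq> nodes T \<inter> cbox 0 1"
  proof
    fix y assume "y \<in> h ` R"
    then obtain x where x: "x \<in> R" "y = h x" by auto
    then obtain e where e: "e \<in> T" "x \<in> e" using R by (auto simp: node_representatives_def nodes_def)
    have "integer_vector (h x - x)" using h[of x] 
      using Ints_minus[of "x $ i - h x $ i" for i] by (simp add: integer_vector_def)
    then have "(+) (h x - x) ` e \<in> T" using assms(1) e by (auto simp: periodic_simplicial_mesh_def)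
    moreover have "h x \<in> (+) (h x - x) ` e" using e by force
    ultimately show "y \<in> nodes T \<inter> cbox 0 1"
      using x by (auto simp: nodes_def mem_box_cart h_def frac_ge_0 frac_lt_1 less_imp_le)
  qed
  moreover have "inj_on h R"
  proof (rule inj_onI)
    fix x y assume xy: "x \<in> R" "y \<in> R" "h x = h y"
    have "integer_vector (x - y)" using h[of x] h[of y] xy(3)
      using Ints_diff[of "x $ i - h x $ i" "y $ i - h y $ i" for i] by (simp add: integer_vector_def)
    moreover have "integer_vector (x - x)" by (simp add: integer_vector_def)
    ultimately show "x = y" using R xy by (force simp: node_representatives_def)
  qed
  ultimately show ?thesis
    using assms(1) by (meson finite_imageD finite_subset periodic_simplicial_mesh_def)
qed

section \<open>Integration over piecewise flat surfaces\<close>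

text \<open>Lebesgue measure of dimension \<open>d - 1\<close> on a hyperplane \<open>H\<close>: the image, under the orthogonal
  projection onto \<open>H\<close>, of the Lebesgue measure on the slab of thickness 1 around \<open>H\<close>.
  If the dimension is 1, it is the unit mass at the point \<open>H\<close>.\<close>

definition hyperplanes :: "'a::euclidean_space set set" where
  "hyperplanes = {H. affine H \<and> aff_dim H = int DIM('a) - 1}"

definition hyperplane_measure :: "'a::euclidean_space set \<Rightarrow> 'a measure" where
  "hyperplane_measure H =
     distr (restrict_space lborel {x. infdist x H \<le> 1/2}) borel (closest_point H)"

text \<open>The surface measure \<open>dS\<close>: since distinct hyperplanes meet in sets that are null for both of
  them, on a set contained in countably many hyperplanes this is the area (the Hausdorff
  measure of dimension \<open>d - 1\<close>).  Faces of control volumes are of this kind.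
  The integral over \<^term>\<open>count_space\<close> is the sum over all hyperplanes.\<close>

definition surface_measure :: "'a::euclidean_space measure" where
  "surface_measure = measure_of UNIV (sets borel)
     (\<lambda>S. \<integral>\<^sup>+H. emeasure (hyperplane_measure H) S \<partial>count_space hyperplanes)"

lemma sets_surface_measure [simp]: "sets surface_measure = sets borel"
  unfolding surface_measure_def using sets.sigma_sets_eq[of borel] by simp

lemma emeasure_surface_measure:
  assumes S: "S \<in> sets borel"
  shows "emeasure surface_measure S =
    (\<integral>\<^sup>+H. emeasure (hyperplane_measure H) S \<partial>count_space hyperplanes)"
proof (rule emeasure_measure_of[OF surface_measure_def])
  show "countably_additive (sets surface_measure)
     (\<lambda>S::'a set. \<integral>\<^sup>+H. emeasure (hyperplane_measure H) S \<partial>count_space hyperplanes)"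
  proof (rule countably_additiveI)
    fix F :: "nat \<Rightarrow> 'a set"
    assume F: "range F \<subseteq> sets surface_measure" "disjoint_family F"
    have "(\<Sum>i. emeasure (hyperplane_measure H) (F i)) = emeasure (hyperplane_measure H) (\<Union>i. F i)" for H
      by (rule suminf_emeasure) (use F in \<open>auto simp: hyperplane_measure_def\<close>)
    moreover have "(\<integral>\<^sup>+H. (\<Sum>i. emeasure (hyperplane_measure H) (F i)) \<partial>count_space hyperplanes) =
        (\<Sum>i. \<integral>\<^sup>+H. emeasure (hyperplane_measure H) (F i) \<partial>count_space hyperplanes)"
      by (rule nn_integral_suminf) simp
    ultimately show "(\<Sum>i. \<integral>\<^sup>+H. emeasure (hyperplane_measure H) (F i) \<partial>count_space hyperplanes) =
       (\<integral>\<^sup>+H. emeasure (hyperplane_measure H) (\<Union>i. F i) \<partial>count_space hyperplanes)"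
      by simp
  qed
next
  show "positive (sets surface_measure)
     (\<lambda>S::'a set. \<integral>\<^sup>+H. emeasure (hyperplane_measure H) S \<partial>count_space hyperplanes)"
    by (simp add: positive_def)
  show "sets borel \<subseteq> Pow (UNIV :: 'a set)" by blast
  show "S \<in> sets surface_measure" using S by simp
qed

text \<open>Near a regular point \<open>x\<close> of the common boundary of \<open>U\<close> and \<open>V\<close> the two sets are the two
  half-balls cut off by the tangent hyperplane.  On the (null) set of the remaining points,
  where there is no normal, the value 0 is used.\<close>

definition is_unit_normal :: "'a::euclidean_space set \<Rightarrow> 'a set \<Rightarrow> 'a \<Rightarrow> 'a \<Rightarrow> bool" where
  "is_unit_normal U V x \<nu> \<longleftrightarrow> norm \<nu> = 1 \<and>
     (\<exists>\<epsilon>>0. U \<inter> ball x \<epsilon> = {y \<in> ball x \<epsilon>. \<nu> \<bullet> (y - x) \<le> 0} \<and>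
            V \<inter> ball x \<epsilon> = {y \<in> ball x \<epsilon>. \<nu> \<bullet> (y - x) \<ge> 0})"

definition unit_normal_into :: "'a::euclidean_space set \<Rightarrow> 'a set \<Rightarrow> 'a \<Rightarrow> 'a" where
  "unit_normal_into U V x =
     (if \<exists>!\<nu>. is_unit_normal U V x \<nu> then THE \<nu>. is_unit_normal U V x \<nu> else 0)"

definition face_normal :: "(real^'d::finite) set set \<Rightarrow> real^'d \<Rightarrow> real^'d \<Rightarrow> real^'d" where
  "face_normal T j k =
     (LINT x:(frontier (control_volume T j) \<inter> frontier (control_volume T k))|surface_measure.
        unit_normal_into (control_volume T j) (control_volume T k) x)"

section \<open>The scheme\<close>

text \<open>A mesh function is a function of the node position; its values off the nodes are irrelevant.\<close>

definition nodal_values :: "(real^'d) set set \<Rightarrow> (real^'d \<Rightarrow> 'b) \<Rightarrow> real^'d \<Rightarrow> 'b" where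
  "nodal_values T f = restrict f (nodes T)"

definition finite_stencil_functional :: "(real^'d) set set \<Rightarrow> ((real^'d \<Rightarrow> real) \<Rightarrow> real) \<Rightarrow> bool" where
  "finite_stencil_functional T L \<longleftrightarrow>
     (\<forall>u v. L (\<lambda>l. u l + v l) = L u + L v) \<and>
     (\<forall>a u. L (\<lambda>l. a * u l) = a * L u) \<and>
     (\<exists>S. finite S \<and> S \<subseteq> nodes T \<and> (\<forall>u v. (\<forall>l\<in>S. u l = v l) \<longrightarrow> L u = L v))"

definition mesh_translation :: "(real^'d) set set \<Rightarrow> real^'d \<Rightarrow> bool" where
  "mesh_translation T t \<longleftrightarrow> (\<lambda>e. (+) t ` e) ` T = T"

text \<open>The operators \<open>G\<close> and \<open>s\<close> act componentwise, so they are given by their action on scalar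
  mesh functions, and exactness is required for scalar polynomials: \<open>G u j\<close> is the approximate
  gradient at the node \<open>j\<close>.\<close>

definition gradient_approximation ::
  "(real^'d::finite) set set \<Rightarrow> ((real^'d \<Rightarrow> real) \<Rightarrow> real^'d \<Rightarrow> real^'d) \<Rightarrow> bool" where
  "gradient_approximation T G \<longleftrightarrow>
     (\<forall>j\<in>nodes T. \<forall>i. finite_stencil_functional T (\<lambda>u. G u j $ i)) \<and>
     (\<forall>q\<in>polynomials_upto 2. \<forall>j\<in>nodes T. G (nodal_values T q) j = gradient q j) \<and>
     (\<forall>t u. mesh_translation T t \<longrightarrow> (\<forall>j\<in>nodes T. G u (j + t) = G (\<lambda>l. u (l + t)) j))"

definition extended_Galerkin ::
  "(real^'d::finite) set set \<Rightarrow> (real^'d \<Rightarrow> real^'d \<Rightarrow> (real^'d \<Rightarrow> real) \<Rightarrow> real) \<Rightarrow> bool" where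
  "extended_Galerkin T s \<longleftrightarrow>
     (\<forall>j\<in>nodes T. \<forall>k\<in>neighbours T j.
        finite_stencil_functional T (s j k) \<and>
        (\<forall>q\<in>polynomials_upto 2. s j k (nodal_values T q) =
           q j - real CARD('d) / (4 * (real CARD('d) + 2)) * ((directional_deriv (k - j) ^^ 2) q) j) \<and>
        (\<forall>t u. mesh_translation T t \<longrightarrow> s (j + t) (k + t) u = s j k (\<lambda>l. u (l + t))))"

definition volume_weight :: "(real^'d::finite) set set \<Rightarrow> real^'d \<Rightarrow> real^'d \<Rightarrow> real" where
  "volume_weight T j k = 1 / (2 * real CARD('d)) * ((k - j) \<bullet> face_normal T j k)"

definition reconstruction ::
  "((real^'d::finite \<Rightarrow> real) \<Rightarrow> real^'d \<Rightarrow> real^'d) \<Rightarrow>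
   real^'d \<Rightarrow> real^'d \<Rightarrow> (real^'d \<Rightarrow> real^'n::finite) \<Rightarrow> real^'n" where
  "reconstruction G j k u = u j + (\<chi> c. ((1/2) *\<^sub>R (k - j)) \<bullet> G (\<lambda>l. u l $ c) j)"

definition flux ::
  "(real^'d::finite) set set \<Rightarrow> ('d \<Rightarrow> real^'n::finite^'n) \<Rightarrow> ((real^'d \<Rightarrow> real) \<Rightarrow> real^'d \<Rightarrow> real^'d) \<Rightarrow>
   real^'d \<Rightarrow> real^'d \<Rightarrow> (real^'d \<Rightarrow> real^'n) \<Rightarrow> real^'n" where
  "flux T A G j k u =
     (let B = matrix_dot A (face_normal T j k) in
        ((1/2) *\<^sub>R (B + matrix_abs B)) *v reconstruction G j k u +
        ((1/2) *\<^sub>R (B - matrix_abs B)) *v reconstruction G k j u)"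

definition truncation_error ::
  "(real^'d::finite) set set \<Rightarrow> ('d \<Rightarrow> real^'n::finite^'n) \<Rightarrow> ((real^'d \<Rightarrow> real) \<Rightarrow> real^'d \<Rightarrow> real^'d) \<Rightarrow>
   (real^'d \<Rightarrow> real^'d \<Rightarrow> (real^'d \<Rightarrow> real) \<Rightarrow> real) \<Rightarrow> (real^'d \<Rightarrow> real^'n) \<Rightarrow> real^'d \<Rightarrow> real^'n" where
  "truncation_error T A G s f j = (1 / measure lebesgue (control_volume T j)) *\<^sub>R
     (- (\<Sum>k\<in>neighbours T j. volume_weight T j k *\<^sub>R
            (\<chi> c. s j k (\<lambda>l. nodal_values T (advection A f) l $ c)))
      + (\<Sum>k\<in>neighbours T j. flux T A G j k (nodal_values T f)))"

end

theory Submission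
  imports Defs
begin

text \<open>Summed over the nodes of one period, \<open>|K\<^sub>j| \<epsilon>\<^sub>j\<close> is a sum of fluxes minus a sum of sources.  Fluxes
through a face are antisymmetric, but for a polynomial \<open>f\<close> they are not periodic, so they do not
cancel.  The proof rewrites everything in terms of periodic quantities; those can be moved between
nodes freely, because over one period the total of what leaves the nodes is the total of what
arrives (\<open>mass_transport\<close>).  Since cubic polynomials are sums of cubes of affine functions \<open>\<ell>\<close>
(\<open>cubic_sum_of_cubes\<close>) and all terms are linear in \<open>f\<close>, each component may be taken to be one cube.

Fluxes.  Put \<open>\<delta> = r\<^sub>k - r\<^sub>j\<close> and \<open>h\<^sub>j\<^sub>k = (f\<^sub>j + f\<^sub>k)/2 + (\<nabla>f\<^sub>j - \<nabla>f\<^sub>k) \<cdot> \<delta>/4\<close>, which is symmetric in \<open>j, k\<close>.  On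
quadratic polynomials the reconstructions from both ends of an edge equal \<open>h\<^sub>j\<^sub>k\<close>, by 2-exactness of
the gradient.  A translation changes a cubic polynomial by a quadratic one, so for cubic \<open>f\<close> the
difference \<open>R\<^sub>j\<^sub>k[f] - h\<^sub>j\<^sub>k\<close> is periodic (\<open>reconstruction_excess_periodic\<close>).  Therefore
\<open>F\<^sub>j\<^sub>k = (A \<cdot> n\<^sub>j\<^sub>k) h\<^sub>j\<^sub>k + y\<^sub>j\<^sub>k\<close> with \<open>y\<close> antisymmetric and periodic, and the \<open>y\<^sub>j\<^sub>k\<close> add up to zero.

Geometry.  With \<open>\<lambda>\<^sub>l\<close> the barycentric coordinates of a simplex \<open>e\<close>, the face normal \<open>n\<^sub>j\<^sub>k\<close> is a constant
times the sum of \<open>|e| (\<nabla>\<lambda>\<^sub>k - \<nabla>\<lambda>\<^sub>j)\<close> over the simplexes on the edge \<open>jk\<close> (\<open>face_normal_formula\<close>).  What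
remains to be shown is homogeneous in the normals, so it is enough that the constant is the same
for all simplexes and edges, and this holds because all simplexes are affinely equivalent.

Elements.  It remains to show that, for \<open>f = \<ell>\<^sup>3\<close> and every direction \<open>v\<close>, the terms
\<open>(n\<^sub>j\<^sub>k \<cdot> v) h\<^sub>j\<^sub>k - v\<^sub>j\<^sub>k (1 - d/(4(d+2)) (\<delta> \<cdot> \<nabla>)\<^sup>2) \<partial>\<^sub>v f(r\<^sub>j)\<close> add up to zero.  By the formula for the normals
they are, up to a constant factor, sums of contributions \<open>D\<^sub>e\<^sub>j\<close> of simplexes \<open>e\<close> with vertex \<open>j\<close>.  Add to \<open>D\<^sub>e\<^sub>j\<close> the integral
over \<open>e\<close> of \<open>(d+1) \<partial>\<^sub>v(\<lambda>\<^sub>j \<Psi>\<^sub>j)\<close>, where \<open>\<Psi>\<^sub>j(x) = f(x) - \<nabla>f(x) \<cdot> (x - r\<^sub>j)/2\<close>.  Then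
\<^item> for fixed \<open>j\<close> the additions cancel, because \<open>\<lambda>\<^sub>j\<close> is on the star of \<open>j\<close> a Lipschitz hat function
  with compact support (\<open>hat_function_by_parts\<close>);
\<^item> for fixed \<open>e\<close> the corrected contributions add up to zero: \<open>h\<close> drops out by symmetry, the sum of
  the \<open>\<lambda>\<^sub>j \<Psi>\<^sub>j\<close> is \<open>f\<close>, and averaging \<open>1 - d/(4(d+2)) (\<delta> \<cdot> \<nabla>)\<^sup>2\<close> over the directed edges is the quadrature
  rule on \<open>e\<close> that is exact for quadratic polynomials (\<open>element_balance\<close>);
\<^item> the corrected contribution depends on \<open>\<ell>\<close> only through \<open>\<ell> - \<ell>(r\<^sub>j)\<close>, so it is periodic
  (\<open>element_local\<close>).
By mass transport the sum over the simplexes around each node can be replaced by the sum over the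
vertices of each simplex, which vanishes (\<open>element_defects_cancel\<close>).\<close>

section \<open>Volume under affine maps\<close>

text \<open>A copy of an index type with a chosen well-order.  Relabelling the coordinates along it makes the
  determinant formula for the volume of linear images, which is about well-ordered index types,
  applicable to every finite index type.\<close>

typedef 'd ordered_index = "UNIV :: 'd set" by simp

definition index_rank :: "'d::finite ordered_index \<Rightarrow> nat" where
  "index_rank i = (SOME f. inj f) (Rep_ordered_index i)"

lemma inj_index_rank: "inj (index_rank :: 'd::finite ordered_index \<Rightarrow> nat)"
proof -
  have "\<exists>f :: 'd \<Rightarrow> nat. inj f" using finite_imp_inj_to_nat_seg[of "UNIV :: 'd set"] by auto
  then have "inj (SOME f :: 'd \<Rightarrow> nat. inj f)" by (rule someI_ex)
  then show ?thesis unfolding index_rank_def inj_def using Rep_ordered_index_inject by blast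
qed

instantiation ordered_index :: (finite) "{finite, wellorder}"
begin

definition "i \<le> k \<longleftrightarrow> index_rank i \<le> index_rank k"
definition "i < k \<longleftrightarrow> index_rank i < index_rank k"

instance
proof
  show "finite (UNIV :: 'a ordered_index set)"
    using finite_imageD[of "index_rank" "UNIV :: 'a ordered_index set"] inj_index_rank
    by (metis Rep_ordered_index_inject ex_new_if_finite finite finite_imageD inj_def iso_tuple_UNIV_I)
next
  fix P :: "'a ordered_index \<Rightarrow> bool" and i :: "'a ordered_index"
  assume step: "\<And>x. (\<And>y. y < x \<Longrightarrow> P y) \<Longrightarrow> P x"
  show "P i"
    by (induction i rule: measure_induct_rule[of index_rank]) (use step less_ordered_index_def in blast)
next
  fix i k :: "'a ordered_index"
  show "i \<le> k \<Longrightarrow> k \<le> i \<Longrightarrow> i = k"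
    using inj_index_rank by (auto simp: less_eq_ordered_index_def inj_def)
qed (auto simp: less_eq_ordered_index_def less_ordered_index_def)

end

definition to_ordered :: "real^'d::finite \<Rightarrow> real^'d ordered_index" where
  "to_ordered x = (\<chi> i. x $ Rep_ordered_index i)"

definition from_ordered :: "real^'d::finite ordered_index \<Rightarrow> real^'d" where
  "from_ordered y = (\<chi> i. y $ Abs_ordered_index i)"

lemma from_to_ordered [simp]: "from_ordered (to_ordered x) = x"
  by (simp add: from_ordered_def to_ordered_def Abs_ordered_index_inverse)

lemma to_from_ordered [simp]: "to_ordered (from_ordered x) = x"
  by (simp add: from_ordered_def to_ordered_def Rep_ordered_index_inverse)

lemma linear_to_ordered: "linear to_ordered"
  by (rule linearI) (auto simp: to_ordered_def vec_eq_iff)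

lemma linear_from_ordered: "linear from_ordered"
  by (rule linearI) (auto simp: from_ordered_def vec_eq_iff)

lemma bij_Rep_ordered_index: "bij (Rep_ordered_index :: 'd ordered_index \<Rightarrow> 'd)"
  by (metis Abs_ordered_index_inverse Rep_ordered_index_inverse UNIV_I bijI')

lemma inner_to_ordered: "to_ordered x \<bullet> to_ordered y = x \<bullet> y"
  unfolding inner_vec_def to_ordered_def
  using sum.reindex_bij_betw[OF bij_Rep_ordered_index, of "\<lambda>i. x $ i \<bullet> y $ i"] by simp

lemma prod_Basis_vec: "(\<Prod>b\<in>Basis. (x::real^'m::finite) \<bullet> b) = (\<Prod>i\<in>UNIV. x $ i)"
proof -
  have "(Basis :: (real^'m) set) = (\<lambda>i. axis i 1) ` UNIV" by (auto simp: Basis_vec_def)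
  moreover have "inj (\<lambda>i::'m. axis i (1::real))" by (simp add: inj_def axis_eq_axis)
  ultimately have "prod ((\<bullet>) x) Basis = prod ((\<bullet>) x \<circ> (\<lambda>i. axis i 1)) UNIV"
    by (metis prod.reindex)
  then show ?thesis by (simp add: inner_axis comp_def)
qed

text \<open>Relabelling the coordinates maps boxes to boxes with the same side lengths.\<close>

lemma distr_to_ordered: "distr lborel borel (to_ordered :: real^'d::finite \<Rightarrow> _) = lborel"
proof (rule lborel_eqI[symmetric])
  fix l u :: "real^'d ordered_index"
  assume lu: "\<And>b. b \<in> Basis \<Longrightarrow> l \<bullet> b \<le> u \<bullet> b"
  have le: "l $ i \<le> u $ i" for i using lu[of "axis i 1"] by (simp add: inner_axis)
  have mb: "to_ordered \<in> borel_measurable (borel :: (real^'d) measure)"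
    using linear_continuous_on[OF linear_to_ordered[unfolded linear_conv_bounded_linear]]
    by (rule borel_measurable_continuous_onI)
  have "to_ordered -` box l u = box (from_ordered l) (from_ordered u)"
    unfolding from_ordered_def to_ordered_def vimage_def mem_box_cart
    by (auto simp: mem_box_cart) (metis Abs_ordered_index_inverse Rep_ordered_index_inverse UNIV_I)+
  then have "emeasure (distr lborel borel to_ordered) (box l u) = emeasure lborel (box (from_ordered l) (from_ordered u))"
    using mb by (subst emeasure_distr) (auto simp: )
  also have "\<dots> = ennreal (\<Prod>b\<in>Basis. (from_ordered u - from_ordered l) \<bullet> b)"
  proof (rule emeasure_lborel_box)
    fix b :: "real^'d" assume "b \<in> Basis"
    then obtain i where "b = axis i 1" by (auto simp: Basis_vec_def)
    then show "from_ordered l \<bullet> b \<le> from_ordered u \<bullet> b" using le by (simp add: inner_axis from_ordered_def)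
  qed
  also have "(\<Prod>b\<in>Basis. (from_ordered u - from_ordered l) \<bullet> b) = (\<Prod>b\<in>Basis. (u - l) \<bullet> b)"
    unfolding prod_Basis_vec from_ordered_def
    using prod.reindex_bij_betw[OF bij_Rep_ordered_index, of "\<lambda>i. u $ Abs_ordered_index i - l $ Abs_ordered_index i"]
    by (simp add: Rep_ordered_index_inverse)
  finally show "emeasure (distr lborel borel to_ordered) (box l u) = ennreal (\<Prod>b\<in>Basis. (u - l) \<bullet> b)" .
qed simp


lemma measurable_linear:
  fixes L :: "'a::euclidean_space \<Rightarrow> 'b::euclidean_space"
  shows "linear L \<Longrightarrow> L \<in> borel_measurable borel"
  by (intro borel_measurable_continuous_onI linear_continuous_on) (simp add: linear_conv_bounded_linear)

lemma distr_from_ordered: "distr lborel borel (from_ordered :: _ \<Rightarrow> real^'d::finite) = lborel"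
proof -
  note [measurable] = measurable_linear[OF linear_to_ordered] measurable_linear[OF linear_from_ordered]
  have "distr lborel borel (from_ordered :: _ \<Rightarrow> real^'d) =
      distr (distr lborel borel to_ordered) borel from_ordered"
    by (simp add: distr_to_ordered)
  also have "\<dots> = distr lborel borel (from_ordered \<circ> to_ordered)" by (rule distr_distr) auto
  also have "(from_ordered \<circ> to_ordered) = (\<lambda>x::real^'d. x)" by auto
  finally show ?thesis by (simp add: distr_id2)
qed

text \<open>For an affine bijection, \<open>r\<close> is the modulus of the determinant of its linear part.  The condition is
  on preimages because all sets met below are given by inequalities between coordinates, and these
  are easy to pull back.\<close>

definition scales_volume :: "('a::euclidean_space \<Rightarrow> 'a) \<Rightarrow> real \<Rightarrow> bool" where
  "scales_volume M r \<longleftrightarrow> 0 < r \<and> M \<in> borel_measurable borel \<and>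
     (\<forall>A\<in>sets borel. emeasure lborel A = ennreal r * emeasure lborel (M -` A))"

lemma scales_volume_emeasure:
  "scales_volume M r \<Longrightarrow> A \<in> sets borel \<Longrightarrow> emeasure lborel A = ennreal r * emeasure lborel (M -` A)"
  by (simp add: scales_volume_def)

lemma scales_volume_measure:
  "scales_volume M r \<Longrightarrow> A \<in> sets borel \<Longrightarrow> measure lborel A = r * measure lborel (M -` A)"
  using scales_volume_emeasure[of M r A] by (simp add: measure_def enn2real_mult scales_volume_def)

lemma scales_volume_iff_density:
  fixes M :: "'a::euclidean_space \<Rightarrow> 'a"
  shows "scales_volume M r \<longleftrightarrow> 0 < r \<and> M \<in> borel_measurable borel \<and>
    lborel = density (distr lborel borel M) (\<lambda>_. ennreal r)"
proof -
  have density: "emeasure (density (distr lborel borel M) (\<lambda>_. ennreal r)) A = ennreal r * emeasure lborel (M -` A)"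
    if [measurable]: "M \<in> borel_measurable borel" "A \<in> sets borel" for A
  proof -
    have "emeasure (density (distr lborel borel M) (\<lambda>_. ennreal r)) A =
        (\<integral>\<^sup>+x. ennreal r * indicator A x \<partial>distr lborel borel M)"
      by (subst emeasure_density) auto
    then show ?thesis
      by (subst (asm) nn_integral_cmult_indicator) (auto simp: emeasure_distr)
  qed
  show ?thesis
  proof
    assume M: "scales_volume M r"
    have "lborel = density (distr lborel borel M) (\<lambda>_. ennreal r)"
      by (rule measure_eqI) (use M density in \<open>auto simp: scales_volume_def\<close>)
    then show "0 < r \<and> M \<in> borel_measurable borel \<and> lborel = density (distr lborel borel M) (\<lambda>_. ennreal r)"
      using M by (simp add: scales_volume_def)
  qed (use density in \<open>auto simp: scales_volume_def\<close>)
qed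

lemma scales_volume_integral:
  fixes f :: "'a::euclidean_space \<Rightarrow> real"
  assumes "scales_volume M r" and [measurable]: "f \<in> borel_measurable borel"
  shows "(\<integral>x. f x \<partial>lborel) = r * (\<integral>x. f (M x) \<partial>lborel)"
proof -
  have [measurable]: "M \<in> borel_measurable borel" and r: "0 < r"
    and eq: "lborel = density (distr lborel borel M) (\<lambda>_. ennreal r)"
    using assms by (auto simp: scales_volume_iff_density)
  have "(\<integral>x. f x \<partial>lborel) = (\<integral>x. f x \<partial>density (distr lborel borel M) (\<lambda>_. ennreal r))"
    using eq by simp
  also have "\<dots> = (\<integral>x. r *\<^sub>R f x \<partial>distr lborel borel M)"
    using r by (subst integral_density) auto
  also have "\<dots> = (\<integral>x. r *\<^sub>R f (M x) \<partial>lborel)"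
    by (subst integral_distr) auto
  finally show ?thesis by simp
qed

lemma scales_volume_compose:
  fixes M N :: "'a::euclidean_space \<Rightarrow> 'a"
  assumes M: "scales_volume M r" and N: "scales_volume N t"
  shows "scales_volume (M \<circ> N) (r * t)"
  unfolding scales_volume_def
proof (intro conjI ballI)
  have [measurable]: "M \<in> borel_measurable borel" "N \<in> borel_measurable borel" and r: "0 < r" "0 < t"
    using assms by (auto simp: scales_volume_def)
  show "0 < r * t" using r by simp
  show "M \<circ> N \<in> borel_measurable borel" by measurable
  fix A :: "'a set" assume A [measurable]: "A \<in> sets borel"
  have "M -` A \<in> sets borel" using measurable_sets[of M borel borel A] by simp
  then show "emeasure lborel A = ennreal (r * t) * emeasure lborel ((M \<circ> N) -` A)"
    using scales_volume_emeasure[OF M A] scales_volume_emeasure[OF N] r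
    by (simp add: ennreal_mult mult.assoc vimage_comp)
qed

lemma scales_volume_translation: "scales_volume ((+) c) 1"
  by (simp add: scales_volume_iff_density lborel_distr_plus density_1)

text \<open>Lebesgue measure is determined by its values on boxes, and the preimage of a box is the image of the
  box under the inverse map, hence bounded.\<close>

lemma scales_volume_linear_ordered:
  fixes L :: "real^'m::{finite,wellorder} \<Rightarrow> real^'m::_"
  assumes L: "linear L" and d: "det (matrix L) \<noteq> 0"
  shows "scales_volume L \<bar>det (matrix L)\<bar>"
proof -
  let ?r = "\<bar>det (matrix L)\<bar>"
  have [measurable]: "L \<in> borel_measurable borel" using L by (rule measurable_linear)
  have inj: "inj L" using det_nz_iff_inj[OF L] d by simp
  then obtain K where K: "linear K" "\<And>x. K (L x) = x" "\<And>x. L (K x) = x"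
    using linear_injective_isomorphism[OF L] by auto
  have "lborel = density (distr lborel borel L) (\<lambda>_. ennreal ?r)"
  proof (rule lborel_eqI)
    fix l u :: "real^'m::_"
    assume lu: "\<And>b. b \<in> Basis \<Longrightarrow> l \<bullet> b \<le> u \<bullet> b"
    have vim: "L -` box l u = K ` box l u"
    proof (intro set_eqI iffI)
      fix x assume "x \<in> L -` box l u"
      then show "x \<in> K ` box l u" using K(2)[of x] by (intro image_eqI[of _ _ "L x"]) auto
    qed (use K(3) in auto)
    have bb [measurable]: "L -` box l u \<in> sets borel"
      using measurable_sets[of L borel borel "box l u"] by simp
    have bd: "bounded (L -` box l u)"
      unfolding vim using K(1) by (intro bounded_linear_image) (auto simp: linear_conv_bounded_linear)
    have lm: "L -` box l u \<in> lmeasurable"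
      using bd bb by (intro bounded_set_imp_lmeasurable) (auto simp: sets_completionI_sets)
    have "emeasure (density (distr lborel borel L) (\<lambda>_. ennreal ?r)) (box l u) =
        (\<integral>\<^sup>+x. ennreal ?r * indicator (box l u) x \<partial>distr lborel borel L)"
      by (subst emeasure_density) auto
    also have "\<dots> = ennreal ?r * emeasure lborel (L -` box l u)"
      by (subst nn_integral_cmult_indicator) (auto simp: emeasure_distr)
    also have "emeasure lborel (L -` box l u) = ennreal (measure lebesgue (L -` box l u))"
      using emeasure_bounded_finite[OF bd] bb by (simp add: emeasure_eq_ennreal_measure measure_completion)
    also have "ennreal ?r * ennreal (measure lebesgue (L -` box l u)) = ennreal (measure lebesgue (L ` (L -` box l u)))"
      using measure_linear_image[OF L lm] by (simp add: ennreal_mult)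
    also have "L ` (L -` box l u) = box l u"
      using K(3) by (intro surj_image_vimage_eq) (metis surjI)
    also have "measure lebesgue (box l u) = (\<Prod>b\<in>Basis. (u - l) \<bullet> b)"
      using lu by (simp add: measure_completion)
    finally show "emeasure (density (distr lborel borel L) (\<lambda>_. ennreal ?r)) (box l u) =
      ennreal (\<Prod>b\<in>Basis. (u - l) \<bullet> b)" .
  qed simp
  then show ?thesis using d by (simp add: scales_volume_iff_density)
qed

lemma scales_volume_linear:
  fixes L :: "real^'d::finite \<Rightarrow> real^'d"
  assumes L: "linear L" and d: "det (matrix (to_ordered \<circ> L \<circ> from_ordered)) \<noteq> 0"
  shows "scales_volume L \<bar>det (matrix (to_ordered \<circ> L \<circ> from_ordered))\<bar>"
proof -
  let ?L = "to_ordered \<circ> L \<circ> from_ordered"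
  have lin: "linear ?L" using L linear_to_ordered linear_from_ordered by (intro linear_compose)
  note [measurable] = measurable_linear[OF linear_from_ordered] measurable_linear[OF L]
  have from_ordered: "emeasure lborel (from_ordered -` A) = emeasure lborel A"
    if "A \<in> sets borel" for A :: "(real^'d) set"
    using emeasure_distr[of from_ordered lborel borel A] that by (simp add: distr_from_ordered)
  have "emeasure lborel A = ennreal \<bar>det (matrix ?L)\<bar> * emeasure lborel (L -` A)"
    if A [measurable]: "A \<in> sets borel" for A
  proof -
    have FA: "from_ordered -` A \<in> sets borel" and LA: "L -` A \<in> sets borel"
      using measurable_sets[of from_ordered borel borel A] measurable_sets[of L borel borel A] by simp_all
    have "emeasure lborel A = emeasure lborel (from_ordered -` A)" by (rule from_ordered[OF A, symmetric])
    also have "\<dots> = ennreal \<bar>det (matrix ?L)\<bar> * emeasure lborel (?L -` (from_ordered -` A))"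
      by (rule scales_volume_emeasure[OF scales_volume_linear_ordered[OF lin d] FA])
    also have "?L -` (from_ordered -` A) = from_ordered -` (L -` A)" by auto
    also have "emeasure lborel (from_ordered -` (L -` A)) = emeasure lborel (L -` A)" by (rule from_ordered[OF LA])
    finally show ?thesis .
  qed
  then show ?thesis using d measurable_linear[OF L] by (simp add: scales_volume_def)
qed

lemma scales_volume_affine:
  fixes L :: "real^'d::finite \<Rightarrow> real^'d"
  assumes L: "linear L" and inj: "inj L"
  shows "\<exists>r. scales_volume (\<lambda>x. c + L x) r"
proof -
  let ?L = "to_ordered \<circ> L \<circ> from_ordered"
  have lin: "linear ?L" using L linear_to_ordered linear_from_ordered by (intro linear_compose)
  have "inj ?L"
    using inj by (intro inj_compose) (metis from_to_ordered to_from_ordered inj_def)+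
  then have "det (matrix ?L) \<noteq> 0" using det_nz_iff_inj[OF lin] by simp
  from scales_volume_compose[OF scales_volume_translation scales_volume_linear[OF L this]]
  show ?thesis by (auto simp: comp_def)
qed

text \<open>If \<open>\<nu>\<^sub>k \<noteq> 0\<close>, let \<open>B\<close> be the identity matrix with row \<open>k\<close> replaced by \<open>\<nu>\<close>.  Conjugation with \<open>B\<close> turns
  the rank one matrix of \<open>w\<close> and \<open>\<nu>\<close> into a matrix with the single nonzero column \<open>k\<close>.  Cramer's rule
  evaluates both this determinant and the determinant of \<open>B\<close>.\<close>

lemma det_identity_plus_outer:
  fixes w \<nu> :: "real^'m::finite"
  shows "det (\<chi> i j. (if i = j then 1 else 0) + w $ i * \<nu> $ j) = 1 + \<nu> \<bullet> w"
proof (cases "\<nu> = 0")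
  case True
  have "(\<chi> i j. (if i = j then 1 else 0) + w $ i * \<nu> $ j) = (mat 1 :: real^'m^'m)"
    by (simp add: True mat_def)
  then show ?thesis using True by simp
next
  case False
  then obtain k where k: "\<nu> $ k \<noteq> 0" by (auto simp: vec_eq_iff)
  define N :: "real^'m^'m" where "N = (\<chi> i j. (if i = j then 1 else 0) + w $ i * \<nu> $ j)"
  define B :: "real^'m^'m" where "B = (\<chi> i. if i = k then \<nu> else row i (mat 1))"
  define P :: "real^'m^'m" where
    "P = (\<chi> i j. if j = k then (mat 1 *v (axis k 1 + B *v w)) $ i else (mat 1 :: real^'m^'m) $ i $ j)"
  have "(\<Sum>i\<in>UNIV. \<nu> $ i *s row i (mat 1)) = \<nu>"
    by (simp add: vec_eq_iff row_def mat_def if_distrib[of "\<lambda>x. _ * x"] cong: if_cong)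
  then have detB: "det B = \<nu> $ k"
    using cramer_lemma_transpose[of k \<nu> "mat 1 :: real^'m^'m"] unfolding B_def by (simp only: det_I mult_1_right)
  have Bw: "(B *v w) $ k = \<nu> \<bullet> w"
    by (simp add: B_def matrix_vector_mult_def inner_vec_def)
  have detP: "det P = 1 + \<nu> \<bullet> w"
    using cramer_lemma[of k "mat 1 :: real^'m^'m" "axis k 1 + B *v w"] by (simp add: P_def Bw)
  have entry: "P $ i $ j = (if i = j then 1 else 0) + (if j = k then (B *v w) $ i else 0)" for i j
    unfolding P_def matrix_vector_mul_lid by (auto simp: mat_def axis_def)
  have Bent: "B $ k $ j = \<nu> $ j" for j by (simp add: B_def)
  have "(B ** N) $ i $ j = (P ** B) $ i $ j" for i j
  proof -
    have "(B ** N) $ i $ j = (\<Sum>m\<in>UNIV. B $ i $ m * (if m = j then 1 else 0)) + (\<Sum>m\<in>UNIV. B $ i $ m * w $ m) * \<nu> $ j"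
      by (simp add: matrix_matrix_mult_def N_def distrib_left sum.distrib sum_distrib_right mult.assoc)
    also have "\<dots> = B $ i $ j + (B *v w) $ i * \<nu> $ j"
      by (simp add: matrix_vector_mult_def if_distrib[of "\<lambda>x. _ * x"] cong: if_cong)
    also have "\<dots> = (\<Sum>m\<in>UNIV. (if i = m then 1 else 0) * B $ m $ j) + (\<Sum>m\<in>UNIV. (if m = k then (B *v w) $ i else 0) * B $ m $ j)"
      by (simp add: if_distrib[of "\<lambda>x. x * _"] Bent cong: if_cong)
    also have "\<dots> = (P ** B) $ i $ j"
      by (simp add: matrix_matrix_mult_def entry distrib_right sum.distrib)
    finally show ?thesis .
  qed
  then have "B ** N = P ** B" by (simp add: vec_eq_iff)
  then have "det B * det N = det P * det B" by (metis det_mul)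
  then show ?thesis using k detB detP by (simp add: N_def)
qed

text \<open>The map fixes the hyperplane \<open>\<nu> \<bullet> x = c\<close> and, if \<open>\<nu>\<close> is a unit vector, takes its normal \<open>\<nu>\<close> to
  \<open>\<nu> + w\<close>; so it tilts right prisms over subsets of the hyperplane.\<close>

lemma scales_volume_shear:
  fixes w \<nu> :: "real^'d::finite"
  assumes "1 + \<nu> \<bullet> w \<noteq> 0"
  shows "scales_volume (\<lambda>x. x + (\<nu> \<bullet> x - c) *\<^sub>R w) \<bar>1 + \<nu> \<bullet> w\<bar>"
proof -
  define L where "L x = x + (\<nu> \<bullet> x) *\<^sub>R w" for x
  have L: "linear L" unfolding L_def by (rule linearI) (auto simp: algebra_simps inner_add_right)
  have "matrix (to_ordered \<circ> L \<circ> from_ordered) =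
      (\<chi> i j. (if i = j then 1 else 0) + to_ordered w $ i * to_ordered \<nu> $ j)"
  proof -
    have "(to_ordered \<circ> L \<circ> from_ordered) y = y + (to_ordered \<nu> \<bullet> y) *\<^sub>R to_ordered w" for y
    proof -
      have "\<nu> \<bullet> from_ordered y = to_ordered \<nu> \<bullet> y"
        using inner_to_ordered[of \<nu> "from_ordered y"] by simp
      then show ?thesis
        by (simp add: L_def linear_add[OF linear_to_ordered] linear_cmul[OF linear_to_ordered])
    qed
    then show ?thesis by (auto simp: matrix_def vec_eq_iff inner_axis mult.commute) (auto simp: axis_def)
  qed
  then have d: "det (matrix (to_ordered \<circ> L \<circ> from_ordered)) = 1 + \<nu> \<bullet> w"
    using det_identity_plus_outer[of "to_ordered w" "to_ordered \<nu>"] by (simp add: inner_to_ordered)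
  have "scales_volume ((+) (- (c *\<^sub>R w)) \<circ> L) (1 * \<bar>1 + \<nu> \<bullet> w\<bar>)"
    using scales_volume_compose[OF scales_volume_translation scales_volume_linear[OF L]] assms d by metis
  moreover have "(+) (- (c *\<^sub>R w)) \<circ> L = (\<lambda>x. x + (\<nu> \<bullet> x - c) *\<^sub>R w)"
    by (auto simp: L_def algebra_simps)
  ultimately show ?thesis by simp
qed

section \<open>Barycentric coordinates\<close>

definition full_simplex :: "(real^'d::finite) set \<Rightarrow> bool" where
  "full_simplex e \<longleftrightarrow> \<not> affine_dependent e \<and> card e = CARD('d) + 1"

text \<open>Barycentric coordinates, as a function of the vertex.  They are 0 at points that are not vertices of
  \<open>e\<close>, so that coordinates with respect to different simplexes of a mesh can be compared as functions.\<close>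

definition bary :: "(real^'d::finite) set \<Rightarrow> real^'d \<Rightarrow> real^'d \<Rightarrow> real" where
  "bary e x = (SOME u. (\<Sum>l\<in>e. u l) = 1 \<and> (\<Sum>l\<in>e. u l *\<^sub>R l) = x \<and> (\<forall>l. l \<notin> e \<longrightarrow> u l = 0))"

text \<open>The gradient of the affine function \<open>\<lambda>x. bary e x l\<close>, read off from its increments along the axes.\<close>

definition bary_grad :: "(real^'d::finite) set \<Rightarrow> real^'d \<Rightarrow> real^'d" where
  "bary_grad e l = (\<chi> i. bary e (axis i 1) l - bary e 0 l)"

lemma full_simplex_finite: "full_simplex e \<Longrightarrow> finite e"
  by (simp add: full_simplex_def aff_independent_finite)

lemma full_simplex_affine_hull:
  assumes "full_simplex (e :: (real^'d::finite) set)"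
  shows "affine hull e = UNIV"
  using assms affine_independent_span_eq[of e] by (simp add: full_simplex_def)

lemma bary_exists:
  assumes e: "full_simplex e"
  shows "(\<Sum>l\<in>e. bary e x l) = 1" and "(\<Sum>l\<in>e. bary e x l *\<^sub>R l) = x"
    and "l \<notin> e \<Longrightarrow> bary e x l = 0"
proof -
  have "x \<in> affine hull e" using full_simplex_affine_hull[OF e] by simp
  then obtain u where u: "sum u e = 1" "(\<Sum>v\<in>e. u v *\<^sub>R v) = x"
    using affine_hull_finite[OF full_simplex_finite[OF e]] by auto
  let ?u = "\<lambda>l. if l \<in> e then u l else 0"
  have 1: "sum ?u e = 1" using u(1) by simp
  have 2: "(\<Sum>v\<in>e. ?u v *\<^sub>R v) = x" using u(2) by (simp cong: sum.cong)
  have "\<exists>u. (\<Sum>l\<in>e. u l) = 1 \<and> (\<Sum>l\<in>e. u l *\<^sub>R l) = x \<and> (\<forall>l. l \<notin> e \<longrightarrow> u l = 0)"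
    by (rule exI[of _ ?u]) (use 1 2 in simp)
  from someI_ex[OF this, folded bary_def]
  show "(\<Sum>l\<in>e. bary e x l) = 1" "(\<Sum>l\<in>e. bary e x l *\<^sub>R l) = x"
    "l \<notin> e \<Longrightarrow> bary e x l = 0" by auto
qed

lemmas bary_sum = bary_exists(1) and bary_repr = bary_exists(2) and bary_outside = bary_exists(3)

lemma bary_unique:
  assumes e: "full_simplex e" and u: "(\<Sum>l\<in>e. u l) = 1" "(\<Sum>l\<in>e. u l *\<^sub>R l) = x" and l: "l \<in> e"
  shows "bary e x l = u l"
proof (rule ccontr)
  assume ne: "bary e x l \<noteq> u l"
  have "(\<Sum>v\<in>e. bary e x v - u v) = 0" using bary_sum[OF e] u by (simp add: sum_subtractf)
  moreover have "(\<Sum>v\<in>e. (bary e x v - u v) *\<^sub>R v) = 0"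
    using bary_repr[OF e] u by (simp add: sum_subtractf scaleR_left_diff_distrib)
  moreover have "bary e x l - u l \<noteq> 0" using ne by simp
  ultimately have "affine_dependent e"
    unfolding affine_dependent_explicit_finite[OF full_simplex_finite[OF e]]
    using l by (intro exI[of _ "\<lambda>v. bary e x v - u v"]) blast
  then show False using e by (simp add: full_simplex_def)
qed

lemma bary_vertex:
  assumes e: "full_simplex e" and k: "k \<in> e"
  shows "bary e k l = (if l = k then 1 else 0)"
proof (cases "l \<in> e")
  case True
  have fin: "finite e" using e by (rule full_simplex_finite)
  have "(\<Sum>v\<in>e. (if v = k then 1 else 0) *\<^sub>R v) = (\<Sum>v\<in>e. if v = k then k else 0)"
    by (rule sum.cong) auto
  then show ?thesis using k fin True
    by (intro bary_unique[OF e, of "\<lambda>v. if v = k then 1 else 0"]) auto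
qed (use k bary_outside[OF e] in auto)

text \<open>Combining the representations of the points gives a representation of the combined point, and the
  representation is unique.\<close>

lemma bary_combination:
  assumes e: "full_simplex e" and t: "(\<Sum>i\<in>I. t i) = 1" and "finite I"
  shows "bary e (\<Sum>i\<in>I. t i *\<^sub>R x i) l = (\<Sum>i\<in>I. t i * bary e (x i) l)"
proof (cases "l \<in> e")
  case True
  show ?thesis
  proof (rule bary_unique[OF e _ _ True])
    have "(\<Sum>l\<in>e. \<Sum>i\<in>I. t i * bary e (x i) l) = (\<Sum>i\<in>I. \<Sum>l\<in>e. t i * bary e (x i) l)"
      by (rule sum.swap)
    then show "(\<Sum>l\<in>e. \<Sum>i\<in>I. t i * bary e (x i) l) = 1"
      using t bary_sum[OF e] by (simp add: sum_distrib_left[symmetric])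
    have "(\<Sum>l\<in>e. (\<Sum>i\<in>I. t i * bary e (x i) l) *\<^sub>R l) = (\<Sum>l\<in>e. \<Sum>i\<in>I. t i *\<^sub>R (bary e (x i) l *\<^sub>R l))"
      by (simp add: scaleR_sum_left)
    also have "\<dots> = (\<Sum>i\<in>I. \<Sum>l\<in>e. t i *\<^sub>R (bary e (x i) l *\<^sub>R l))"
      by (rule sum.swap)
    finally show "(\<Sum>l\<in>e. (\<Sum>i\<in>I. t i * bary e (x i) l) *\<^sub>R l) = (\<Sum>i\<in>I. t i *\<^sub>R x i)"
      using bary_repr[OF e] by (simp only: scaleR_sum_right[symmetric])
  qed
qed (simp add: bary_outside[OF e])

text \<open>Every point is an affine combination of the origin and the unit vectors.\<close>

lemma bary_affine:
  assumes e: "full_simplex e"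
  shows "bary e x l = bary e y l + bary_grad e l \<bullet> (x - y)"
proof -
  have *: "bary e x l = bary e 0 l + bary_grad e l \<bullet> x" for x :: "real^'a"
  proof -
    define t :: "'a option \<Rightarrow> real" where
      "t i = (case i of None \<Rightarrow> 1 - (\<Sum>i\<in>UNIV. x $ i) | Some i \<Rightarrow> x $ i)" for i
    define p :: "'a option \<Rightarrow> real^'a" where "p i = (case i of None \<Rightarrow> 0 | Some i \<Rightarrow> axis i 1)" for i
    have split: "(\<Sum>i\<in>UNIV. g i) = g None + (\<Sum>i\<in>UNIV. g (Some i))" for g :: "'a option \<Rightarrow> 'b::comm_monoid_add"
      by (simp add: UNIV_option_conv sum.reindex)
    have "(\<Sum>i\<in>UNIV. t i) = 1" by (simp add: split t_def)
    moreover have "(\<Sum>i\<in>UNIV. t i *\<^sub>R p i) = x"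
      by (simp add: split t_def p_def) (simp add: vec_eq_iff axis_def if_distrib[of "\<lambda>x. _ * x"] cong: if_cong)
    ultimately have "bary e x l = (\<Sum>i\<in>UNIV. t i * bary e (p i) l)"
      using bary_combination[OF e, of t UNIV p l] by simp
    moreover have "bary_grad e l \<bullet> x = (\<Sum>i\<in>UNIV. x $ i * bary e (axis i 1) l) - (\<Sum>i\<in>UNIV. x $ i) * bary e 0 l"
      by (simp add: bary_grad_def inner_vec_def right_diff_distrib sum_subtractf sum_distrib_right mult.commute)
    ultimately show ?thesis
      by (simp add: split t_def p_def left_diff_distrib)
  qed
  show ?thesis using *[of x] *[of y] by (simp add: inner_diff_right)
qed

lemma bary_grad_outside: "full_simplex e \<Longrightarrow> l \<notin> e \<Longrightarrow> bary_grad e l = 0"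
  by (simp add: bary_grad_def bary_outside vec_eq_iff)

lemma bary_grad_sum: "full_simplex e \<Longrightarrow> (\<Sum>l\<in>e. bary_grad e l) = 0"
  by (simp add: bary_grad_def vec_eq_iff sum_subtractf bary_sum)

text \<open>Both sides are the derivative in direction \<open>v\<close> of \<open>x \<mapsto> a \<bullet> x\<close>; the left one is that of its
  interpolation from the vertices, which is exact.\<close>

lemma bary_grad_moment:
  assumes e: "full_simplex e"
  shows "(\<Sum>l\<in>e. (a \<bullet> l) * (bary_grad e l \<bullet> v)) = a \<bullet> v"
proof -
  have "bary_grad e l \<bullet> v = bary e v l - bary e 0 l" for l
    using bary_affine[OF e, of v l 0] by simp
  then have "(\<Sum>l\<in>e. (a \<bullet> l) * (bary_grad e l \<bullet> v)) =
      (\<Sum>l\<in>e. a \<bullet> (bary e v l *\<^sub>R l)) - (\<Sum>l\<in>e. a \<bullet> (bary e 0 l *\<^sub>R l))"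
    by (simp add: right_diff_distrib sum_subtractf mult.commute)
  also have "\<dots> = a \<bullet> v"
    unfolding inner_sum_right[symmetric] bary_repr[OF e] by simp
  finally show ?thesis .
qed

lemma bary_interpolates:
  assumes e: "full_simplex e"
  shows "(\<Sum>l\<in>e. bary e x l * (a \<bullet> l + b)) = a \<bullet> x + b"
proof -
  have "(\<Sum>l\<in>e. bary e x l * (a \<bullet> l + b)) = a \<bullet> (\<Sum>l\<in>e. bary e x l *\<^sub>R l) + (\<Sum>l\<in>e. bary e x l) * b"
    by (simp add: inner_sum_right distrib_left sum.distrib sum_distrib_right)
  then show ?thesis using bary_repr[OF e] bary_sum[OF e] by simp
qed

lemma bary_grad_edge:
  assumes e: "full_simplex e" and "j \<in> e" "k \<in> e"
  shows "bary_grad e l \<bullet> (k - j) = (if l = k then 1 else 0) - (if l = j then 1 else 0)"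
  using bary_affine[OF e, of k l j] bary_vertex[OF e] assms by simp

lemma continuous_bary: "full_simplex e \<Longrightarrow> continuous_on S (\<lambda>x. bary e x l)"
  by (subst bary_affine[of e _ l 0]) (auto intro!: continuous_intros)

lemma measurable_bary: "full_simplex e \<Longrightarrow> (\<lambda>x. bary e x l) \<in> borel_measurable borel"
  by (intro borel_measurable_continuous_onI continuous_bary)

lemma in_hull_iff:
  assumes e: "full_simplex e"
  shows "x \<in> convex hull e \<longleftrightarrow> (\<forall>l\<in>e. 0 \<le> bary e x l)"
proof
  assume "x \<in> convex hull e"
  then obtain u where u: "\<forall>x\<in>e. 0 \<le> u x" "sum u e = 1" "(\<Sum>x\<in>e. u x *\<^sub>R x) = x"
    using convex_hull_finite[OF full_simplex_finite[OF e]] by auto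
  then show "\<forall>l\<in>e. 0 \<le> bary e x l" using bary_unique[OF e u(2,3)] by simp
next
  assume "\<forall>l\<in>e. 0 \<le> bary e x l"
  then show "x \<in> convex hull e"
    using convex_hull_finite[OF full_simplex_finite[OF e]] bary_sum[OF e] bary_repr[OF e] by blast
qed

lemma bary_of_face:
  assumes e: "full_simplex e" and c: "c \<subseteq> e" and u: "(\<Sum>l\<in>c. u l) = 1" "(\<Sum>l\<in>c. u l *\<^sub>R l) = x"
  shows "bary e x l = (if l \<in> c then u l else 0)"
proof -
  have fin: "finite e" "finite c" using full_simplex_finite[OF e] c finite_subset by auto
  let ?u = "\<lambda>l. if l \<in> c then u l else 0"
  have "sum ?u e = 1" using u(1) fin c by (simp add: sum.If_cases Int_absorb1)
  moreover have "(\<Sum>v\<in>e. ?u v *\<^sub>R v) = (\<Sum>v\<in>e. if v \<in> c then u v *\<^sub>R v else 0)"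
    by (rule sum.cong) auto
  then have "(\<Sum>v\<in>e. ?u v *\<^sub>R v) = x" using u(2) fin c by (simp add: sum.If_cases Int_absorb1)
  ultimately show ?thesis
    using bary_unique[OF e, of ?u x l] bary_outside[OF e, of l x] c by (cases "l \<in> e") auto
qed

lemma bary_grad_nonzero:
  assumes e: "full_simplex e" and "l \<in> e" "k \<in> e" "k \<noteq> l"
  shows "bary_grad e l \<noteq> 0"
  using bary_grad_edge[OF e assms(3,2), of l] assms by auto

lemma full_simplex_other_vertex:
  assumes "full_simplex e" "l \<in> e"
  obtains k where "k \<in> e" "k \<noteq> l"
proof -
  have "card e > 1" using assms by (simp add: full_simplex_def)
  then have "\<not> e \<subseteq> {l}" using card_mono[of "{l}" e] by auto
  then show thesis using that by auto
qed

lemma full_simplex_translate: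
  fixes z :: "real^'d::finite"
  assumes "full_simplex e"
  shows "full_simplex ((+) z ` e)"
  using assms by (simp add: full_simplex_def affine_dependent_translation_eq[symmetric] card_image)

lemma bary_translate:
  assumes e: "full_simplex e"
  shows "bary ((+) z ` e) (z + x) (z + l) = bary e x l"
proof (cases "l \<in> e")
  case True
  have "bary ((+) z ` e) (z + x) (z + l) = bary e x (z + l - z)"
  proof (rule bary_unique[OF full_simplex_translate[OF e]])
    show "(\<Sum>l\<in>(+) z ` e. bary e x (l - z)) = 1" by (simp add: sum.reindex bary_sum[OF e])
    have "(\<Sum>l\<in>(+) z ` e. bary e x (l - z) *\<^sub>R l) = (\<Sum>l\<in>e. bary e x l *\<^sub>R z + bary e x l *\<^sub>R l)"
      by (simp add: sum.reindex scaleR_add_right)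
    then show "(\<Sum>l\<in>(+) z ` e. bary e x (l - z) *\<^sub>R l) = z + x"
      using bary_sum[OF e] bary_repr[OF e] by (simp add: sum.distrib scaleR_sum_left[symmetric])
    show "z + l \<in> (+) z ` e" using True by simp
  qed
  then show ?thesis by simp
next
  case False
  then have "z + l \<notin> (+) z ` e" by auto
  then show ?thesis using False bary_outside[OF e] bary_outside[OF full_simplex_translate[OF e]] by simp
qed

lemma bary_grad_translate:
  assumes e: "full_simplex e"
  shows "bary_grad ((+) z ` e) (z + l) = bary_grad e l"
proof (rule vector_eq_rdot[THEN iffD1], rule allI)
  fix v
  show "bary_grad ((+) z ` e) (z + l) \<bullet> v = bary_grad e l \<bullet> v"
    using bary_affine[OF e, of v l 0] bary_affine[OF full_simplex_translate[OF e], of z "z + v" "z + l" "z + 0"]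
      bary_translate[OF e, of z v l] bary_translate[OF e, of z 0 l] by (simp del: add.commute)
qed

section \<open>Affine maps between simplices and exact quadrature\<close>

lemma null_sets_hyperplane:
  fixes g :: "'a::euclidean_space"
  assumes "g \<noteq> 0"
  shows "{x. g \<bullet> x = c} \<in> null_sets lborel"
proof -
  have "{x. g \<bullet> x = c} \<in> null_sets lebesgue"
    using negligible_hyperplane[of g c] assms by (simp add: negligible_iff_null_sets)
  moreover have "{x. g \<bullet> x = c} \<in> sets borel" by (intro borel_closed closed_hyperplane)
  ultimately show ?thesis by (simp add: null_sets_def emeasure_completion)
qed

lemma null_sets_affine_level:
  fixes g :: "'a::euclidean_space"
  assumes "g \<noteq> 0" and "\<And>x. b x = b 0 + g \<bullet> x"
  shows "{x. b x = c} \<in> null_sets lborel"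
proof -
  have "{x. b x = c} = {x. g \<bullet> x = c - b 0}" by (subst assms(2)) auto
  then show ?thesis using null_sets_hyperplane[OF assms(1)] by simp
qed

definition vertex_map :: "(real^'d::finite) set \<Rightarrow> (real^'d \<Rightarrow> real^'d) \<Rightarrow> real^'d \<Rightarrow> real^'d" where
  "vertex_map e \<pi> x = (\<Sum>l\<in>e. bary e x l *\<^sub>R \<pi> l)"

lemma vertex_map_scales:
  assumes e: "full_simplex e" and inj: "inj (vertex_map e \<pi>)"
  shows "\<exists>r. scales_volume (vertex_map e \<pi>) r"
proof -
  define L where "L x = (\<Sum>l\<in>e. (bary_grad e l \<bullet> x) *\<^sub>R \<pi> l)" for x
  have M: "vertex_map e \<pi> x = vertex_map e \<pi> 0 + L x" for x
    unfolding vertex_map_def L_def sum.distrib[symmetric]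
    by (rule sum.cong) (use bary_affine[OF e, of x _ 0] in \<open>simp_all add: scaleR_add_left\<close>)
  have "linear L"
    unfolding L_def
    by (rule linearI) (simp_all add: inner_add_right scaleR_add_left sum.distrib scaleR_sum_right)
  moreover have "inj L" using inj unfolding inj_def by (metis M)
  moreover have "vertex_map e \<pi> = (\<lambda>x. vertex_map e \<pi> 0 + L x)" by (rule ext) (rule M)
  ultimately show ?thesis using scales_volume_affine by metis
qed

lemma bary_vertex_map:
  assumes e: "full_simplex e" and e': "full_simplex e'"
  shows "bary e' (vertex_map e \<pi> x) l = (\<Sum>m\<in>e. bary e x m * bary e' (\<pi> m) l)"
  unfolding vertex_map_def
  by (rule bary_combination[OF e' bary_sum[OF e] full_simplex_finite[OF e]])

lemma bary_inject:
  assumes e: "full_simplex e" and "\<And>l. l \<in> e \<Longrightarrow> bary e x l = bary e y l"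
  shows "x = y"
proof -
  have "(\<Sum>l\<in>e. bary e x l *\<^sub>R l) = (\<Sum>l\<in>e. bary e y l *\<^sub>R l)" using assms(2) by simp
  then show ?thesis using bary_repr[OF e] by simp
qed

text \<open>Any two full simplexes are affinely equivalent, with any matching of the vertices.\<close>

lemma vertex_bijection_scales:
  assumes e: "full_simplex e" and e': "full_simplex e'" and \<pi>: "bij_betw \<pi> e e'"
  obtains r where "scales_volume (vertex_map e \<pi>) r"
    and "\<And>x l. l \<in> e \<Longrightarrow> bary e' (vertex_map e \<pi> x) (\<pi> l) = bary e x l"
proof -
  have b: "bary e' (vertex_map e \<pi> x) (\<pi> l) = bary e x l" if l: "l \<in> e" for x l
  proof -
    have "bary e' (\<pi> m) (\<pi> l) = (if m = l then 1 else 0)" if "m \<in> e" for m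
      using bary_vertex[OF e', of "\<pi> m" "\<pi> l"] \<pi> l that by (auto simp: bij_betw_def inj_on_def)
    then have "bary e' (vertex_map e \<pi> x) (\<pi> l) = (\<Sum>m\<in>e. if m = l then bary e x m else 0)"
      unfolding bary_vertex_map[OF e e'] by (intro sum.cong) auto
    then show ?thesis using l full_simplex_finite[OF e] by simp
  qed
  have "inj (vertex_map e \<pi>)"
    by (rule injI, rule bary_inject[OF e]) (metis b)
  then show thesis using vertex_map_scales[OF e] b that by blast
qed

lemma vimage_hull_vertex_map:
  assumes e: "full_simplex e" and e': "full_simplex e'" and \<pi>: "bij_betw \<pi> e e'"
    and b: "\<And>x l. l \<in> e \<Longrightarrow> bary e' (M x) (\<pi> l) = bary e x l"
  shows "M -` (convex hull e') = convex hull e"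
proof (rule set_eqI)
  fix x
  have "(\<forall>l\<in>e'. 0 \<le> bary e' (M x) l) \<longleftrightarrow> (\<forall>l\<in>e. 0 \<le> bary e' (M x) (\<pi> l))"
    using \<pi> by (auto simp: bij_betw_def)
  then show "x \<in> M -` (convex hull e') \<longleftrightarrow> x \<in> convex hull e"
    by (simp add: in_hull_iff[OF e] in_hull_iff[OF e'] b)
qed

lemma compact_hull: "full_simplex e \<Longrightarrow> compact (convex hull e)"
  by (simp add: finite_imp_compact_convex_hull full_simplex_finite)

lemma borel_hull: "full_simplex e \<Longrightarrow> convex hull e \<in> sets borel"
  by (simp add: borel_compact compact_hull)

definition simplex_volume :: "(real^'d::finite) set \<Rightarrow> real" where
  "simplex_volume e = measure lborel (convex hull e)"

lemma open_subsimplex: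
  assumes e: "full_simplex e" and t: "\<And>l. l \<in> e \<Longrightarrow> 0 < t l" "(\<Sum>l\<in>e. t l) = 1"
  shows "\<exists>x. \<forall>l\<in>e. bary e x l = t l"
  using bary_unique[OF e t(2)] by blast

lemma emeasure_lborel_open_pos:
  fixes U :: "'a::euclidean_space set"
  assumes "open U" "U \<noteq> {}"
  shows "emeasure lborel U > 0"
proof -
  have "\<not> negligible U" using assms by (simp add: open_not_negligible)
  then show ?thesis using assms by (auto simp: negligible_iff_null_sets null_sets_def zero_less_iff_neq_zero)
qed

lemma simplex_volume_pos:
  assumes e: "full_simplex e"
  shows "0 < simplex_volume e"
proof -
  let ?U = "\<Inter>l\<in>e. {x. 0 < bary e x l}"
  have fin: "finite e" using e by (rule full_simplex_finite)
  have "open ?U"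
    using fin by (intro open_INT ballI open_Collect_less continuous_on_const continuous_bary[OF e])
  moreover have "?U \<noteq> {}"
  proof -
    have "card e > 0" using e by (simp add: full_simplex_def)
    then have "\<exists>x. \<forall>l\<in>e. bary e x l = 1 / card e" by (intro open_subsimplex[OF e]) auto
    then obtain x where "\<forall>l\<in>e. bary e x l = 1 / card e" by blast
    then have "x \<in> ?U" using \<open>card e > 0\<close> by auto
    then show ?thesis by blast
  qed
  ultimately have "0 < emeasure lborel ?U" by (rule emeasure_lborel_open_pos)
  also have "\<dots> \<le> emeasure lborel (convex hull e)"
    using borel_hull[OF e] by (intro emeasure_mono) (auto simp: in_hull_iff[OF e] less_imp_le)
  finally show ?thesis
    using emeasure_compact_finite[OF compact_hull[OF e]]
    by (simp add: simplex_volume_def measure_def enn2real_positive_iff)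
qed

text \<open>The facet of points where the coordinates of \<open>j\<close> and \<open>k\<close> are equal and largest, swept by half the
  edge vector \<open>k - j\<close> in both directions.  Written in barycentric coordinates alone, the set is
  carried to a set of the same kind by an affine map between simplexes.\<close>

definition edge_prism :: "(real^'d::finite) set \<Rightarrow> real^'d \<Rightarrow> real^'d \<Rightarrow> (real^'d) set" where
  "edge_prism e j k = {x. \<bar>bary e x k - bary e x j\<bar> \<le> 1 \<and> 0 < bary e x j + bary e x k \<and>
     (\<forall>l\<in>e - {j, k}. 0 < bary e x l \<and> 2 * bary e x l < bary e x j + bary e x k)}"

lemma borel_edge_prism:
  assumes e: "full_simplex e"
  shows "edge_prism e j k \<in> sets borel"
proof -
  note [measurable] = measurable_bary[OF e]
  have "edge_prism e j k = ({x. \<bar>bary e x k - bary e x j\<bar> \<le> 1} \<inter> {x. 0 < bary e x j + bary e x k}) -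
      (\<Union>l\<in>e - {j, k}. {x. bary e x l \<le> 0} \<union> {x. bary e x j + bary e x k \<le> 2 * bary e x l})"
    unfolding edge_prism_def set_eq_iff by (simp add: not_le)
  moreover have "(\<Union>l\<in>e - {j, k}. {x. bary e x l \<le> 0} \<union> {x. bary e x j + bary e x k \<le> 2 * bary e x l}) \<in> sets borel"
    using full_simplex_finite[OF e] by (intro sets.finite_UN sets.Un) auto
  ultimately show ?thesis by auto
qed

text \<open>Affine maps preserve ratios of volumes, and some affine map takes any given edge of a simplex to any
  given edge of another one.\<close>

lemma edge_prism_volume_proportional:
  "\<exists>C. \<forall>(e :: (real^'d::finite) set) j k. full_simplex e \<and> j \<in> e \<and> k \<in> e \<and> j \<noteq> k \<longrightarrow>
     measure lborel (edge_prism e j k) = C * simplex_volume e"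
proof (cases "\<exists>(e :: (real^'d) set) j k. full_simplex e \<and> j \<in> e \<and> k \<in> e \<and> j \<noteq> k")
  case True
  then obtain e and j k :: "real^'d" where e: "full_simplex e" and jk: "j \<in> e" "k \<in> e" "j \<noteq> k" by blast
  show ?thesis
  proof (rule exI[of _ "measure lborel (edge_prism e j k) / simplex_volume e"], safe)
    fix e' and j' k' :: "real^'d"
    assume e': "full_simplex e'" and jk': "j' \<in> e'" "k' \<in> e'" "j' \<noteq> k'"
    have fin: "finite e" "finite e'" using e e' full_simplex_finite by auto
    have "card (e - {j, k}) = card (e' - {j', k'})"
      using e e' jk jk' fin by (simp add: full_simplex_def card_Diff_subset)
    then obtain h where h: "bij_betw h (e - {j, k}) (e' - {j', k'})"
      using finite_same_card_bij[of "e - {j, k}" "e' - {j', k'}"] fin by auto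
    define \<pi> where "\<pi> l = (if l = j then j' else if l = k then k' else h l)" for l
    have "bij_betw \<pi> (e - {j, k}) (e' - {j', k'})"
      using h bij_betw_cong[of "e - {j, k}" \<pi> h] by (simp add: \<pi>_def)
    moreover have "bij_betw \<pi> {j, k} {j', k'}"
      using jk jk' by (auto simp: bij_betw_def inj_on_def \<pi>_def)
    ultimately have "bij_betw \<pi> ((e - {j, k}) \<union> {j, k}) ((e' - {j', k'}) \<union> {j', k'})"
      by (rule bij_betw_combine) auto
    moreover have "(e - {j, k}) \<union> {j, k} = e" "(e' - {j', k'}) \<union> {j', k'} = e'" using jk jk' by auto
    ultimately have \<pi>: "bij_betw \<pi> e e'" by simp
    obtain r where r: "scales_volume (vertex_map e \<pi>) r"
      and b: "\<And>x l. l \<in> e \<Longrightarrow> bary e' (vertex_map e \<pi> x) (\<pi> l) = bary e x l"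
      using vertex_bijection_scales[OF e e' \<pi>] by blast
    have pjk: "\<pi> j = j'" "\<pi> k = k'" using jk by (auto simp: \<pi>_def)
    have bjk: "bary e' (vertex_map e \<pi> x) j' = bary e x j" "bary e' (vertex_map e \<pi> x) k' = bary e x k" for x
      using b[OF jk(1), of x] b[OF jk(2), of x] pjk by auto
    have im: "e' - {j', k'} = \<pi> ` (e - {j, k})"
      using \<open>bij_betw \<pi> (e - {j, k}) (e' - {j', k'})\<close> unfolding bij_betw_def by blast
    have "vertex_map e \<pi> -` edge_prism e' j' k' = edge_prism e j k"
      unfolding edge_prism_def im vimage_def by (simp add: bjk b)
    then have "measure lborel (edge_prism e' j' k') = r * measure lborel (edge_prism e j k)"
      using scales_volume_measure[OF r borel_edge_prism[OF e']] by simp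
    moreover have "simplex_volume e' = r * simplex_volume e"
      using scales_volume_measure[OF r borel_hull[OF e']] vimage_hull_vertex_map[OF e e' \<pi> b]
      by (simp add: simplex_volume_def)
    ultimately show "measure lborel (edge_prism e' j' k') =
        measure lborel (edge_prism e j k) / simplex_volume e * simplex_volume e'"
      using simplex_volume_pos[OF e] by simp
  qed
next
  case False
  then show ?thesis by blast
qed

definition prism_ratio :: "'d::finite itself \<Rightarrow> real" where
  "prism_ratio _ = (SOME C. \<forall>(e :: (real^'d) set) j k. full_simplex e \<and> j \<in> e \<and> k \<in> e \<and> j \<noteq> k \<longrightarrow>
     measure lborel (edge_prism e j k) = C * simplex_volume e)"

lemma edge_prism_volume:
  fixes e :: "(real^'d::finite) set"
  assumes "full_simplex e" "j \<in> e" "k \<in> e" "j \<noteq> k"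
  shows "measure lborel (edge_prism e j k) = prism_ratio TYPE('d) * simplex_volume e"
  using someI_ex[OF edge_prism_volume_proportional[where 'd = 'd]] assms unfolding prism_ratio_def by blast

definition simplex_integral :: "(real^'d::finite) set \<Rightarrow> (real^'d \<Rightarrow> real) \<Rightarrow> real" where
  "simplex_integral e f = (\<integral>x. indicator (convex hull e) x * f x \<partial>lborel)"

lemma integrable_on_hull:
  assumes "full_simplex e" and "continuous_on UNIV (f :: real^'d::finite \<Rightarrow> real)"
  shows "integrable lborel (\<lambda>x. indicator (convex hull e) x * f x)"
  using borel_integrable_compact[OF compact_hull[OF assms(1)] continuous_on_subset[OF assms(2)]] by simp

lemma simplex_integral_add:
  assumes "full_simplex e" "continuous_on UNIV f" "continuous_on UNIV g"
  shows "simplex_integral e (\<lambda>x. f x + g x) = simplex_integral e f + simplex_integral e g"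
  unfolding simplex_integral_def
  using integrable_on_hull[OF assms(1,2)] integrable_on_hull[OF assms(1,3)] by (simp add: distrib_left)

lemma simplex_integral_cmult: "simplex_integral e (\<lambda>x. c * f x) = c * simplex_integral e f"
  unfolding simplex_integral_def by (simp add: mult.left_commute)

lemma simplex_integral_sum:
  assumes "full_simplex e" "finite I" "\<And>i. i \<in> I \<Longrightarrow> continuous_on UNIV (f i)"
  shows "simplex_integral e (\<lambda>x. \<Sum>i\<in>I. f i x) = (\<Sum>i\<in>I. simplex_integral e (f i))"
  unfolding simplex_integral_def
  using integrable_on_hull[OF assms(1,3)] by (simp add: sum_distrib_left)

lemma simplex_integral_const:
  assumes "full_simplex e"
  shows "simplex_integral e (\<lambda>x. c) = c * simplex_volume e"
  unfolding simplex_integral_def simplex_volume_def using borel_hull[OF assms]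
  by (simp add: mult.commute)

lemma simplex_integral_cong:
  assumes "\<And>x. x \<in> convex hull e \<Longrightarrow> f x = g x"
  shows "simplex_integral e f = simplex_integral e g"
  unfolding simplex_integral_def by (rule Bochner_Integration.integral_cong) (auto simp: assms indicator_def)

lemma simplex_integral_translate:
  fixes z :: "real^'d::finite"
  assumes f: "continuous_on UNIV f"  and e: "full_simplex e"
  shows "simplex_integral ((+) z ` e) f = simplex_integral e (\<lambda>x. f (z + x))"
proof -
  have [measurable]: "f \<in> borel_measurable borel" using f by (rule borel_measurable_continuous_onI)
  have [measurable]: "convex hull ((+) z ` e) \<in> sets borel" using borel_hull[OF full_simplex_translate[OF e]] .
  have "convex hull ((+) z ` e) = (+) z ` (convex hull e)" by (rule convex_hull_translation)
  then have "indicator (convex hull ((+) z ` e)) (z + x) = (indicator (convex hull e) x :: real)" for x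
    by (auto simp: indicator_def)
  then show ?thesis
    unfolding simplex_integral_def by (subst scales_volume_integral[OF scales_volume_translation[of z]]) auto
qed

lemma simplex_volume_translate:
  assumes e: "full_simplex e"
  shows "simplex_volume ((+) z ` e) = simplex_volume e"
  using simplex_integral_translate[OF continuous_on_const[of _ 1] e, of z]
    simplex_integral_const[OF e, of 1] simplex_integral_const[OF full_simplex_translate[OF e, of z], of 1] by simp

context
  fixes e :: "(real^'d::finite) set" and j k :: "real^'d"
  assumes e: "full_simplex e" and jk: "j \<in> e" "k \<in> e" "j \<noteq> k"
begin

text \<open>The affine map that exchanges two vertices maps the simplex onto itself, so it preserves volume.\<close>

lemma vertex_swap:
  obtains M where "scales_volume M 1"
    and "\<And>x. bary e (M x) j = bary e x k" and "\<And>x. bary e (M x) k = bary e x j"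
    and "M -` (convex hull e) = convex hull e"
proof -
  let ?\<pi> = "Transposition.transpose j k"
  have \<pi>: "bij_betw ?\<pi> e e" using jk by simp
  obtain r where r: "scales_volume (vertex_map e ?\<pi>) r"
    and b: "\<And>x l. l \<in> e \<Longrightarrow> bary e (vertex_map e ?\<pi> x) (?\<pi> l) = bary e x l"
    using vertex_bijection_scales[OF e e \<pi>] by blast
  note v = vimage_hull_vertex_map[OF e e \<pi> b]
  have "simplex_volume e = r * simplex_volume e"
    using scales_volume_measure[OF r borel_hull[OF e]] v by (simp add: simplex_volume_def)
  then have "r = 1" using simplex_volume_pos[OF e] by (metis mult_cancel_right1 less_irrefl)
  then have r1: "scales_volume (vertex_map e ?\<pi>) 1" using r by simp
  have bj: "bary e (vertex_map e ?\<pi> x) j = bary e x k" and bk: "bary e (vertex_map e ?\<pi> x) k = bary e x j" for x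
    using b[OF jk(2), of x] b[OF jk(1), of x] unfolding transpose_apply_first transpose_apply_second by auto
  show thesis by (rule that[OF r1 bj bk v])
qed

lemma integral_swap:
  "simplex_integral e (\<lambda>x. bary e x j) = simplex_integral e (\<lambda>x. bary e x k)"
  "simplex_integral e (\<lambda>x. (bary e x j)\<^sup>2) = simplex_integral e (\<lambda>x. (bary e x k)\<^sup>2)"
proof -
  note [measurable] = measurable_bary[OF e] borel_hull[OF e]
  obtain M where M: "scales_volume M 1" "\<And>x. bary e (M x) j = bary e x k" "\<And>x. bary e (M x) k = bary e x j"
     "M -` (convex hull e) = convex hull e"
    by (rule vertex_swap) (rule that)
  have i: "indicator (convex hull e) (M x) = (indicator (convex hull e) x :: real)" for x
    using M(4) by (auto simp: indicator_def)
  show "simplex_integral e (\<lambda>x. bary e x j) = simplex_integral e (\<lambda>x. bary e x k)"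
    unfolding simplex_integral_def by (subst scales_volume_integral[OF M(1)]) (auto simp: i M(2))
  show "simplex_integral e (\<lambda>x. (bary e x j)\<^sup>2) = simplex_integral e (\<lambda>x. (bary e x k)\<^sup>2)"
    unfolding simplex_integral_def by (subst scales_volume_integral[OF M(1)]) (auto simp: i M(2))
qed

text \<open>Bisect the simplex at the midpoint of the edge \<open>jk\<close>.  The halves are exchanged by the swap of \<open>j\<close> and
  \<open>k\<close>, and the half where \<open>\<lambda>\<^sub>j \<ge> \<lambda>\<^sub>k\<close> is the image of the simplex under an affine map that replaces
  \<open>\<lambda>\<^sub>j, \<lambda>\<^sub>k\<close> by \<open>\<lambda>\<^sub>j + \<lambda>\<^sub>k/2, \<lambda>\<^sub>k/2\<close>.  Evaluating the integral of \<open>\<lambda>\<^sub>j\<^sup>2 + \<lambda>\<^sub>k\<^sup>2\<close> through this half gives a linear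
  relation between the integrals of \<open>\<lambda>\<^sub>j\<^sup>2\<close> and \<open>\<lambda>\<^sub>j \<lambda>\<^sub>k\<close>.\<close>

lemma integral_edge_product:
  "simplex_integral e (\<lambda>x. bary e x j * bary e x k) = simplex_integral e (\<lambda>x. (bary e x j)\<^sup>2) / 2"
proof -
  note [measurable] = measurable_bary[OF e] borel_hull[OF e]
  define A where "A = {x \<in> convex hull e. bary e x k \<le> bary e x j}"
  define B where "B = {x \<in> convex hull e. bary e x j \<le> bary e x k}"
  have [measurable]: "A \<in> sets borel" "B \<in> sets borel" unfolding A_def B_def by measurable
  have AB: "\<And>f :: real^'d \<Rightarrow> real. AE x in lborel. indicator (convex hull e) x * f x = indicator A x * f x + indicator B x * f x"
  proof -
    fix f :: "real^'d \<Rightarrow> real"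
    have "{x. bary e x j - bary e x k = 0} \<in> null_sets lborel"
    proof (rule null_sets_affine_level)
      show "bary_grad e j - bary_grad e k \<noteq> 0"
        using bary_grad_edge[OF e jk(1,2), of j] bary_grad_edge[OF e jk(1,2), of k] jk(3) by auto
      show "bary e x j - bary e x k = bary e 0 j - bary e 0 k + (bary_grad e j - bary_grad e k) \<bullet> x" for x
        using bary_affine[OF e, of x j 0] bary_affine[OF e, of x k 0] by (simp add: inner_diff_left)
    qed
    then show "AE x in lborel. indicator (convex hull e) x * f x = indicator A x * f x + indicator B x * f x"
      by (rule AE_I') (auto simp: A_def B_def indicator_def)
  qed
  have sub: "A \<subseteq> convex hull e" "B \<subseteq> convex hull e" by (auto simp: A_def B_def)
  have fc: "continuous_on UNIV (\<lambda>x. (bary e x j)\<^sup>2 + (bary e x k)\<^sup>2)"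
    by (intro continuous_intros continuous_bary[OF e])
  have intA: "integrable lborel (\<lambda>x. indicator S x * f x)" if "S \<subseteq> convex hull e" "S \<in> sets borel" "continuous_on UNIV f"
    for S and f :: "real^'d \<Rightarrow> real"
  proof (rule Bochner_Integration.integrable_bound[OF integrable_on_hull[OF e that(3)]])
    have [measurable]: "f \<in> borel_measurable borel" using that(3) by (rule borel_measurable_continuous_onI)
    show "(\<lambda>x. indicator S x * f x) \<in> borel_measurable lborel" using that(2) by measurable
  qed (use that in \<open>auto simp: indicator_def\<close>)
  have split: "simplex_integral e f = (\<integral>x. indicator A x * f x \<partial>lborel) + (\<integral>x. indicator B x * f x \<partial>lborel)"
    if f: "continuous_on UNIV f" for f
  proof -
    have [measurable]: "f \<in> borel_measurable borel" using f by (rule borel_measurable_continuous_onI)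
    have "simplex_integral e f = (\<integral>x. indicator A x * f x + indicator B x * f x \<partial>lborel)"
      unfolding simplex_integral_def by (rule integral_cong_AE) (use AB in auto)
    also have "\<dots> = (\<integral>x. indicator A x * f x \<partial>lborel) + (\<integral>x. indicator B x * f x \<partial>lborel)"
      by (intro Bochner_Integration.integral_add intA sub f) auto
    finally show ?thesis .
  qed
  obtain M where M: "scales_volume M 1" "\<And>x. bary e (M x) j = bary e x k" "\<And>x. bary e (M x) k = bary e x j"
     "M -` (convex hull e) = convex hull e"
    by (rule vertex_swap) (rule that)
  have indM: "indicator A (M x) = (indicator B x :: real)" for x
    using M by (auto simp: A_def B_def indicator_def)
  have half: "simplex_integral e f = 2 * (\<integral>x. indicator A x * f x \<partial>lborel)"
    if f: "continuous_on UNIV f" and sym: "\<And>x. f (M x) = f x" for f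
  proof -
    have [measurable]: "f \<in> borel_measurable borel" using f by (rule borel_measurable_continuous_onI)
    have "(\<integral>x. indicator A x * f x \<partial>lborel) = (\<integral>x. indicator B x * f x \<partial>lborel)"
      by (subst scales_volume_integral[OF M(1)]) (auto simp: indM sym)
    then show ?thesis using split[OF f] by simp
  qed
  \<comment> \<open>The affine map onto the half at \<open>j\<close> moves the vertex \<open>k\<close> to the midpoint of the edge.\<close>
  define \<pi> where "\<pi> l = (if l = k then (1/2) *\<^sub>R j + (1/2) *\<^sub>R k else l)" for l
  define N where "N = vertex_map e \<pi>"
  have mid: "bary e ((1/2) *\<^sub>R j + (1/2) *\<^sub>R k) l = (1/2) * bary e j l + (1/2) * bary e k l" for l
    using bary_combination[OF e, of "\<lambda>i::bool. 1/2" UNIV "\<lambda>i. if i then j else k" l]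
    by (simp add: UNIV_bool add.commute)
  have bN: "bary e (N x) l = bary e x l + (if l = j then bary e x k / 2 else 0) - (if l = k then bary e x k / 2 else 0)"
    if l: "l \<in> e" for x l
  proof -
    have "bary e (N x) l = (\<Sum>m\<in>e. bary e x m * bary e m l + (if m = k then bary e x k * (bary e j l - bary e k l) / 2 else 0))"
      unfolding N_def bary_vertex_map[OF e e] by (rule sum.cong) (auto simp: \<pi>_def mid field_simps)
    also have "\<dots> = (\<Sum>m\<in>e. bary e x m * bary e m l) + bary e x k * (bary e j l - bary e k l) / 2"
      using jk(2) full_simplex_finite[OF e] by (simp only: sum.distrib sum.delta if_True)
    also have "(\<Sum>m\<in>e. bary e x m * bary e m l) = (\<Sum>m\<in>e. if m = l then bary e x m else 0)"
      by (rule sum.cong) (auto simp: bary_vertex[OF e])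
    also have "\<dots> = bary e x l" using l full_simplex_finite[OF e] by simp
    finally show ?thesis using jk(3) by (auto simp: bary_vertex[OF e jk(1)] bary_vertex[OF e jk(2)])
  qed
  have "inj N"
  proof (rule injI, rule bary_inject[OF e])
    fix x y l assume xy: "N x = N y" and l: "l \<in> e"
    have inv: "bary e x l = bary e (N x) l - (if l = j then bary e x k / 2 else 0) + (if l = k then bary e x k / 2 else 0)"
      if "l \<in> e" for x l
      using bN[OF that, of x] by simp
    have k: "bary e x k = bary e y k" using bN[OF jk(2), of x] bN[OF jk(2), of y] xy jk(3) by simp
    show "bary e x l = bary e y l" unfolding inv[OF l, of x] inv[OF l, of y] xy k by (rule refl)
  qed
  then obtain r where r: "scales_volume N r" using vertex_map_scales[OF e, of \<pi>] unfolding N_def by auto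
  have bjk: "bary e (N x) j = bary e x j + bary e x k / 2" "bary e (N x) k = bary e x k / 2" for x
    using bN[OF jk(1), of x] bN[OF jk(2), of x] jk(3) by auto
  have bl: "bary e (N x) l = bary e x l" if "l \<in> e" "l \<noteq> j" "l \<noteq> k" for x l
    using bN[OF that(1), of x] that by simp
  have "N x \<in> A \<longleftrightarrow> x \<in> convex hull e" for x
  proof
    assume "N x \<in> A"
    then have 1: "\<And>l. l \<in> e \<Longrightarrow> 0 \<le> bary e (N x) l" and 2: "bary e (N x) k \<le> bary e (N x) j"
      by (auto simp: A_def in_hull_iff[OF e])
    have "0 \<le> bary e x l" if "l \<in> e" for l
      using 1[OF that] 2 1[OF jk(2)] bjk[of x] bl[OF that, of x] by (cases "l = j \<or> l = k") auto
    then show "x \<in> convex hull e" by (simp add: in_hull_iff[OF e])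
  next
    assume "x \<in> convex hull e"
    then have 1: "\<And>l. l \<in> e \<Longrightarrow> 0 \<le> bary e x l" by (auto simp: in_hull_iff[OF e])
    have "0 \<le> bary e (N x) l" if "l \<in> e" for l
      using 1[OF that] 1[OF jk(2)] 1[OF jk(1)] bjk[of x] bl[OF that, of x] by (cases "l = j \<or> l = k") auto
    then show "N x \<in> A" using 1[OF jk(1)] by (simp add: A_def in_hull_iff[OF e] bjk)
  qed
  then have indN: "indicator A (N x) = (indicator (convex hull e) x :: real)" for x by (simp add: indicator_def)
  have AN: "(\<integral>x. indicator A x * f x \<partial>lborel) = r * simplex_integral e (\<lambda>x. f (N x))"
    if f: "continuous_on UNIV f" for f
  proof -
    have [measurable]: "f \<in> borel_measurable borel" using f by (rule borel_measurable_continuous_onI)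
    show ?thesis unfolding simplex_integral_def by (subst scales_volume_integral[OF r]) (auto simp: indN)
  qed
  have "simplex_integral e (\<lambda>_. 1) = 2 * (r * simplex_integral e (\<lambda>_. 1))"
    unfolding AN[of "\<lambda>_. 1", OF continuous_on_const, symmetric]
    by (rule half[of "\<lambda>_. 1", OF continuous_on_const refl])
  then have "simplex_volume e = 2 * (r * simplex_volume e)"
    unfolding simplex_integral_const[OF e] mult_1 .
  then have "(2 * r) * simplex_volume e = 1 * simplex_volume e" by linarith
  then have r2: "2 * r = 1" using simplex_volume_pos[OF e] unfolding mult_cancel_right by linarith
  have "simplex_integral e (\<lambda>x. (bary e x j)\<^sup>2 + (bary e x k)\<^sup>2) =
      2 * (r * simplex_integral e (\<lambda>x. (bary e x j + bary e x k / 2)\<^sup>2 + (bary e x k / 2)\<^sup>2))"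
    using half[OF fc] AN[OF fc] M(2,3) bjk by (simp add: add.commute)
  also have "\<dots> = simplex_integral e (\<lambda>x. (bary e x j)\<^sup>2 + (bary e x j * bary e x k + (1/2) * (bary e x k)\<^sup>2))"
  proof -
    have "(bary e x j + bary e x k / 2)\<^sup>2 + (bary e x k / 2)\<^sup>2 =
       (bary e x j)\<^sup>2 + (bary e x j * bary e x k + (1/2) * (bary e x k)\<^sup>2)" for x
      by (simp add: power2_eq_square algebra_simps)
    then show ?thesis using r2 by (simp add: mult.assoc[symmetric])
  qed
  finally have "simplex_integral e (\<lambda>x. (bary e x j)\<^sup>2) + simplex_integral e (\<lambda>x. (bary e x k)\<^sup>2) =
     simplex_integral e (\<lambda>x. (bary e x j)\<^sup>2) + (simplex_integral e (\<lambda>x. bary e x j * bary e x k)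
        + (1/2) * simplex_integral e (\<lambda>x. (bary e x k)\<^sup>2))"
    using e by (simp only: simplex_integral_add simplex_integral_cmult continuous_bary
       continuous_on_add continuous_on_mult continuous_on_power continuous_on_const)
  then show ?thesis using integral_swap(2) by simp
qed

end

lemma simplex_integral_bary:
  fixes e :: "(real^'d::finite) set"
  assumes e: "full_simplex e" and j: "j \<in> e"
  shows "simplex_integral e (\<lambda>x. bary e x j) = simplex_volume e / (real CARD('d) + 1)"
proof -
  have "simplex_volume e = simplex_integral e (\<lambda>x. \<Sum>l\<in>e. bary e x l)"
    using simplex_integral_const[OF e, of 1] by (simp add: bary_sum[OF e])
  also have "\<dots> = (\<Sum>l\<in>e. simplex_integral e (\<lambda>x. bary e x l))"
    by (intro simplex_integral_sum[OF e] full_simplex_finite[OF e] continuous_bary[OF e])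
  also have "\<dots> = (\<Sum>l\<in>e. simplex_integral e (\<lambda>x. bary e x j))"
    by (rule sum.cong) (use integral_swap(1)[OF e _ j] in metis)+
  also have "\<dots> = (real CARD('d) + 1) * simplex_integral e (\<lambda>x. bary e x j)"
    using e by (simp add: full_simplex_def)
  finally show ?thesis by (simp add: add_nonneg_eq_0_iff)
qed

lemma simplex_integral_affine:
  fixes e :: "(real^'d::finite) set"
  assumes e: "full_simplex e"
  shows "simplex_integral e (\<lambda>x. a \<bullet> x + b) = simplex_volume e / (real CARD('d) + 1) * (\<Sum>l\<in>e. a \<bullet> l + b)"
proof -
  have "simplex_integral e (\<lambda>x. a \<bullet> x + b) = simplex_integral e (\<lambda>x. \<Sum>l\<in>e. (a \<bullet> l + b) * bary e x l)"
    by (rule simplex_integral_cong, rule trans[OF bary_interpolates[OF e, symmetric]]) (simp add: mult.commute)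
  also have "\<dots> = (\<Sum>l\<in>e. (a \<bullet> l + b) * simplex_integral e (\<lambda>x. bary e x l))"
    by (subst simplex_integral_sum[OF e full_simplex_finite[OF e]])
      (auto intro!: continuous_intros continuous_bary[OF e] simp: simplex_integral_cmult)
  also have "\<dots> = simplex_volume e / (real CARD('d) + 1) * (\<Sum>l\<in>e. a \<bullet> l + b)"
    by (subst sum_distrib_left, rule sum.cong) (auto simp: simplex_integral_bary[OF e])
  finally show ?thesis .
qed

text \<open>The products \<open>\<lambda>\<^sub>l \<lambda>\<^sub>m\<close> add up to 1, all squares have the same integral by symmetry, and mixed products
  have half of it.\<close>

lemma simplex_integral_bary_product:
  fixes e :: "(real^'d::finite) set"
  assumes e: "full_simplex e" and jk: "j \<in> e" "k \<in> e"
  shows "simplex_integral e (\<lambda>x. bary e x j * bary e x k) =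
    simplex_volume e / ((real CARD('d) + 1) * (real CARD('d) + 2)) * (if j = k then 2 else 1)"
proof -
  let ?d = "real CARD('d)"
  define p where "p = simplex_integral e (\<lambda>x. (bary e x j)\<^sup>2)"
  have p: "simplex_integral e (\<lambda>x. (bary e x l)\<^sup>2) = p" if "l \<in> e" for l
    unfolding p_def using integral_swap(2)[OF e that jk(1)] by (cases "l = j") auto
  have prod: "simplex_integral e (\<lambda>x. bary e x l * bary e x m) = p / 2 + (if m = l then p / 2 else 0)"
    if "l \<in> e" "m \<in> e" for l m
    using integral_edge_product[OF e that] p[OF that(1)] by (auto simp: power2_eq_square)
  have card: "real (card e) = ?d + 1" using e by (simp add: full_simplex_def)
  have fin: "finite e" by (rule full_simplex_finite[OF e])
  have "simplex_volume e = simplex_integral e (\<lambda>x. \<Sum>l\<in>e. \<Sum>m\<in>e. bary e x l * bary e x m)"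
    using simplex_integral_const[OF e, of 1] by (simp add: sum_product[symmetric] bary_sum[OF e])
  also have "\<dots> = (\<Sum>l\<in>e. \<Sum>m\<in>e. simplex_integral e (\<lambda>x. bary e x l * bary e x m))"
    by (subst simplex_integral_sum[OF e fin], (intro continuous_intros continuous_bary[OF e])[1])
      (intro sum.cong refl simplex_integral_sum[OF e fin] continuous_intros continuous_bary[OF e])
  also have "\<dots> = (\<Sum>l\<in>e. \<Sum>m\<in>e. p / 2 + (if m = l then p / 2 else 0))"
    by (intro sum.cong refl prod)
  also have "\<dots> = (?d + 1) * ((?d + 1) * (p / 2) + p / 2)"
    using fin by (simp add: sum.distrib card)
  also have "\<dots> = (?d + 1) * (?d + 2) * (p / 2)" by (simp add: field_simps)
  finally have "p / 2 = simplex_volume e / ((?d + 1) * (?d + 2))"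
    using nonzero_mult_div_cancel_left[of "(?d + 1) * (?d + 2)" "p / 2"] by (simp add: add_nonneg_eq_0_iff)
  then show ?thesis using prod[OF jk] by (cases "j = k") auto
qed

lemma simplex_integral_affine_square:
  fixes e :: "(real^'d::finite) set"
  assumes e: "full_simplex e"
  shows "simplex_integral e (\<lambda>x. (a \<bullet> x + b)\<^sup>2) = simplex_volume e / ((real CARD('d) + 1) * (real CARD('d) + 2)) *
    ((\<Sum>l\<in>e. (a \<bullet> l + b)\<^sup>2) + (\<Sum>l\<in>e. a \<bullet> l + b)\<^sup>2)"
proof -
  let ?y = "\<lambda>l. a \<bullet> l + b"
  let ?K = "simplex_volume e / ((real CARD('d) + 1) * (real CARD('d) + 2))"
  have fin: "finite e" by (rule full_simplex_finite[OF e])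
  have diagonal: "(\<Sum>l\<in>e. \<Sum>m\<in>e. K * (y l * y m) + (if m = l then K * (y l * y l) else 0)) =
      K * ((\<Sum>l\<in>e. \<Sum>m\<in>e. y l * y m) + (\<Sum>l\<in>e. y l * y l))" for K :: real and y
    using fin by (simp add: sum.distrib sum_distrib_left distrib_left)
  have "simplex_integral e (\<lambda>x. (a \<bullet> x + b)\<^sup>2) =
      simplex_integral e (\<lambda>x. \<Sum>l\<in>e. \<Sum>m\<in>e. (?y l * ?y m) * (bary e x l * bary e x m))"
  proof (rule simplex_integral_cong)
    fix x
    have "(\<Sum>l\<in>e. \<Sum>m\<in>e. (?y l * ?y m) * (bary e x l * bary e x m)) =
        (\<Sum>l\<in>e. bary e x l * ?y l) * (\<Sum>m\<in>e. bary e x m * ?y m)"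
      unfolding sum_product by (intro sum.cong refl) (simp only: mult_ac)
    then show "(a \<bullet> x + b)\<^sup>2 = (\<Sum>l\<in>e. \<Sum>m\<in>e. (?y l * ?y m) * (bary e x l * bary e x m))"
      unfolding bary_interpolates[OF e] power2_eq_square by (rule sym)
  qed
  also have "\<dots> = (\<Sum>l\<in>e. \<Sum>m\<in>e. (?y l * ?y m) * simplex_integral e (\<lambda>x. bary e x l * bary e x m))"
    by (subst simplex_integral_sum[OF e fin], (intro continuous_intros continuous_bary[OF e])[1])
      (intro sum.cong refl, subst simplex_integral_sum[OF e fin],
       auto intro!: continuous_intros continuous_bary[OF e] simp: simplex_integral_cmult)
  also have "\<dots> = (\<Sum>l\<in>e. \<Sum>m\<in>e. ?K * (?y l * ?y m) + (if m = l then ?K * (?y l * ?y l) else 0))"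
    by (intro sum.cong refl) (auto simp: simplex_integral_bary_product[OF e])
  also have "\<dots> = ?K * ((\<Sum>l\<in>e. \<Sum>m\<in>e. ?y l * ?y m) + (\<Sum>l\<in>e. ?y l * ?y l))"
    by (rule diagonal)
  also have "(\<Sum>l\<in>e. \<Sum>m\<in>e. ?y l * ?y m) = (\<Sum>l\<in>e. ?y l)\<^sup>2"
    by (simp add: power2_eq_square sum_product)
  finally show ?thesis by (simp add: power2_eq_square add.commute)
qed

section \<open>The area of a dual facet\<close>

lemma affine_level_hyperplane:
  fixes g :: "'a::euclidean_space"
  assumes "g \<noteq> 0" and "\<And>x. b x = b 0 + g \<bullet> x"
  shows "{x. b x = c} \<in> hyperplanes"
proof -
  have "{x. b x = c} = {x. g \<bullet> x = c - b 0}" by (subst assms(2)) auto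
  then show ?thesis using assms(1) by (simp add: hyperplanes_def affine_hyperplane)
qed

lemma hyperplane_unit_normal_form:
  fixes H :: "'a::euclidean_space set"
  assumes "H \<in> hyperplanes"
  obtains \<nu> c where "norm \<nu> = 1" "H = {x. \<nu> \<bullet> x = c}"
proof -
  have H: "affine H" "aff_dim H = DIM('a) - 1" using assms by (auto simp: hyperplanes_def)
  have "aff_dim H = int (DIM('a) - 1)" using H(2) DIM_positive[where 'a = 'a] by (simp add: of_nat_diff Suc_leI)
  then obtain a b where a: "a \<noteq> 0" "affine hull H = {x. a \<bullet> x = b}"
    unfolding aff_dim_eq_hyperplane by blast
  have "H = {x. (a /\<^sub>R norm a) \<bullet> x = b / norm a}"
    using a H(1) by (auto simp: hull_same field_simps)
  then show thesis using that[of "a /\<^sub>R norm a" "b / norm a"] a(1) by simp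
qed

lemma closest_point_hyperplane:
  fixes \<nu> :: "'a::euclidean_space"
  assumes "norm \<nu> = 1"
  shows "closest_point {x. \<nu> \<bullet> x = c} x = x - (\<nu> \<bullet> x - c) *\<^sub>R \<nu>"
    and "infdist x {x. \<nu> \<bullet> x = c} = \<bar>\<nu> \<bullet> x - c\<bar>"
proof -
  let ?H = "{x. \<nu> \<bullet> x = c}" and ?p = "x - (\<nu> \<bullet> x - c) *\<^sub>R \<nu>"
  have 1: "\<nu> \<bullet> \<nu> = 1" using assms by (simp add: norm_eq_1)
  have p: "?p \<in> ?H" by (simp add: inner_diff_right 1)
  have dp: "dist x ?p = \<bar>\<nu> \<bullet> x - c\<bar>" using assms by (simp add: dist_norm)
  have le: "\<bar>\<nu> \<bullet> x - c\<bar> \<le> dist x z" if "z \<in> ?H" for z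
    using that Cauchy_Schwarz_ineq2[of \<nu> "x - z"] assms by (simp add: dist_norm inner_diff_right)
  show "closest_point ?H x = ?p"
    by (rule closest_point_unique[symmetric])
      (use p le dp in \<open>auto simp: convex_hyperplane closed_hyperplane\<close>)
  have "infdist x ?H \<le> \<bar>\<nu> \<bullet> x - c\<bar>" using infdist_le[OF p, of x] unfolding dp .
  moreover have "\<bar>\<nu> \<bullet> x - c\<bar> \<le> infdist x ?H"
    unfolding infdist_def using p le by (auto intro!: cINF_greatest)
  ultimately show "infdist x ?H = \<bar>\<nu> \<bullet> x - c\<bar>" by simp
qed

text \<open>The area of \<open>S\<close> is the volume of the prism of height 1 over \<open>S\<close>.\<close>

lemma emeasure_hyperplane_measure:
  fixes \<nu> :: "'a::euclidean_space"
  assumes \<nu>: "norm \<nu> = 1" and [measurable]: "S \<in> sets borel"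
  shows "emeasure (hyperplane_measure {x. \<nu> \<bullet> x = c}) S =
    emeasure lborel {x. \<bar>\<nu> \<bullet> x - c\<bar> \<le> 1/2 \<and> x - (\<nu> \<bullet> x - c) *\<^sub>R \<nu> \<in> S}"
proof -
  let ?B = "{x. \<bar>\<nu> \<bullet> x - c\<bar> \<le> 1/2}" and ?p = "\<lambda>x. x - (\<nu> \<bullet> x - c) *\<^sub>R \<nu>"
  have [measurable]: "?B \<in> sets borel" by measurable
  have p [measurable]: "?p \<in> borel_measurable borel" by measurable
  have "emeasure (hyperplane_measure {x. \<nu> \<bullet> x = c}) S = emeasure (distr (restrict_space lborel ?B) borel ?p) S"
    unfolding hyperplane_measure_def closest_point_hyperplane[OF \<nu>] by simp
  also have "\<dots> = emeasure (restrict_space lborel ?B) (?p -` S \<inter> space (restrict_space lborel ?B))"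
    by (rule emeasure_distr) (auto intro!: measurable_restrict_space1)
  also have "?p -` S \<inter> space (restrict_space lborel ?B) = {x. \<bar>\<nu> \<bullet> x - c\<bar> \<le> 1/2 \<and> ?p x \<in> S}"
    by (auto simp: space_restrict_space)
  also have "emeasure (restrict_space lborel ?B) \<dots> = emeasure lborel \<dots>"
    by (rule emeasure_restrict_space) auto
  finally show ?thesis .
qed

text \<open>The points whose projection to \<open>H\<close> lies in \<open>H1\<close> form a hyperplane, or none exist if \<open>H1\<close> is parallel
  to \<open>H\<close>.\<close>

lemma hyperplane_measure_other:
  fixes H :: "'a::euclidean_space set"
  assumes "H \<in> hyperplanes" "H1 \<in> hyperplanes" "H \<noteq> H1"
  shows "emeasure (hyperplane_measure H) H1 = 0"
proof -
  obtain \<nu> c where \<nu>: "norm \<nu> = 1" "H = {x. \<nu> \<bullet> x = c}" using hyperplane_unit_normal_form assms(1) by metis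
  obtain a b where a: "norm a = 1" "H1 = {x. a \<bullet> x = b}" using hyperplane_unit_normal_form assms(2) by metis
  have H1: "H1 \<in> sets borel" unfolding a(2) by (intro borel_closed closed_hyperplane)
  let ?g = "a - (a \<bullet> \<nu>) *\<^sub>R \<nu>"
  let ?P = "{x. \<bar>\<nu> \<bullet> x - c\<bar> \<le> 1/2 \<and> x - (\<nu> \<bullet> x - c) *\<^sub>R \<nu> \<in> H1}"
  have sub: "?P \<subseteq> {x. ?g \<bullet> x = b - c * (a \<bullet> \<nu>)}"
    by (auto simp: a(2) inner_diff_left inner_diff_right algebra_simps)
  have "emeasure lborel ?P = 0"
  proof (cases "?g = 0")
    case False
    have "emeasure lborel ?P \<le> emeasure lborel {x. ?g \<bullet> x = b - c * (a \<bullet> \<nu>)}"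
      by (rule emeasure_mono[OF sub]) (simp add: borel_closed closed_hyperplane)
    also have "\<dots> = 0" by (rule null_setsD1[OF null_sets_hyperplane[OF False]])
    finally show ?thesis by simp
  next
    case True
    then have an: "a = (a \<bullet> \<nu>) *\<^sub>R \<nu>" by simp
    then have ne: "a \<bullet> \<nu> \<noteq> 0" using a(1) by auto
    have "b - c * (a \<bullet> \<nu>) \<noteq> 0"
    proof
      assume b: "b - c * (a \<bullet> \<nu>) = 0"
      have ax: "a \<bullet> x = (a \<bullet> \<nu>) * (\<nu> \<bullet> x)" for x by (subst an) simp
      have b': "b = (a \<bullet> \<nu>) * c" using b by simp
      have "a \<bullet> x = b \<longleftrightarrow> \<nu> \<bullet> x = c" for x unfolding ax[of x] b' using ne by simp
      then have "H1 = H" unfolding a(2) \<nu>(2) by simp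
      then show False using assms(3) by simp
    qed
    then have "?P = {}" using sub True by auto
    then show ?thesis by (metis emeasure_empty)
  qed
  then show ?thesis unfolding \<nu>(2) using emeasure_hyperplane_measure[OF \<nu>(1) H1] by simp
qed

lemma sets_hyperplane_measure [simp]: "sets (hyperplane_measure H) = sets borel"
  by (simp add: hyperplane_measure_def)

lemma borel_hyperplane: "H \<in> hyperplanes \<Longrightarrow> H \<in> sets borel"
  by (metis hyperplane_unit_normal_form closed_hyperplane borel_closed)

text \<open>Every hyperplane differs from \<open>H1\<close> or from \<open>H2\<close>, so none of them sees the intersection.\<close>

lemma surface_measure_null:
  fixes H1 :: "'a::euclidean_space set"
  assumes H: "H1 \<in> hyperplanes" "H2 \<in> hyperplanes" "H1 \<noteq> H2"
  shows "H1 \<inter> H2 \<in> null_sets surface_measure"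
proof -
  have S: "H1 \<inter> H2 \<in> sets borel" using H borel_hyperplane by auto
  have zero: "emeasure (hyperplane_measure H) (H1 \<inter> H2) = 0" if "H \<in> hyperplanes" for H
  proof -
    obtain H' where H': "H' \<in> hyperplanes" "H \<noteq> H'" "H1 \<inter> H2 \<subseteq> H'" using H by blast
    have "emeasure (hyperplane_measure H) (H1 \<inter> H2) \<le> emeasure (hyperplane_measure H) H'"
      using H' borel_hyperplane by (intro emeasure_mono) auto
    then show ?thesis using hyperplane_measure_other[OF that H'(1,2)] by simp
  qed
  have "(\<integral>\<^sup>+H. emeasure (hyperplane_measure H) (H1 \<inter> H2) \<partial>count_space hyperplanes) =
     (\<integral>\<^sup>+H. 0 \<partial>count_space (hyperplanes :: 'a set set))"
    by (rule nn_integral_cong) (simp add: zero)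
  then show ?thesis using S emeasure_surface_measure[OF S] by (intro null_setsI) auto
qed

lemma surface_measure_on_hyperplane:
  assumes H: "H \<in> hyperplanes" and S: "S \<subseteq> H" "S \<in> sets borel"
  shows "emeasure surface_measure S = emeasure (hyperplane_measure H) S"
proof -
  have "emeasure (hyperplane_measure H') S = 0" if "H' \<in> hyperplanes" "H' \<noteq> H" for H'
  proof -
    have "emeasure (hyperplane_measure H') S \<le> emeasure (hyperplane_measure H') H"
      using S borel_hyperplane[OF H] by (intro emeasure_mono) auto
    then show ?thesis using hyperplane_measure_other[OF that(1) H that(2)] by simp
  qed
  then have "(\<integral>\<^sup>+H. emeasure (hyperplane_measure H) S \<partial>count_space hyperplanes) =
      (\<Sum>H\<in>{H}. emeasure (hyperplane_measure H) S)"
    using H by (intro nn_integral_count_space') auto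
  then show ?thesis using emeasure_surface_measure[OF S(2)] by simp
qed

text \<open>The relative interior of the part of the interface between the control volumes of \<open>j\<close> and \<open>k\<close> that
  lies in the simplex \<open>e\<close>.\<close>

definition dual_facet :: "(real^'d::finite) set \<Rightarrow> real^'d \<Rightarrow> real^'d \<Rightarrow> (real^'d) set" where
  "dual_facet e j k = {x. bary e x j = bary e x k \<and> 0 < bary e x j \<and>
     (\<forall>l\<in>e - {j, k}. 0 < bary e x l \<and> bary e x l < bary e x j)}"

text \<open>Along the edge from \<open>j\<close> to \<open>k\<close> the function \<open>\<lambda>\<^sub>k - \<lambda>\<^sub>j\<close> grows from -1 to 1; its gradient is normal to the
  dual facet and points to the side of \<open>k\<close>.\<close>

definition edge_normal :: "(real^'d::finite) set \<Rightarrow> real^'d \<Rightarrow> real^'d \<Rightarrow> real^'d" where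
  "edge_normal e j k = bary_grad e k - bary_grad e j"

context
  fixes e :: "(real^'d::finite) set" and j k :: "real^'d"
  assumes e: "full_simplex e" and jk: "j \<in> e" "k \<in> e" "j \<noteq> k"
begin

lemma edge_normal_edge: "edge_normal e j k \<bullet> (k - j) = 2"
  using bary_grad_edge[OF e jk(1,2), of j] bary_grad_edge[OF e jk(1,2), of k] jk(3)
  by (simp add: edge_normal_def inner_diff_left)

lemma edge_normal_nonzero: "edge_normal e j k \<noteq> 0"
  using edge_normal_edge by auto

lemma bary_difference: "bary e x k - bary e x j = bary e y k - bary e y j + edge_normal e j k \<bullet> (x - y)"
  using bary_affine[OF e, of x k y] bary_affine[OF e, of x j y]
  by (simp add: edge_normal_def inner_diff_left)

lemma dual_hyperplane: "{x. bary e x k - bary e x j = 0} \<in> hyperplanes"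
  by (rule affine_level_hyperplane[OF edge_normal_nonzero])
    (rule bary_difference[where y = 0, unfolded diff_zero])

lemma borel_dual_facet: "dual_facet e j k \<in> sets borel"
proof -
  note [measurable] = measurable_bary[OF e]
  have "dual_facet e j k = ({x. bary e x j = bary e x k} \<inter> {x. 0 < bary e x j}) -
      (\<Union>l\<in>e - {j, k}. {x. bary e x l \<le> 0} \<union> {x. bary e x j \<le> bary e x l})"
    unfolding dual_facet_def set_eq_iff by (simp add: not_le)
  moreover have "(\<Union>l\<in>e - {j, k}. {x. bary e x l \<le> 0} \<union> {x. bary e x j \<le> bary e x l}) \<in> sets borel"
    using full_simplex_finite[OF e] by (intro sets.finite_UN sets.Un) auto
  ultimately show ?thesis by auto
qed

lemma bounded_edge_prism: "bounded (edge_prism e j k)"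
proof (rule boundedI)
  fix x assume x: "x \<in> edge_prism e j k"
  have fin: "finite e" by (rule full_simplex_finite[OF e])
  have 1: "(\<Sum>l\<in>e. bary e x l) = bary e x j + (bary e x k + (\<Sum>l\<in>e - {j, k}. bary e x l))"
  proof -
    have "e = insert j (insert k (e - {j, k}))" using jk by auto
    then show ?thesis using fin jk by (metis Diff_iff finite_Diff finite_insert insertE insertI1 insertI2 sum.insert)
  qed
  have "0 \<le> (\<Sum>l\<in>e - {j, k}. bary e x l)"
    using x by (intro sum_nonneg) (auto simp: edge_prism_def less_imp_le)
  then have s: "bary e x j + bary e x k \<le> 1" using 1 bary_sum[OF e] by simp
  have b: "\<bar>bary e x l\<bar> \<le> 1" if l: "l \<in> e" for l
  proof (cases "l \<in> {j, k}")
    case True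
    then show ?thesis using x s by (auto simp: edge_prism_def abs_le_iff)
  next
    case False
    then have "0 < bary e x l \<and> 2 * bary e x l < bary e x j + bary e x k" using x l by (simp add: edge_prism_def)
    then show ?thesis using s by simp
  qed
  have "norm x = norm (\<Sum>l\<in>e. bary e x l *\<^sub>R l)" by (simp add: bary_repr[OF e])
  also have "\<dots> \<le> (\<Sum>l\<in>e. norm (bary e x l *\<^sub>R l))" by (rule norm_sum)
  also have "\<dots> \<le> (\<Sum>l\<in>e. 1 * norm l)"
    unfolding norm_scaleR by (intro sum_mono mult_right_mono b) auto
  finally show "norm x \<le> (\<Sum>l\<in>e. norm l)" by simp
qed

text \<open>The area is the volume of the right prism of height 1 over the facet.  The shear that fixes the facet
  and tilts the unit normal to \<open>k - j\<close> maps this prism to \<open>edge_prism e j k\<close>, and it scales volume by the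
  height \<open>2 / |\<nabla>(\<lambda>\<^sub>k - \<lambda>\<^sub>j)|\<close> of the tilted prism.\<close>

lemma surface_measure_dual_facet:
  "emeasure surface_measure (dual_facet e j k) =
    ennreal (prism_ratio TYPE('d) / 2 * simplex_volume e * norm (edge_normal e j k))"
proof -
  define C where "C = prism_ratio TYPE('d)"
  have C: "measure lborel (edge_prism e j k) = C * simplex_volume e"
    unfolding C_def by (rule edge_prism_volume[OF e jk])
  let ?g = "edge_normal e j k"
  define \<nu> where "\<nu> = ?g /\<^sub>R norm ?g"
  define c where "c = - (bary e 0 k - bary e 0 j) / norm ?g"
  define \<delta> where "\<delta> = k - j"
  have ng: "norm ?g > 0" using edge_normal_nonzero by simp
  have \<nu>: "norm \<nu> = 1" using edge_normal_nonzero by (simp add: \<nu>_def)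
  have t: "\<nu> \<bullet> x - c = (bary e x k - bary e x j) / norm ?g" for x
    using bary_difference[of x 0] ng by (simp add: \<nu>_def c_def field_simps)
  have H: "{x. bary e x k - bary e x j = 0} = {x. \<nu> \<bullet> x = c}"
  proof -
    have "\<nu> \<bullet> x - c = 0 \<longleftrightarrow> bary e x k - bary e x j = 0" for x unfolding t using ng by simp
    then show ?thesis by simp
  qed
  let ?F = "dual_facet e j k"
  let ?P = "{x. \<bar>\<nu> \<bullet> x - c\<bar> \<le> 1/2 \<and> x - (\<nu> \<bullet> x - c) *\<^sub>R \<nu> \<in> ?F}"
  define \<Lambda> where "\<Lambda> x = x + (\<nu> \<bullet> x - c) *\<^sub>R (\<delta> - \<nu>)" for x
  have \<nu>\<delta>: "1 + \<nu> \<bullet> (\<delta> - \<nu>) = 2 / norm ?g"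
  proof -
    have "\<nu> \<bullet> \<delta> = 2 / norm ?g" using edge_normal_edge by (simp add: \<nu>_def \<delta>_def divide_inverse mult.commute)
    moreover have "\<nu> \<bullet> \<nu> = 1" using \<nu> by (simp add: norm_eq_1)
    ultimately show ?thesis by (simp add: inner_diff_right)
  qed
  have sc: "scales_volume \<Lambda> (2 / norm ?g)"
    using scales_volume_shear[of \<nu> "\<delta> - \<nu>" c] ng unfolding \<nu>\<delta> \<Lambda>_def by simp
  have "\<Lambda> -` edge_prism e j k = ?P"
  proof (rule set_eqI)
    fix x
    define s where "s = \<nu> \<bullet> x - c"
    define y where "y = x - s *\<^sub>R \<nu>"
    have Lx: "\<Lambda> x = y + s *\<^sub>R \<delta>" by (simp add: \<Lambda>_def y_def s_def algebra_simps)
    have "\<nu> \<bullet> y - c = 0" using \<nu> by (simp add: y_def s_def inner_diff_right norm_eq_1)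
    then have y: "bary e y j = bary e y k" using t[of y] ng by simp
    have b: "bary e (\<Lambda> x) l = bary e y l + s * ((if l = k then 1 else 0) - (if l = j then 1 else 0))" for l
      using bary_affine[OF e, of "\<Lambda> x" l y] bary_grad_edge[OF e jk(1,2), of l] by (simp add: Lx \<delta>_def)
    have bj: "bary e (\<Lambda> x) j = bary e y j - s" and bk: "bary e (\<Lambda> x) k = bary e y j + s"
      using b[of j] b[of k] jk(3) y by auto
    have bl: "bary e (\<Lambda> x) l = bary e y l" if "l \<in> e - {j, k}" for l using b[of l] that by auto
    have "x \<in> \<Lambda> -` edge_prism e j k \<longleftrightarrow> \<bar>s\<bar> \<le> 1/2 \<and> y \<in> ?F"
      unfolding edge_prism_def dual_facet_def by (auto simp: bj bk bl y)
    then show "x \<in> \<Lambda> -` edge_prism e j k \<longleftrightarrow> x \<in> ?P" by (simp add: y_def s_def)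
  qed
  then have "emeasure lborel (edge_prism e j k) = ennreal (2 / norm ?g) * emeasure lborel ?P"
    using scales_volume_emeasure[OF sc borel_edge_prism[OF e]] by simp
  then have "ennreal (norm ?g / 2) * emeasure lborel (edge_prism e j k) =
      ennreal (norm ?g / 2 * (2 / norm ?g)) * emeasure lborel ?P"
    using ng by (simp only: mult.assoc[symmetric] ennreal_mult[symmetric] divide_nonneg_nonneg norm_ge_zero zero_le_numeral)
  then have P: "emeasure lborel ?P = ennreal (norm ?g / 2) * emeasure lborel (edge_prism e j k)"
    using ng by simp
  have prism: "emeasure lborel (edge_prism e j k) = ennreal (C * simplex_volume e)"
    using emeasure_bounded_finite[OF bounded_edge_prism] C by (simp add: emeasure_eq_ennreal_measure)
  have "emeasure lborel ?P = ennreal (norm ?g / 2 * (C * simplex_volume e))"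
    unfolding P prism
    by (rule ennreal_mult''[symmetric]) (use C measure_nonneg[of lborel "edge_prism e j k"] in simp)
  moreover have "emeasure surface_measure ?F = emeasure lborel ?P"
  proof -
    have "?F \<subseteq> {x. bary e x k - bary e x j = 0}" by (auto simp: dual_facet_def)
    from surface_measure_on_hyperplane[OF dual_hyperplane this borel_dual_facet]
    show ?thesis unfolding H emeasure_hyperplane_measure[OF \<nu> borel_dual_facet] .
  qed
  ultimately show ?thesis by (simp add: C_def mult_ac)
qed

text \<open>On the relative boundary a further coordinate vanishes or equals those of \<open>j\<close> and \<open>k\<close>, which confines
  the point to a second hyperplane.\<close>

lemma dual_facet_boundary_null:
  "\<exists>Z\<in>null_sets surface_measure.
     {x \<in> convex hull e. bary e x j = bary e x k \<and> (\<forall>l\<in>e. bary e x l \<le> bary e x j)} - dual_facet e j k \<subseteq> Z"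
proof
  let ?H = "{x. bary e x k - bary e x j = 0}"
  let ?Z = "\<Union>l\<in>e - {j, k}. (?H \<inter> {x. bary e x l = 0}) \<union> (?H \<inter> {x. bary e x j - bary e x l = 0})"
  show "?Z \<in> null_sets surface_measure"
  proof (rule null_sets_UN'[OF countable_finite])
    show "finite (e - {j, k})" using full_simplex_finite[OF e] by simp
    fix l assume l: "l \<in> e - {j, k}"
    then have le: "l \<in> e" by simp
    have h1: "{x. bary e x l = 0} \<in> hyperplanes"
    proof (rule affine_level_hyperplane[of "bary_grad e l"])
      show "bary_grad e l \<noteq> 0" using bary_grad_nonzero[OF e le jk(1)] l by blast
      show "bary e x l = bary e 0 l + bary_grad e l \<bullet> x" for x using bary_affine[OF e, of x l 0] by simp
    qed
    have h2: "{x. bary e x j - bary e x l = 0} \<in> hyperplanes"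
    proof (rule affine_level_hyperplane[of "bary_grad e j - bary_grad e l"])
      show "bary_grad e j - bary_grad e l \<noteq> 0"
        using bary_grad_edge[OF e le jk(1), of l] bary_grad_edge[OF e le jk(1), of j] l by auto
      show "bary e x j - bary e x l = bary e 0 j - bary e 0 l + (bary_grad e j - bary_grad e l) \<bullet> x" for x
        using bary_affine[OF e, of x l 0] bary_affine[OF e, of x j 0] by (simp add: inner_diff_left)
    qed
    have "l \<in> ?H" "l \<notin> {x. bary e x l = 0}" "l \<notin> {x. bary e x j - bary e x l = 0}"
      using l by (auto simp: bary_vertex[OF e le])
    then show "(?H \<inter> {x. bary e x l = 0}) \<union> (?H \<inter> {x. bary e x j - bary e x l = 0}) \<in> null_sets surface_measure"
      using surface_measure_null[OF dual_hyperplane h1] surface_measure_null[OF dual_hyperplane h2]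
      by (intro null_sets.Un) blast+
  qed
  show "{x \<in> convex hull e. bary e x j = bary e x k \<and> (\<forall>l\<in>e. bary e x l \<le> bary e x j)} - dual_facet e j k \<subseteq> ?Z"
  proof
    fix x
    assume x: "x \<in> {x \<in> convex hull e. bary e x j = bary e x k \<and> (\<forall>l\<in>e. bary e x l \<le> bary e x j)} - dual_facet e j k"
    then have nn: "\<And>l. l \<in> e \<Longrightarrow> 0 \<le> bary e x l" and le: "\<And>l. l \<in> e \<Longrightarrow> bary e x l \<le> bary e x j"
      and eq: "bary e x j = bary e x k" by (auto simp: in_hull_iff[OF e])
    have "0 < bary e x j"
    proof (rule ccontr)
      assume "\<not> 0 < bary e x j"
      then have "(\<Sum>l\<in>e. bary e x l) \<le> 0" using le by (intro sum_nonpos) force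
      then show False using bary_sum[OF e] by simp
    qed
    then obtain l where l: "l \<in> e - {j, k}" "\<not> (0 < bary e x l \<and> bary e x l < bary e x j)"
      using x eq unfolding dual_facet_def by blast
    then have "bary e x l = 0 \<or> bary e x j - bary e x l = 0" using nn[of l] le[of l] by auto
    then show "x \<in> ?Z" using l(1) eq by auto
  qed
qed

end

section \<open>Measurability of the unit normal\<close>

text \<open>Moving from \<open>x\<close> a little in direction \<open>\<mu> - \<nu>\<close> leads to the side of \<open>U\<close> according to \<open>\<nu>\<close>, but away from
  it according to \<open>\<mu>\<close>.\<close>

lemma is_unit_normal_unique:
  assumes "is_unit_normal U V x \<nu>" "is_unit_normal U V x \<mu>"
  shows "\<nu> = \<mu>"
proof (rule ccontr)
  assume ne: "\<nu> \<noteq> \<mu>"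
  obtain \<epsilon> where 1: "norm \<nu> = 1" "\<epsilon> > 0" "U \<inter> ball x \<epsilon> = {y \<in> ball x \<epsilon>. \<nu> \<bullet> (y - x) \<le> 0}"
    using assms(1) by (auto simp: is_unit_normal_def)
  obtain \<epsilon>' where 2: "norm \<mu> = 1" "\<epsilon>' > 0" "U \<inter> ball x \<epsilon>' = {y \<in> ball x \<epsilon>'. \<mu> \<bullet> (y - x) \<le> 0}"
    using assms(2) by (auto simp: is_unit_normal_def)
  have "0 < (\<nu> - \<mu>) \<bullet> (\<nu> - \<mu>)" using ne by simp
  then have lt: "\<nu> \<bullet> \<mu> < 1"
    using 1(1) 2(1) by (simp add: inner_diff_left inner_diff_right norm_eq_1 inner_commute)
  define t where "t = min \<epsilon> \<epsilon>' / 4"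
  have t: "t > 0" using 1 2 by (simp add: t_def)
  define y where "y = x + t *\<^sub>R (\<mu> - \<nu>)"
  have "norm (\<mu> - \<nu>) \<le> 2" using norm_triangle_ineq4[of \<mu> \<nu>] 1 2 by simp
  then have "dist x y \<le> t * 2" using t by (simp add: y_def dist_norm)
  then have yb: "y \<in> ball x \<epsilon>" "y \<in> ball x \<epsilon>'" using 1(2) 2(2) by (auto simp: t_def)
  have "\<nu> \<bullet> (y - x) = t * (\<nu> \<bullet> \<mu> - 1)" "\<mu> \<bullet> (y - x) = t * (1 - \<nu> \<bullet> \<mu>)"
    using 1(1) 2(1) by (auto simp: y_def inner_diff_right norm_eq_1 inner_commute)
  then have "\<nu> \<bullet> (y - x) \<le> 0" "\<not> \<mu> \<bullet> (y - x) \<le> 0" using lt t by (auto simp: mult_le_0_iff not_le)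
  then show False using 1(3) 2(3) yb by blast
qed

lemma unit_normal_into_eq:
  assumes "is_unit_normal U V x \<nu>"
  shows "unit_normal_into U V x = \<nu>"
proof -
  have ex: "\<exists>!\<nu>. is_unit_normal U V x \<nu>" using assms is_unit_normal_unique by blast
  have "(THE \<nu>. is_unit_normal U V x \<nu>) = \<nu>" by (rule the1_equality[OF ex assms])
  then show ?thesis by (simp only: unit_normal_into_def ex if_True)
qed

text \<open>Near a regular point the common points of the two sets lie on the tangent hyperplane, and seen from
  them the sets are the same half-balls.  So the normal is locally constant.\<close>

lemma is_unit_normal_nearby:
  assumes "is_unit_normal U V x \<nu>"
  shows "\<exists>\<epsilon>>0. \<forall>y\<in>U \<inter> V \<inter> ball x \<epsilon>. is_unit_normal U V y \<nu>"
proof -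
  obtain \<epsilon> where 1: "norm \<nu> = 1" "\<epsilon> > 0" "U \<inter> ball x \<epsilon> = {y \<in> ball x \<epsilon>. \<nu> \<bullet> (y - x) \<le> 0}"
     "V \<inter> ball x \<epsilon> = {y \<in> ball x \<epsilon>. \<nu> \<bullet> (y - x) \<ge> 0}"
    using assms by (auto simp: is_unit_normal_def)
  have "is_unit_normal U V y \<nu>" if y: "y \<in> U" "y \<in> V" "y \<in> ball x \<epsilon>" for y
  proof -
    have "\<nu> \<bullet> (y - x) = 0" using 1(3,4) y by (intro antisym) blast+
    then have eq: "\<nu> \<bullet> (z - y) = \<nu> \<bullet> (z - x)" for z by (simp add: inner_diff_right)
    have sub: "ball y (\<epsilon> - dist x y) \<subseteq> ball x \<epsilon>"
      by (auto simp: subset_iff dist_commute) (metis add_less_cancel_left dist_commute dist_triangle_lt less_diff_eq add.commute)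
    have "U \<inter> ball y (\<epsilon> - dist x y) = {z \<in> ball y (\<epsilon> - dist x y). \<nu> \<bullet> (z - y) \<le> 0}"
      "V \<inter> ball y (\<epsilon> - dist x y) = {z \<in> ball y (\<epsilon> - dist x y). \<nu> \<bullet> (z - y) \<ge> 0}"
      unfolding eq using 1(3,4) sub by blast+
    then show ?thesis unfolding is_unit_normal_def using 1(1) y(3) by (intro conjI exI[of _ "\<epsilon> - dist x y"]) auto
  qed
  then show ?thesis using 1(2) by blast
qed

text \<open>The normal is locally constant where it is not 0, so the preimages of sets without 0 are relatively
  open in \<open>S\<close>; the set where it is 0 is the complement of such a preimage.\<close>

lemma measurable_unit_normal:
  fixes U V S :: "'a::euclidean_space set"
  assumes S: "closed S" "S \<subseteq> U \<inter> V"
  shows "(\<lambda>x. indicator S x *\<^sub>R unit_normal_into U V x) \<in> borel_measurable borel"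
proof -
  let ?N = "unit_normal_into U V" and ?f = "\<lambda>x. indicator S x *\<^sub>R unit_normal_into U V x"
  have nonzero: "?f -` W \<in> sets borel" if W: "0 \<notin> W" for W
  proof -
    define O' where "O' = \<Union>{ball x \<epsilon> | x \<epsilon>. x \<in> S \<and> ?N x \<in> W \<and> (\<forall>y\<in>S \<inter> ball x \<epsilon>. ?N y = ?N x)}"
    have "open O'" unfolding O'_def by auto
    moreover have "?f -` W = S \<inter> O'"
    proof (intro set_eqI iffI)
      fix x assume "x \<in> ?f -` W"
      then have x: "x \<in> S" "?N x \<in> W" using W by (cases "x \<in> S"; simp)+
      then have "?N x \<noteq> 0" using W by auto
      then obtain \<nu> where \<nu>: "is_unit_normal U V x \<nu>" unfolding unit_normal_into_def by metis
      obtain \<epsilon> where \<epsilon>: "\<epsilon> > 0" "\<forall>y\<in>U \<inter> V \<inter> ball x \<epsilon>. is_unit_normal U V y \<nu>"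
        using is_unit_normal_nearby[OF \<nu>] by blast
      have "\<forall>y\<in>S \<inter> ball x \<epsilon>. ?N y = ?N x"
        using \<epsilon>(2) S(2) unit_normal_into_eq[OF \<nu>] unit_normal_into_eq by blast
      then have "ball x \<epsilon> \<subseteq> O'" unfolding O'_def using x by blast
      then show "x \<in> S \<inter> O'" using x(1) \<epsilon>(1) by (meson IntI centre_in_ball subsetD)
    next
      fix y assume y: "y \<in> S \<inter> O'"
      then obtain x \<epsilon> where "?N x \<in> W" "\<forall>y\<in>S \<inter> ball x \<epsilon>. ?N y = ?N x" "y \<in> ball x \<epsilon>"
        unfolding O'_def by auto
      then show "y \<in> ?f -` W" using y by auto
    qed
    ultimately show ?thesis using S(1) by (auto simp: borel_closed)
  qed
  have zero: "?f -` {0} \<in> sets borel"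
  proof -
    have "?f -` {0} = UNIV - ?f -` (UNIV - {0})" by auto
    moreover have "?f -` (UNIV - {0}) \<in> sets borel" by (rule nonzero) simp
    ultimately show ?thesis by (metis sets.compl_sets space_borel)
  qed
  have vim: "f -` W = f -` (W - {0}) \<union> (if 0 \<in> W then f -` {0} else {})" for f :: "'a \<Rightarrow> 'a" and W
  proof (rule set_eqI)
    fix x show "x \<in> f -` W \<longleftrightarrow> x \<in> f -` (W - {0}) \<union> (if 0 \<in> W then f -` {0} else {})"
      by (cases "f x = 0") simp_all
  qed
  show ?thesis
  proof (rule borel_measurableI)
    fix W :: "'a set"
    have nz: "?f -` (W - {0}) \<in> sets borel" by (rule nonzero) simp
    have "?f -` (W - {0}) \<union> (if 0 \<in> W then ?f -` {0} else {}) \<in> sets borel"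
    proof (rule sets.Un[OF nz])
      show "(if 0 \<in> W then ?f -` {0} else {}) \<in> sets borel"
        using zero by (cases "0 \<in> W") (simp_all only: if_True if_False sets.empty_sets)
    qed
    then show "?f -` W \<inter> space borel \<in> sets borel"
      unfolding vim[symmetric] space_borel Int_UNIV_right .
  qed
qed

section \<open>Control volumes and face normals\<close>

lemma mesh_full_simplex: "conforming_simplicial_mesh T \<Longrightarrow> e \<in> T \<Longrightarrow> full_simplex e"
  by (simp add: conforming_simplicial_mesh_def full_simplex_def)

text \<open>A common face of two simplexes is spanned by vertices of either of them, and these vertices are its
  extreme points.\<close>

lemma mesh_intersection:
  assumes T: "conforming_simplicial_mesh T" and e: "e \<in> T" "e' \<in> T"
  shows "convex hull e \<inter> convex hull e' = convex hull (e \<inter> e')"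
proof -
  have ind: "\<not> affine_dependent e" "\<not> affine_dependent e'"
    using mesh_full_simplex[OF T] e by (auto simp: full_simplex_def)
  have "(convex hull e \<inter> convex hull e') face_of convex hull e"
    "(convex hull e' \<inter> convex hull e) face_of convex hull e'"
    using T e by (auto simp: conforming_simplicial_mesh_def)
  then obtain c c' where c: "c \<subseteq> e" "convex hull e \<inter> convex hull e' = convex hull c"
    and c': "c' \<subseteq> e'" "convex hull e' \<inter> convex hull e = convex hull c'"
    unfolding face_of_convex_hull_affine_independent[OF ind(1)] face_of_convex_hull_affine_independent[OF ind(2)]
    by blast
  have "\<not> affine_dependent c" "\<not> affine_dependent c'"
    using ind c(1) c'(1) affine_independent_subset by blast+
  then have "x \<in> c \<longleftrightarrow> x \<in> c'" for x
    using extreme_point_of_convex_hull_affine_independent[of c x]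
      extreme_point_of_convex_hull_affine_independent[of c' x] c(2) c'(2) by (simp add: Int_commute)
  then have "c \<subseteq> e \<inter> e'" using c(1) c'(1) by blast
  then have "convex hull e \<inter> convex hull e' \<subseteq> convex hull (e \<inter> e')"
    unfolding c(2) by (rule hull_mono)
  moreover have "convex hull (e \<inter> e') \<subseteq> convex hull e" "convex hull (e \<inter> e') \<subseteq> convex hull e'"
    by (intro hull_mono; blast)+
  ultimately show ?thesis by blast
qed

text \<open>The point lies in the hull of the common vertices and its coordinates there serve for both simplexes.\<close>

lemma mesh_bary_agree:
  assumes T: "conforming_simplicial_mesh T" and e: "e \<in> T" "e' \<in> T"
    and x: "x \<in> convex hull e" "x \<in> convex hull e'"
  shows "bary e x l = bary e' x l"
proof -
  note se = mesh_full_simplex[OF T e(1)] and se' = mesh_full_simplex[OF T e(2)]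
  have "finite (e \<inter> e')" using full_simplex_finite[OF se] by simp
  moreover have "x \<in> convex hull (e \<inter> e')" using mesh_intersection[OF T e] x by blast
  ultimately obtain u where u: "sum u (e \<inter> e') = 1" "(\<Sum>l\<in>e \<inter> e'. u l *\<^sub>R l) = x"
    using convex_hull_finite[of "e \<inter> e'"] by auto
  show ?thesis
    using bary_of_face[OF se _ u, of l] bary_of_face[OF se' _ u, of l] by simp
qed

lemma mesh_bary_support:
  assumes T: "conforming_simplicial_mesh T" and e: "e \<in> T" "e' \<in> T"
    and x: "x \<in> convex hull e" "x \<in> convex hull e'" and l: "bary e x l \<noteq> 0"
  shows "l \<in> e'"
  using mesh_bary_agree[OF T e x, of l] bary_outside[OF mesh_full_simplex[OF T e(2)], of l x] l by auto

lemma mesh_interior_disjoint: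
  assumes T: "conforming_simplicial_mesh T" and e: "e \<in> T" "e' \<in> T"
    and x: "x \<in> convex hull e'" and pos: "\<And>l. l \<in> e \<Longrightarrow> 0 < bary e x l"
  shows "e' = e"
proof -
  have "x \<in> convex hull e" using pos by (simp add: in_hull_iff[OF mesh_full_simplex[OF T e(1)]] less_imp_le)
  then have "e \<subseteq> e'" using mesh_bary_support[OF T e _ x] pos by force
  moreover have "card e = card e'" "finite e'"
    using mesh_full_simplex[OF T] e full_simplex_finite unfolding full_simplex_def by auto
  ultimately show ?thesis using card_subset_eq by metis
qed

lemma mesh_covers:
  assumes "conforming_simplicial_mesh T"
  obtains e where "e \<in> T" "x \<in> convex hull e"
  using assms unfolding conforming_simplicial_mesh_def by blast

lemma control_volume_eq:
  assumes T: "conforming_simplicial_mesh T"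
  shows "control_volume T j = (\<Union>e\<in>{e\<in>T. j \<in> e}. {x \<in> convex hull e. \<forall>l\<in>e. bary e x l \<le> bary e x j})"
  unfolding control_volume_def
proof (rule SUP_cong[OF refl])
  fix e assume "e \<in> {e\<in>T. j \<in> e}"
  then have e: "full_simplex e" and j: "j \<in> e" using mesh_full_simplex[OF T] by auto
  have fin: "finite e" by (rule full_simplex_finite[OF e])
  show "{\<Sum>l\<in>e. \<alpha> l *\<^sub>R l |\<alpha>. (\<forall>l\<in>e. \<alpha> l \<in> {0..1}) \<and> sum \<alpha> e = 1 \<and> \<alpha> j = Max (\<alpha> ` e)} =
      {x \<in> convex hull e. \<forall>l\<in>e. bary e x l \<le> bary e x j}" (is "?A = ?B")
  proof
    show "?A \<subseteq> ?B"
    proof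
      fix x assume "x \<in> ?A"
      then obtain \<alpha> where a: "x = (\<Sum>l\<in>e. \<alpha> l *\<^sub>R l)" "\<forall>l\<in>e. \<alpha> l \<in> {0..1}" "sum \<alpha> e = 1" "\<alpha> j = Max (\<alpha> ` e)"
        by blast
      have "bary e x l = \<alpha> l" if "l \<in> e" for l using bary_unique[OF e a(3) a(1)[symmetric] that] .
      then show "x \<in> ?B" using a fin j by (simp add: in_hull_iff[OF e])
    qed
    show "?B \<subseteq> ?A"
    proof
      fix x assume "x \<in> ?B"
      then have nn: "\<And>l. l \<in> e \<Longrightarrow> 0 \<le> bary e x l" and le: "\<And>l. l \<in> e \<Longrightarrow> bary e x l \<le> bary e x j"
        by (auto simp: in_hull_iff[OF e])
      have "bary e x l \<le> 1" if "l \<in> e" for l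
        using member_le_sum[OF that, of "bary e x"] nn fin bary_sum[OF e, of x] by simp
      moreover have "Max (bary e x ` e) = bary e x j"
        using fin j le by (intro Max_eqI) auto
      ultimately have "(\<forall>l\<in>e. bary e x l \<in> {0..1}) \<and> sum (bary e x) e = 1 \<and> bary e x j = Max (bary e x ` e)"
        using nn bary_sum[OF e] by simp
      then show "x \<in> ?A" by (intro CollectI exI[of _ "bary e x"]) (simp add: bary_repr[OF e])
    qed
  qed
qed

lemma bary_max_pos:
  assumes e: "full_simplex e" and le: "\<And>l. l \<in> e \<Longrightarrow> bary e x l \<le> bary e x j"
  shows "0 < bary e x j"
proof (rule ccontr)
  assume "\<not> 0 < bary e x j"
  then have "(\<Sum>l\<in>e. bary e x l) \<le> 0" using le by (intro sum_nonpos) force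
  then show False using bary_sum[OF e] by simp
qed

text \<open>Any simplex that contains the point decides its membership, although \<open>control_volume\<close> is a union
  over the simplexes at \<open>j\<close>: the coordinates do not depend on the simplex, and the largest coordinate
  is positive, so its vertex belongs to every simplex that contains the point.\<close>

lemma control_volume_iff:
  assumes T: "conforming_simplicial_mesh T" and e: "e \<in> T" and x: "x \<in> convex hull e"
  shows "x \<in> control_volume T j \<longleftrightarrow> j \<in> e \<and> (\<forall>l\<in>e. bary e x l \<le> bary e x j)"
proof
  assume "x \<in> control_volume T j"
  then obtain e' where e': "e' \<in> T" "j \<in> e'" "x \<in> convex hull e'" "\<And>l. l \<in> e' \<Longrightarrow> bary e' x l \<le> bary e' x j"
    unfolding control_volume_eq[OF T] by blast
  have pos: "0 < bary e' x j" by (rule bary_max_pos[OF mesh_full_simplex[OF T e'(1)] e'(4)])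
  have agree: "bary e x l = bary e' x l" for l by (rule mesh_bary_agree[OF T e e'(1) x e'(3)])
  have "j \<in> e" using mesh_bary_support[OF T e'(1) e e'(3) x] pos by force
  moreover have "bary e x l \<le> bary e x j" for l
    unfolding agree using e'(4)[of l] pos bary_outside[OF mesh_full_simplex[OF T e'(1)], of l x] by force
  ultimately show "j \<in> e \<and> (\<forall>l\<in>e. bary e x l \<le> bary e x j)" by blast
next
  assume "j \<in> e \<and> (\<forall>l\<in>e. bary e x l \<le> bary e x j)"
  then show "x \<in> control_volume T j" unfolding control_volume_eq[OF T] using e x by blast
qed

lemma compact_control_volume:
  assumes T: "conforming_simplicial_mesh T" and j: "j \<in> nodes T"
  shows "compact (control_volume T j)"
  unfolding control_volume_eq[OF T]
proof (rule compact_UN)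
  show "finite {e\<in>T. j \<in> e}" using T j by (simp add: conforming_simplicial_mesh_def)
  fix e assume "e \<in> {e\<in>T. j \<in> e}"
  then have e: "full_simplex e" using mesh_full_simplex[OF T] by auto
  have "{x \<in> convex hull e. \<forall>l\<in>e. bary e x l \<le> bary e x j} =
      convex hull e \<inter> (\<Inter>l\<in>e. {x. bary e x l \<le> bary e x j})" by auto
  moreover have "closed (\<Inter>l\<in>e. {x. bary e x l \<le> bary e x j})"
    by (intro closed_INT ballI closed_Collect_le continuous_bary[OF e])
  ultimately show "compact {x \<in> convex hull e. \<forall>l\<in>e. bary e x l \<le> bary e x j}"
    using compact_Int_closed[OF compact_hull[OF e], of "\<Inter>l\<in>e. {x. bary e x l \<le> bary e x j}"] by simp
qed

text \<open>The points of one simplex where all coordinates are positive and that of \<open>j\<close> is the largest form an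
  open set.\<close>

lemma control_volume_measure_pos:
  assumes T: "conforming_simplicial_mesh T" and j: "j \<in> nodes T"
  shows "0 < measure lebesgue (control_volume T j)"
proof -
  obtain e where e: "e \<in> T" "j \<in> e" using j by (auto simp: nodes_def)
  note se = mesh_full_simplex[OF T e(1)]
  have fin: "finite e" by (rule full_simplex_finite[OF se])
  let ?U = "(\<Inter>l\<in>e. {x. 0 < bary e x l}) \<inter> (\<Inter>l\<in>e - {j}. {x. bary e x l < bary e x j})"
  let ?K = "control_volume T j"
  have "open ?U"
    using fin by (intro open_Int open_INT ballI open_Collect_less continuous_on_const continuous_bary[OF se]) auto
  moreover have "?U \<noteq> {}"
  proof -
    let ?n = "real (card e)"
    let ?t = "\<lambda>l. (if l = j then 2 else 1) / (?n + 1)"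
    have n: "?n > 0" using e fin card_gt_0_iff by fastforce
    have "(\<Sum>l\<in>e. (if l = j then 2 else 1) :: real) = (\<Sum>l\<in>e. 1 + (if l = j then 1 else 0))"
      by (rule sum.cong) auto
    also have "\<dots> = ?n + 1" using fin e by (simp add: sum.distrib)
    finally have "(\<Sum>l\<in>e. ?t l) = 1" using n unfolding sum_divide_distrib[symmetric] by simp
    then obtain x where x: "\<forall>l\<in>e. bary e x l = ?t l"
      using open_subsimplex[OF se, of ?t] n by auto
    then have "x \<in> ?U" using n e(2) by (auto simp: divide_strict_right_mono)
    then show ?thesis by blast
  qed
  ultimately have pos: "0 < emeasure lborel ?U" by (rule emeasure_lborel_open_pos)
  have sub: "?U \<subseteq> ?K"
  proof
    fix x assume x: "x \<in> ?U"
    then have "x \<in> convex hull e" by (auto simp: in_hull_iff[OF se] less_imp_le)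
    moreover have "bary e x l \<le> bary e x j" if "l \<in> e" for l using x that by (cases "l = j") (auto intro: less_imp_le)
    ultimately show "x \<in> ?K" using control_volume_iff[OF T e(1)] e(2) by blast
  qed
  have K: "?K \<in> sets borel" using compact_control_volume[OF T j] by (rule borel_compact)
  have "0 < emeasure lborel ?K" by (rule less_le_trans[OF pos emeasure_mono[OF sub]]) (use K in simp)
  then have "0 < measure lborel ?K"
    using emeasure_compact_finite[OF compact_control_volume[OF T j]] by (simp add: measure_def enn2real_positive_iff)
  then show ?thesis using K by (simp add: measure_completion)
qed

text \<open>Near such a point only the coordinates of \<open>j\<close> and \<open>k\<close> compete for the maximum.\<close>

lemma unit_normal_on_dual_facet:
  assumes T: "conforming_simplicial_mesh T" and e: "e \<in> T" and jk: "j \<in> e" "k \<in> e" "j \<noteq> k"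
    and x: "x \<in> dual_facet e j k"
  shows "is_unit_normal (control_volume T j) (control_volume T k) x (edge_normal e j k /\<^sub>R norm (edge_normal e j k))"
proof -
  let ?g = "edge_normal e j k"
  note se = mesh_full_simplex[OF T e]
  have g: "?g \<noteq> 0" by (rule edge_normal_nonzero[OF se jk])
  have fin: "finite e" by (rule full_simplex_finite[OF se])
  let ?O = "(\<Inter>l\<in>e. {x. 0 < bary e x l}) \<inter>
     (\<Inter>l\<in>e - {j, k}. {x. bary e x l < bary e x j} \<inter> {x. bary e x l < bary e x k})"
  have "open ?O"
    using fin by (intro open_Int open_INT ballI open_Collect_less continuous_on_const continuous_bary[OF se]) auto
  moreover have "x \<in> ?O"
    using x by (auto simp: dual_facet_def)
  ultimately obtain \<epsilon> where \<epsilon>: "\<epsilon> > 0" "ball x \<epsilon> \<subseteq> ?O" using open_contains_ball by meson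
  have side: "(?g /\<^sub>R norm ?g) \<bullet> (y - x) = (bary e y k - bary e y j) / norm ?g" for y
    using bary_difference[OF se jk, of y x] x by (simp add: dual_facet_def divide_inverse mult.commute)
  have K: "y \<in> control_volume T j \<longleftrightarrow> bary e y k \<le> bary e y j"
      "y \<in> control_volume T k \<longleftrightarrow> bary e y j \<le> bary e y k" if y: "y \<in> ball x \<epsilon>" for y
  proof -
    have pos: "\<And>l. l \<in> e \<Longrightarrow> 0 < bary e y l"
      and lt: "\<And>l. l \<in> e \<Longrightarrow> l \<noteq> j \<Longrightarrow> l \<noteq> k \<Longrightarrow> bary e y l < bary e y j \<and> bary e y l < bary e y k"
      using y \<epsilon>(2) by auto
    have h: "y \<in> convex hull e" using pos by (simp add: in_hull_iff[OF se] less_imp_le)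
    show "y \<in> control_volume T j \<longleftrightarrow> bary e y k \<le> bary e y j"
      unfolding control_volume_iff[OF T e h] using jk lt by (metis less_imp_le order_refl)
    show "y \<in> control_volume T k \<longleftrightarrow> bary e y j \<le> bary e y k"
      unfolding control_volume_iff[OF T e h] using jk lt by (metis less_imp_le order_refl)
  qed
  have ng: "norm ?g > 0" using g by simp
  have le: "((?g /\<^sub>R norm ?g) \<bullet> (y - x) \<le> 0) = (bary e y k \<le> bary e y j)"
    "((?g /\<^sub>R norm ?g) \<bullet> (y - x) \<ge> 0) = (bary e y j \<le> bary e y k)" for y
    unfolding side using ng by (auto simp: divide_le_0_iff zero_le_divide_iff)
  show ?thesis unfolding is_unit_normal_def le
    using g \<epsilon>(1) K by (intro conjI exI[of _ \<epsilon>]) auto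
qed

lemma regular_in_frontier:
  fixes x :: "'a::euclidean_space"
  assumes "is_unit_normal U V x \<nu>"
  shows "x \<in> frontier U \<inter> frontier V"
proof -
  obtain \<epsilon> where 1: "norm \<nu> = 1" "\<epsilon> > 0" "U \<inter> ball x \<epsilon> = {y \<in> ball x \<epsilon>. \<nu> \<bullet> (y - x) \<le> 0}"
     "V \<inter> ball x \<epsilon> = {y \<in> ball x \<epsilon>. \<nu> \<bullet> (y - x) \<ge> 0}"
    using assms by (auto simp: is_unit_normal_def)
  have xU: "x \<in> U" "x \<in> V" using 1 by auto
  have "\<exists>y\<in>ball x \<delta>. y \<notin> U" "\<exists>y\<in>ball x \<delta>. y \<notin> V" if d: "\<delta> > 0" for \<delta>
  proof -
    define t where "t = min \<epsilon> \<delta> / 2"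
    have t: "t > 0" "t < \<epsilon>" "t < \<delta>" using d 1(2) by (auto simp: t_def)
    have nn: "\<nu> \<bullet> \<nu> = 1" using 1(1) by (simp add: norm_eq_1)
    have p: "x + t *\<^sub>R \<nu> \<in> ball x \<epsilon>" "x + t *\<^sub>R \<nu> \<in> ball x \<delta>" "x - t *\<^sub>R \<nu> \<in> ball x \<epsilon>" "x - t *\<^sub>R \<nu> \<in> ball x \<delta>"
      using t 1(1) by (auto simp: dist_norm)
    have "x + t *\<^sub>R \<nu> \<notin> U"
    proof
      assume "x + t *\<^sub>R \<nu> \<in> U"
      then have "x + t *\<^sub>R \<nu> \<in> {y \<in> ball x \<epsilon>. \<nu> \<bullet> (y - x) \<le> 0}" using p(1) 1(3) by blast
      then show False using t nn by simp
    qed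
    moreover have "x - t *\<^sub>R \<nu> \<notin> V"
    proof
      assume "x - t *\<^sub>R \<nu> \<in> V"
      then have "x - t *\<^sub>R \<nu> \<in> {y \<in> ball x \<epsilon>. \<nu> \<bullet> (y - x) \<ge> 0}" using p(3) 1(4) by blast
      then show False using t nn by simp
    qed
    ultimately show "\<exists>y\<in>ball x \<delta>. y \<notin> U" "\<exists>y\<in>ball x \<delta>. y \<notin> V" using p by blast+
  qed
  then have "x \<notin> interior U" "x \<notin> interior V" unfolding mem_interior by blast+
  then show ?thesis using xU closure_subset by (auto simp: frontier_def)
qed

text \<open>Up to a null set the interface is the disjoint union of the dual facets, on each of which the normal
  is constant.  The length of the coordinate gradient in the area of a dual facet cancels against its
  normalization in the unit normal.\<close>

lemma face_normal_formula:
  fixes T :: "(real^'d::finite) set set"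
  assumes T: "conforming_simplicial_mesh T" and j: "j \<in> nodes T" and k: "k \<in> nodes T" and ne: "j \<noteq> k"
  shows "face_normal T j k = (prism_ratio TYPE('d) / 2) *\<^sub>R (\<Sum>e\<in>{e\<in>T. j \<in> e \<and> k \<in> e}. simplex_volume e *\<^sub>R edge_normal e j k)"
proof -
  define C where "C = prism_ratio TYPE('d)"
  let ?E = "{e\<in>T. j \<in> e \<and> k \<in> e}" and ?Kj = "control_volume T j" and ?Kk = "control_volume T k"
  let ?S = "frontier ?Kj \<inter> frontier ?Kk"
  let ?N = "unit_normal_into ?Kj ?Kk"
  let ?n = "\<lambda>e. edge_normal e j k /\<^sub>R norm (edge_normal e j k)"
  let ?f = "\<lambda>x. indicator ?S x *\<^sub>R ?N x"
  let ?h = "\<lambda>x. \<Sum>e\<in>?E. indicator (dual_facet e j k) x *\<^sub>R ?n e"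
  have "finite {e\<in>T. j \<in> e}" using T j by (simp add: conforming_simplicial_mesh_def)
  then have finE: "finite ?E" by (rule rev_finite_subset) auto
  have se: "full_simplex e" "j \<in> e" "k \<in> e" if "e \<in> ?E" for e using mesh_full_simplex[OF T] that by auto
  have closed: "closed ?Kj" "closed ?Kk" using compact_control_volume[OF T] j k compact_imp_closed by auto
  have SK: "?S \<subseteq> ?Kj \<inter> ?Kk" using frontier_subset_closed closed by blast
  have fm: "?f \<in> borel_measurable borel" by (rule measurable_unit_normal[OF _ SK]) auto
  have dm: "dual_facet e j k \<in> sets borel" if "e \<in> ?E" for e by (rule borel_dual_facet[OF se[OF that] ne])
  have hm: "?h \<in> borel_measurable borel"
    by (intro borel_measurable_sum borel_measurable_scaleR borel_measurable_indicator dm) auto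
  have em: "emeasure surface_measure (dual_facet e j k) = ennreal (C / 2 * simplex_volume e * norm (edge_normal e j k))"
    if "e \<in> ?E" for e
    unfolding C_def by (rule surface_measure_dual_facet[OF se[OF that] ne])
  have nonneg: "0 \<le> C / 2 * simplex_volume e * norm (edge_normal e j k)" if "e \<in> ?E" for e
  proof -
    have "0 \<le> C * simplex_volume e" unfolding C_def edge_prism_volume[OF se[OF that] ne, symmetric] by (rule measure_nonneg)
    then show ?thesis by (simp add: zero_le_mult_iff)
  qed
  have "\<forall>e\<in>?E. \<exists>Z. Z \<in> null_sets surface_measure \<and>
     {x \<in> convex hull e. bary e x j = bary e x k \<and> (\<forall>l\<in>e. bary e x l \<le> bary e x j)} - dual_facet e j k \<subseteq> Z"
  proof
    fix e assume "e \<in> ?E"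
    from dual_facet_boundary_null[OF se[OF this] ne]
    show "\<exists>Z. Z \<in> null_sets surface_measure \<and>
     {x \<in> convex hull e. bary e x j = bary e x k \<and> (\<forall>l\<in>e. bary e x l \<le> bary e x j)} - dual_facet e j k \<subseteq> Z"
      by (simp only: Bex_def)
  qed
  from bchoice[OF this] obtain Z where Z: "\<forall>e\<in>?E. Z e \<in> null_sets surface_measure \<and>
     {x \<in> convex hull e. bary e x j = bary e x k \<and> (\<forall>l\<in>e. bary e x l \<le> bary e x j)} - dual_facet e j k \<subseteq> Z e" ..
  have "AE x in surface_measure. ?f x = ?h x"
  proof (rule AE_I')
    show "(\<Union>e\<in>?E. Z e) \<in> null_sets surface_measure"
      using finE Z by (intro null_sets_UN' countable_finite) auto
    show "{x \<in> space surface_measure. ?f x \<noteq> ?h x} \<subseteq> (\<Union>e\<in>?E. Z e)"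
    proof
      fix x assume "x \<in> {x \<in> space surface_measure. ?f x \<noteq> ?h x}"
      then have neq: "?f x \<noteq> ?h x" by simp
      have out: "x \<notin> dual_facet e j k" if e: "e \<in> ?E" for e
      proof
        assume x: "x \<in> dual_facet e j k"
        have un: "is_unit_normal ?Kj ?Kk x (?n e)"
          using unit_normal_on_dual_facet[OF T _ _ _ ne x] e by simp
        have pos: "0 < bary e x l" if "l \<in> e" for l
          using x that by (cases "l = j \<or> l = k") (auto simp: dual_facet_def)
        have "x \<notin> dual_facet e' j k" if e': "e' \<in> ?E" "e' \<noteq> e" for e'
        proof
          assume x': "x \<in> dual_facet e' j k"
          have "0 < bary e' x l" if "l \<in> e'" for l
            using x' that by (cases "l = j \<or> l = k") (auto simp: dual_facet_def)
          then have "x \<in> convex hull e'" by (simp add: in_hull_iff[OF se(1)[OF e'(1)]] less_imp_le)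
          then have "e' = e" using mesh_interior_disjoint[OF T _ _ _ pos] e e'(1) by simp
          then show False using e'(2) by simp
        qed
        then have "?h x = (\<Sum>e'\<in>?E. if e' = e then ?n e else 0)"
          using x by (intro sum.cong) auto
        also have "\<dots> = ?n e" using finE e by simp
        also have "\<dots> = ?f x"
          using unit_normal_into_eq[OF un] regular_in_frontier[OF un] by simp
        finally show False using neq by simp
      qed
      then have "?h x = 0" by (intro sum.neutral) simp
      then have "x \<in> ?S" using neq by (cases "x \<in> ?S") auto
      then have xK: "x \<in> ?Kj" "x \<in> ?Kk" using SK by auto
      then obtain e where e: "e \<in> T" "j \<in> e" "x \<in> convex hull e"
        unfolding control_volume_eq[OF T] by blast
      have b: "k \<in> e" "\<forall>l\<in>e. bary e x l \<le> bary e x j" "\<forall>l\<in>e. bary e x l \<le> bary e x k"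
        using xK control_volume_iff[OF T e(1,3)] by auto
      then have "bary e x j = bary e x k" using e(2) by (intro antisym) auto
      moreover have eE: "e \<in> ?E" using e b by simp
      ultimately have "x \<in> Z e" using bspec[OF Z eE] out[OF eE] e(3) b(2) by blast
      then show "x \<in> (\<Union>e\<in>?E. Z e)" using eE by blast
    qed
  qed
  then have "face_normal T j k = (\<integral>x. ?h x \<partial>surface_measure)"
    unfolding face_normal_def set_lebesgue_integral_def
    by (intro integral_cong_AE) (use fm hm in \<open>auto simp: measurable_def sets_eq_imp_space_eq[OF sets_surface_measure]\<close>)
  also have "\<dots> = (\<Sum>e\<in>?E. \<integral>x. indicator (dual_facet e j k) x *\<^sub>R ?n e \<partial>surface_measure)"
    by (rule Bochner_Integration.integral_sum)
      (intro integrable_scaleR_left impI integrable_real_indicator, use dm em in auto)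
  also have "\<dots> = (\<Sum>e\<in>?E. (C / 2) *\<^sub>R (simplex_volume e *\<^sub>R edge_normal e j k))"
  proof (rule sum.cong[OF refl])
    fix e assume e: "e \<in> ?E"
    have "(\<integral>x. indicator (dual_facet e j k) x *\<^sub>R ?n e \<partial>surface_measure) =
        measure surface_measure (dual_facet e j k) *\<^sub>R ?n e"
      using dm[OF e] em[OF e] by (subst integral_scaleR_left) (auto intro!: integrable_real_indicator simp: sets_eq_imp_space_eq[OF sets_surface_measure])
    also have "measure surface_measure (dual_facet e j k) = C / 2 * simplex_volume e * norm (edge_normal e j k)"
      using em[OF e] nonneg[OF e] by (simp add: measure_def)
    also have "(C / 2 * simplex_volume e * norm (edge_normal e j k)) *\<^sub>R ?n e = (C / 2) *\<^sub>R (simplex_volume e *\<^sub>R edge_normal e j k)"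
      using edge_normal_nonzero[OF se[OF e] ne] by simp
    finally show "(\<integral>x. indicator (dual_facet e j k) x *\<^sub>R ?n e \<partial>surface_measure) =
      (C / 2) *\<^sub>R (simplex_volume e *\<^sub>R edge_normal e j k)" .
  qed
  finally show ?thesis by (simp add: C_def scaleR_sum_right)
qed

section \<open>Integration by parts against hat functions\<close>

lemma periodic_conforming: "periodic_simplicial_mesh T \<Longrightarrow> conforming_simplicial_mesh T"
  by (simp add: periodic_simplicial_mesh_def)

lemma periodic_translate:
  assumes "periodic_simplicial_mesh T" "integer_vector z" "e \<in> T"
  shows "(+) z ` e \<in> T"
proof -
  have "(\<lambda>e. (+) z ` e) ` T = T" using assms by (simp add: periodic_simplicial_mesh_def)
  then show ?thesis using assms(3) by blast
qed

lemma integer_vector_uminus: "integer_vector z \<Longrightarrow> integer_vector (- z)"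
  by (simp add: integer_vector_def)

lemma periodic_nodes:
  assumes "periodic_simplicial_mesh T" "integer_vector z" "j \<in> nodes T"
  shows "z + j \<in> nodes T"
  using periodic_translate[OF assms(1,2)] assms(3) unfolding nodes_def by blast

lemma integer_part:
  fixes x :: "real^'d::finite"
  obtains z where "integer_vector z" "x - z \<in> cbox 0 1"
proof
  show "integer_vector (\<chi> i. of_int \<lfloor>x $ i\<rfloor>)" by (simp add: integer_vector_def)
  have "0 \<le> x $ i - of_int \<lfloor>x $ i\<rfloor>" "x $ i - of_int \<lfloor>x $ i\<rfloor> \<le> 1" for i
    by linarith+
  then show "x - (\<chi> i. of_int \<lfloor>x $ i\<rfloor>) \<in> cbox 0 1" by (simp add: mem_box_cart)
qed

lemma finite_integer_vectors: "finite {z :: real^'d::finite. integer_vector z \<and> norm z \<le> r}"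
proof -
  define N where "N = \<lceil>\<bar>r\<bar>\<rceil>"
  have "{z :: real^'d. integer_vector z \<and> norm z \<le> r} \<subseteq> (\<lambda>h. \<chi> i. of_int (h i)) ` (UNIV \<rightarrow>\<^sub>E {-N..N})"
  proof
    fix z :: "real^'d" assume "z \<in> {z. integer_vector z \<and> norm z \<le> r}"
    then have z: "\<And>i. z $ i \<in> \<int>" "norm z \<le> r" by (auto simp: integer_vector_def)
    have fl: "of_int \<lfloor>z $ i\<rfloor> = z $ i" for i using z(1)[of i] by (rule of_int_floor)
    have "\<lfloor>z $ i\<rfloor> \<in> {-N..N}" for i
    proof -
      have "\<bar>z $ i\<bar> \<le> of_int N"
        using component_le_norm_cart[of z i] z(2) unfolding N_def by linarith
      then have "real_of_int \<lfloor>z $ i\<rfloor> \<le> of_int N" "real_of_int (- N) \<le> of_int \<lfloor>z $ i\<rfloor>"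
        unfolding fl of_int_minus by linarith+
      then show ?thesis unfolding of_int_le_iff by simp
    qed
    then have mem: "(\<lambda>i. \<lfloor>z $ i\<rfloor>) \<in> UNIV \<rightarrow>\<^sub>E {-N..N}" by (simp add: PiE_UNIV_domain)
    have eq: "z = (\<chi> i. of_int \<lfloor>z $ i\<rfloor>)" by (simp add: fl)
    show "z \<in> (\<lambda>h. \<chi> i. of_int (h i)) ` (UNIV \<rightarrow>\<^sub>E {-N..N})"
      by (rule image_eqI[of _ _ "\<lambda>i. \<lfloor>z $ i\<rfloor>"]) (rule eq, rule mem)
  qed
  then show ?thesis by (rule finite_subset) (intro finite_imageI finite_PiE; simp)
qed

lemma finite_nodes_bounded:
  fixes T :: "(real^'d::finite) set set"
  assumes T: "periodic_simplicial_mesh T"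
  shows "finite (nodes T \<inter> cball 0 r)"
proof -
  obtain M where M: "\<And>y :: real^'d. y \<in> cbox 0 1 \<Longrightarrow> norm y \<le> M"
    using bounded_cbox bounded_iff by metis
  let ?Z = "{z :: real^'d. integer_vector z \<and> norm z \<le> r + M}"
  have "nodes T \<inter> cball 0 r \<subseteq> (\<Union>z\<in>?Z. (+) z ` (nodes T \<inter> cbox 0 1))"
  proof
    fix x assume x: "x \<in> nodes T \<inter> cball 0 r"
    obtain z where z: "integer_vector z" "x - z \<in> cbox 0 1" by (rule integer_part)
    have "norm z \<le> r + M" using norm_triangle_ineq4[of x "x - z"] M[OF z(2)] x by simp
    moreover have "x - z \<in> nodes T" using periodic_nodes[OF T integer_vector_uminus[OF z(1)], of x] x by simp
    ultimately show "x \<in> (\<Union>z\<in>?Z. (+) z ` (nodes T \<inter> cbox 0 1))"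
      using z by (intro UN_I[of z] image_eqI[of _ _ "x - z"]) auto
  qed
  moreover have "finite (\<Union>z\<in>?Z. (+) z ` (nodes T \<inter> cbox 0 1))"
    using T by (intro finite_UN_I finite_integer_vectors finite_imageI) (simp add: periodic_simplicial_mesh_def)
  ultimately show ?thesis by (rule finite_subset)
qed

text \<open>Up to integer translations there are finitely many simplexes, namely those with a vertex in the unit
  cube.\<close>

lemma mesh_size_bounded:
  fixes T :: "(real^'d::finite) set set"
  assumes T: "periodic_simplicial_mesh T"
  obtains D where "\<And>e x l. e \<in> T \<Longrightarrow> x \<in> convex hull e \<Longrightarrow> l \<in> e \<Longrightarrow> dist x l \<le> D"
proof -
  note TC = periodic_conforming[OF T]
  let ?T0 = "\<Union>j\<in>nodes T \<inter> cbox 0 1. {e\<in>T. j \<in> e}"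
  have fin: "finite ?T0"
    using T TC by (intro finite_UN_I) (auto simp: periodic_simplicial_mesh_def conforming_simplicial_mesh_def)
  have "dist x l \<le> (\<Sum>e\<in>?T0. diameter (convex hull e))" if e: "e \<in> T" and x: "x \<in> convex hull e" and l: "l \<in> e" for e x l
  proof -
    obtain z where z: "integer_vector z" "l - z \<in> cbox 0 1" by (rule integer_part)
    let ?e = "(+) (- z) ` e"
    have eT: "?e \<in> T" by (rule periodic_translate[OF T integer_vector_uminus[OF z(1)] e])
    have lz: "l - z \<in> ?e" using l by force
    have e0: "?e \<in> ?T0" using eT lz z(2) by (auto simp: nodes_def)
    have hull: "convex hull ?e = (+) (- z) ` (convex hull e)" by (rule convex_hull_translation)
    have "x - z \<in> convex hull ?e" unfolding hull using x by force
    moreover have "l - z \<in> convex hull ?e" using lz by (rule hull_inc)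
    moreover have "bounded (convex hull ?e)"
      using compact_hull[OF mesh_full_simplex[OF TC eT]] by (rule compact_imp_bounded)
    ultimately have "dist (x - z) (l - z) \<le> diameter (convex hull ?e)" by (intro diameter_bounded_bound)
    also have "\<dots> \<le> (\<Sum>e\<in>?T0. diameter (convex hull e))"
    proof (rule member_le_sum[OF e0 _ fin])
      fix e assume "e \<in> ?T0 - {?e}"
      then have "bounded (convex hull e)" using compact_hull[OF mesh_full_simplex[OF TC]] compact_imp_bounded by blast
      then show "0 \<le> diameter (convex hull e)" by (rule diameter_ge_0)
    qed
    finally show ?thesis by (simp add: dist_norm)
  qed
  then show thesis by (rule that)
qed

text \<open>A simplex that meets a bounded set has its vertices in a larger bounded set, which contains finitely
  many nodes.\<close>

lemma finite_simplices_meeting: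
  fixes T :: "(real^'d::finite) set set"
  assumes T: "periodic_simplicial_mesh T" and B: "bounded B"
  shows "finite {e\<in>T. convex hull e \<inter> B \<noteq> {}}"
proof -
  note TC = periodic_conforming[OF T]
  obtain D where D: "\<And>e x l. e \<in> T \<Longrightarrow> x \<in> convex hull e \<Longrightarrow> l \<in> e \<Longrightarrow> dist x l \<le> D"
    using mesh_size_bounded[OF T] by blast
  obtain r where r: "\<And>x. x \<in> B \<Longrightarrow> norm x \<le> r" using B bounded_iff by metis
  have "{e\<in>T. convex hull e \<inter> B \<noteq> {}} \<subseteq> (\<Union>j\<in>nodes T \<inter> cball 0 (r + D). {e\<in>T. j \<in> e})"
  proof
    fix e assume "e \<in> {e\<in>T. convex hull e \<inter> B \<noteq> {}}"
    then obtain x where e: "e \<in> T" and x: "x \<in> convex hull e" "x \<in> B" by blast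
    have "card e > 0" using mesh_full_simplex[OF TC e] by (simp add: full_simplex_def)
    then obtain l where l: "l \<in> e" by fastforce
    have "norm l \<le> r + D" using norm_triangle_ineq4[of x "x - l"] D[OF e x(1) l] r[OF x(2)] by (simp add: dist_norm)
    then show "e \<in> (\<Union>j\<in>nodes T \<inter> cball 0 (r + D). {e\<in>T. j \<in> e})"
      using e l by (auto simp: nodes_def)
  qed
  moreover have "finite (\<Union>j\<in>nodes T \<inter> cball 0 (r + D). {e\<in>T. j \<in> e})"
    using finite_nodes_bounded[OF T] TC by (intro finite_UN_I) (auto simp: conforming_simplicial_mesh_def)
  ultimately show ?thesis by (rule finite_subset)
qed

lemma countable_mesh:
  assumes T: "periodic_simplicial_mesh T"
  shows "countable T"
proof -
  have "T \<subseteq> (\<Union>n. {e\<in>T. convex hull e \<inter> cball 0 (real n) \<noteq> {}})"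
  proof
    fix e assume e: "e \<in> T"
    have "card e > 0" using mesh_full_simplex[OF periodic_conforming[OF T] e] by (simp add: full_simplex_def)
    then obtain l where l: "l \<in> e" by fastforce
    obtain n where "norm l \<le> real n" using real_arch_simple by blast
    then have "l \<in> convex hull e \<inter> cball 0 (real n)" using l by (simp add: hull_inc)
    then show "e \<in> (\<Union>n. {e\<in>T. convex hull e \<inter> cball 0 (real n) \<noteq> {}})" using e by blast
  qed
  moreover have "countable (\<Union>n. {e\<in>T. convex hull e \<inter> cball 0 (real n) \<noteq> {}})"
    by (rule countable_UN, simp, rule countable_finite, rule finite_simplices_meeting[OF T], simp)
  ultimately show ?thesis by (rule countable_subset)
qed

text \<open>The segment from \<open>x\<close> to \<open>y\<close> is covered by finitely many simplexes, and Lipschitz bounds on the members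
  of a finite closed cover of an interval combine to one on the interval.\<close>

lemma piecewise_lipschitz:
  fixes T :: "(real^'d::finite) set set" and u :: "real^'d \<Rightarrow> real"
  assumes T: "periodic_simplicial_mesh T" and M: "0 \<le> M"
    and lip: "\<And>e x y. e \<in> T \<Longrightarrow> x \<in> convex hull e \<Longrightarrow> y \<in> convex hull e \<Longrightarrow> \<bar>u x - u y\<bar> \<le> M * norm (x - y)"
  shows "\<bar>u x - u y\<bar> \<le> M * norm (x - y)"
proof -
  define \<gamma> where "\<gamma> t = x + t *\<^sub>R (y - x)" for t :: real
  have cont: "continuous_on UNIV \<gamma>" unfolding \<gamma>_def by (intro continuous_intros)
  let ?I = "{e\<in>T. convex hull e \<inter> \<gamma> ` {0..1} \<noteq> {}}"
  let ?U = "\<lambda>e. {0..1} \<inter> \<gamma> -` (convex hull e)"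
  have "(M * norm (y - x))-lipschitz_on {0..1} (\<lambda>t. u (\<gamma> t))"
  proof (rule lipschitz_on_closed_Union)
    show "finite ?I"
      by (intro finite_simplices_meeting[OF T] compact_imp_bounded compact_continuous_image
          continuous_on_subset[OF cont]) auto
    show "0 \<le> M * norm (y - x)" using M by simp
    fix e assume e: "e \<in> ?I"
    then have hull: "compact (convex hull e)" using compact_hull mesh_full_simplex[OF periodic_conforming[OF T]] by blast
    show "closed (?U e)"
      using continuous_closed_vimage[OF compact_imp_closed[OF hull]] cont
      by (intro closed_Int closed_vimage compact_imp_closed[OF hull]) auto
    show "(M * norm (y - x))-lipschitz_on (?U e) (\<lambda>t. u (\<gamma> t))"
    proof (rule lipschitz_onI)
      fix s t assume st: "s \<in> ?U e" "t \<in> ?U e"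
      then have "\<bar>u (\<gamma> s) - u (\<gamma> t)\<bar> \<le> M * norm (\<gamma> s - \<gamma> t)" using lip[of e] e by auto
      also have "\<gamma> s - \<gamma> t = (s - t) *\<^sub>R (y - x)" by (simp add: \<gamma>_def scaleR_left_diff_distrib)
      finally show "dist (u (\<gamma> s)) (u (\<gamma> t)) \<le> M * norm (y - x) * dist s t"
        by (simp add: dist_real_def mult_ac)
    qed (use M in simp)
  next
    show "{0..1} \<subseteq> (\<Union>e\<in>?I. ?U e)"
    proof
      fix t :: real assume t: "t \<in> {0..1}"
      obtain e where "e \<in> T" "\<gamma> t \<in> convex hull e" using mesh_covers[OF periodic_conforming[OF T]] by blast
      then show "t \<in> (\<Union>e\<in>?I. ?U e)" using t by blast
    qed
  qed
  from lipschitz_onD[OF this, of 0 1] show ?thesis by (simp add: \<gamma>_def dist_real_def norm_minus_commute)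
qed

text \<open>The integrands are the derivatives in direction \<open>v\<close> of the product \<open>u\<close> of \<open>w\<close> with the hat function of
  \<open>j\<close>.  Translation invariance makes the integrals of the difference quotients of \<open>u\<close> vanish.  As \<open>u\<close> is
  Lipschitz with compact support, dominated convergence passes this on to the derivative, which
  exists in the interiors of the simplexes, that is, almost everywhere.\<close>

lemma hat_function_by_parts:
  fixes T :: "(real^'d::finite) set set" and w :: "real^'d \<Rightarrow> real" and w' :: "real^'d \<Rightarrow> real^'d"
  assumes T: "periodic_simplicial_mesh T" and j: "j \<in> nodes T"
    and w: "\<And>x. (w has_derivative (\<lambda>h. w' x \<bullet> h)) (at x)" and w': "continuous_on UNIV w'"
  shows "(\<Sum>e\<in>{e\<in>T. j \<in> e}. simplex_integral e (\<lambda>x. (bary_grad e j \<bullet> v) * w x + bary e x j * (w' x \<bullet> v))) = 0"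
proof -
  note TC = periodic_conforming[OF T]
  note sx = mesh_full_simplex[OF TC]
  let ?S = "{e\<in>T. j \<in> e}"
  have finS: "finite ?S" using TC j by (simp add: conforming_simplicial_mesh_def)
  define u where "u x = bary (SOME e. e \<in> T \<and> x \<in> convex hull e) x j * w x" for x
  define G where "G e x = w x *\<^sub>R bary_grad e j + bary e x j *\<^sub>R w' x" for e x
  have u_eq: "u x = bary e x j * w x" if "e \<in> T" "x \<in> convex hull e" for e x
  proof -
    have "(SOME e. e \<in> T \<and> x \<in> convex hull e) \<in> T \<and> x \<in> convex hull (SOME e. e \<in> T \<and> x \<in> convex hull e)"
      by (rule someI[of _ e]) (use that in simp)
    then show ?thesis unfolding u_def using mesh_bary_agree[OF TC _ that(1) _ that(2)] by metis
  qed
  have w_cont: "continuous_on UNIV w" by (rule has_derivative_continuous_on[of _ _ "\<lambda>x h. w' x \<bullet> h"]) (use w in simp)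
  have G_cont: "continuous_on UNIV (G e)" if "e \<in> T" for e
    unfolding G_def by (intro continuous_intros w_cont w' continuous_bary sx that)
  have G_deriv: "((\<lambda>x. bary e x j * w x) has_derivative (\<lambda>h. G e x \<bullet> h)) (at x)" if "e \<in> T" for e x
  proof -
    have "((\<lambda>x. bary e 0 j + bary_grad e j \<bullet> (x - 0)) has_derivative (\<lambda>h. bary_grad e j \<bullet> h)) (at x)"
      by (auto intro!: derivative_eq_intros)
    then have "((\<lambda>x. bary e x j) has_derivative (\<lambda>h. bary_grad e j \<bullet> h)) (at x)"
      unfolding bary_affine[OF sx[OF that], of _ j 0, symmetric] .
    from has_derivative_mult[OF this w[of x]]
    show ?thesis by (rule has_derivative_eq_rhs) (auto simp: G_def inner_add_left)
  qed
  have G_out: "G e x = 0" if "e \<in> T" "j \<notin> e" for e x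
    using that by (simp add: G_def bary_outside[OF sx] bary_grad_outside[OF sx])
  \<comment> \<open>\<open>G e\<close> is the gradient of \<open>u\<close> inside \<open>e\<close>; it is bounded on the compact star of \<open>j\<close> and 0 elsewhere.\<close>
  have "bounded (\<Union>e\<in>?S. G e ` (convex hull e))"
  proof (intro bounded_UN finS ballI compact_imp_bounded compact_continuous_image)
    fix e assume "e \<in> ?S"
    then show "continuous_on (convex hull e) (G e)" "compact (convex hull e)"
      using G_cont continuous_on_subset compact_hull[OF sx] by blast+
  qed
  then have "\<exists>M>0. \<forall>y\<in>(\<Union>e\<in>?S. G e ` (convex hull e)). norm y \<le> M" by (simp only: bounded_pos)
  then obtain M where "M > 0" and M0: "\<forall>y\<in>(\<Union>e\<in>?S. G e ` (convex hull e)). norm y \<le> M"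
    by (elim exE conjE)
  have M': "norm y \<le> M" if "y \<in> (\<Union>e\<in>?S. G e ` (convex hull e))" for y
    using M0 that by (rule bspec)
  have M: "norm (G e x) \<le> M" if "e \<in> T" "x \<in> convex hull e" for e x
    using M'[of "G e x"] G_out[OF that(1)] \<open>M > 0\<close> that by (cases "j \<in> e") auto
  have lip: "\<bar>u x - u y\<bar> \<le> M * norm (x - y)" for x y
  proof (rule piecewise_lipschitz[OF T])
    show "0 \<le> M" using \<open>M > 0\<close> by simp
    fix e x y assume e: "e \<in> T" and xy: "x \<in> convex hull e" "y \<in> convex hull e"
    have "norm (bary e x j * w x - bary e y j * w y) \<le> M * norm (x - y)"
    proof (rule differentiable_bound[OF convex_convex_hull _ _ xy])
      fix z assume z: "z \<in> convex hull e"
      show "((\<lambda>x. bary e x j * w x) has_derivative (\<lambda>h. G e z \<bullet> h)) (at z within convex hull e)"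
        using G_deriv[OF e] by (rule has_derivative_at_withinI)
      show "onorm (\<lambda>h. G e z \<bullet> h) \<le> M"
      proof (rule onorm_le)
        fix h
        have "norm (G e z \<bullet> h) \<le> norm (G e z) * norm h" by (simp add: Cauchy_Schwarz_ineq2)
        also have "\<dots> \<le> M * norm h" by (intro mult_right_mono M[OF e z]) simp
        finally show "norm (G e z \<bullet> h) \<le> M * norm h" .
      qed
    qed
    then show "\<bar>u x - u y\<bar> \<le> M * norm (x - y)" using u_eq[OF e] xy by simp
  qed
  have u_cont: "continuous_on UNIV u"
    by (rule lipschitz_on_continuous_on[of M], rule lipschitz_onI)
      (use lip \<open>M > 0\<close> in \<open>auto simp: dist_norm\<close>)
  have [measurable]: "u \<in> borel_measurable borel" using u_cont by (rule borel_measurable_continuous_onI)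
  define K where "K = (\<Union>e\<in>?S. convex hull e)"
  have compact_K: "compact K" unfolding K_def using finS compact_hull[OF sx] by (intro compact_UN) auto
  obtain r where r: "\<And>x. x \<in> K \<Longrightarrow> norm x \<le> r" using compact_imp_bounded[OF compact_K] bounded_iff by metis
  have u_out: "u x = 0" if "x \<notin> K" for x
  proof -
    obtain e where e: "e \<in> T" "x \<in> convex hull e" using mesh_covers[OF TC] by blast
    then have "j \<notin> e" using that unfolding K_def by blast
    then show ?thesis using u_eq[OF e] bary_outside[OF sx[OF e(1)]] by simp
  qed
  have "integrable lborel (\<lambda>x. indicator K x *\<^sub>R u x)"
    by (rule borel_integrable_compact[OF compact_K continuous_on_subset[OF u_cont]]) simp
  moreover have "(\<lambda>x. indicator K x *\<^sub>R u x) = u"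
  proof (rule ext)
    show "indicator K x *\<^sub>R u x = u x" for x using u_out[of x] by (cases "x \<in> K") simp_all
  qed
  ultimately have u_int: "integrable lborel u" by simp
  have shift_int: "integrable lborel (\<lambda>x. u (c + x))" for c
  proof -
    have "integrable (distr lborel borel ((+) c)) u" using u_int by (simp add: lborel_distr_plus)
    then show ?thesis by (subst (asm) integrable_distr_eq) auto
  qed
  \<comment> \<open>For steps of at most 1 the difference quotients vanish outside of one common ball.\<close>
  define t where "t n = inverse (real (Suc n))" for n
  have t: "t n > 0" "t n \<le> 1" for n by (auto simp: t_def inverse_le_1_iff)
  have t_lim: "filterlim t (at 0) sequentially"
    unfolding filterlim_at t_def using LIMSEQ_inverse_real_of_nat by simp
  define q where "q n x = (u (t n *\<^sub>R v + x) - u x) / t n" for n x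
  have q_int: "(\<integral>x. q n x \<partial>lborel) = 0" for n
  proof -
    have "(\<integral>x. u x \<partial>lborel) = (\<integral>x. u (t n *\<^sub>R v + x) \<partial>lborel)"
      by (subst scales_volume_integral[OF scales_volume_translation[of "t n *\<^sub>R v"]]) auto
    then show ?thesis
      unfolding q_def using u_int shift_int by (simp add: Bochner_Integration.integral_diff)
  qed
  define L where "L x = (\<Sum>e\<in>?S. indicator (convex hull e) x * (G e x \<bullet> v))" for x
  have "(\<lambda>n. \<integral>x. q n x \<partial>lborel) \<longlonglongrightarrow> (\<integral>x. L x \<partial>lborel)"
  proof (rule integral_dominated_convergence[where w = "\<lambda>x. indicator (cball 0 (r + norm v)) x *\<^sub>R (M * norm v)"])
    have "(\<lambda>x. indicator (convex hull e) x * (G e x \<bullet> v)) \<in> borel_measurable borel" if "e \<in> ?S" for e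
      using that borel_hull[OF sx] borel_measurable_continuous_onI[OF G_cont]
      by (intro borel_measurable_times borel_measurable_indicator borel_measurable_inner) auto
    then show "L \<in> borel_measurable lborel" unfolding L_def by (intro borel_measurable_sum) auto
    show "q n \<in> borel_measurable lborel" for n unfolding q_def by measurable
    show "integrable lborel (\<lambda>x. indicator (cball 0 (r + norm v)) x *\<^sub>R (M * norm v))"
      by (rule borel_integrable_compact) auto
    show "AE x in lborel. norm (q n x) \<le> indicator (cball 0 (r + norm v)) x *\<^sub>R (M * norm v)" for n
    proof (rule AE_I2)
      fix x
      have "\<bar>q n x\<bar> = \<bar>u (t n *\<^sub>R v + x) - u x\<bar> / t n" using t(1)[of n] by (simp add: q_def)
      also have "\<dots> \<le> (M * norm (t n *\<^sub>R v)) / t n"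
        using t(1)[of n] lip[of "t n *\<^sub>R v + x" x] by (intro divide_right_mono) simp_all
      also have "\<dots> = M * norm v" using t(1)[of n] by simp
      finally have b: "\<bar>q n x\<bar> \<le> M * norm v" .
      show "norm (q n x) \<le> indicator (cball 0 (r + norm v)) x *\<^sub>R (M * norm v)"
      proof (cases "x \<in> cball 0 (r + norm v)")
        case False
        then have "x \<notin> K" using r[of x] norm_ge_zero[of v] by (auto simp del: norm_ge_zero)
        moreover have "t n *\<^sub>R v + x \<notin> K"
        proof
          assume "t n *\<^sub>R v + x \<in> K"
          then have "norm (t n *\<^sub>R v + x) \<le> r" by (rule r)
          moreover have "norm (t n *\<^sub>R v) \<le> norm v"
            using t[of n] mult_right_mono[of "t n" 1 "norm v"] by simp
          ultimately have "norm x \<le> r + norm v"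
            using norm_triangle_ineq4[of "t n *\<^sub>R v + x" "t n *\<^sub>R v"] by simp
          then show False using False by simp
        qed
        ultimately show ?thesis using u_out False by (simp add: q_def)
      qed (use b in simp)
    qed
    show "AE x in lborel. (\<lambda>n. q n x) \<longlonglongrightarrow> L x"
    proof -
      have "AE x in lborel. \<forall>e\<in>T. \<forall>l\<in>e. bary e x l \<noteq> 0"
      proof (intro AE_ball_countable[THEN iffD2] countable_mesh[OF T] ballI)
        fix e assume e: "e \<in> T"
        show "countable e" using full_simplex_finite[OF sx[OF e]] by (rule countable_finite)
        fix l assume l: "l \<in> e"
        obtain k where k: "k \<in> e" "k \<noteq> l" using full_simplex_other_vertex[OF sx[OF e] l] by blast
        have "{x. bary e x l = 0} \<in> null_sets lborel"
        proof (rule null_sets_affine_level)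
          show "bary_grad e l \<noteq> 0" by (rule bary_grad_nonzero[OF sx[OF e] l k])
          show "bary e x l = bary e 0 l + bary_grad e l \<bullet> x" for x using bary_affine[OF sx[OF e], of x l 0] by simp
        qed
        then show "AE x in lborel. bary e x l \<noteq> 0" by (rule AE_I') auto
      qed
      then show ?thesis
      proof (rule AE_mp, intro AE_I2 impI)
        fix x assume ne: "\<forall>e\<in>T. \<forall>l\<in>e. bary e x l \<noteq> 0"
        obtain e where e: "e \<in> T" "x \<in> convex hull e" using mesh_covers[OF TC] by blast
        have pos: "0 < bary e x l" if "l \<in> e" for l
          using e that ne in_hull_iff[OF sx[OF e(1)]] by (metis order_le_less)
        have uniq: "e' = e" if "e' \<in> T" "x \<in> convex hull e'" for e'
          by (rule mesh_interior_disjoint[OF TC e(1) that pos])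
        have "L x = (\<Sum>e'\<in>?S. if e' = e then G e x \<bullet> v else 0)"
          unfolding L_def by (intro sum.cong refl) (use uniq e(2) in \<open>auto simp: indicator_def\<close>)
        also have "\<dots> = G e x \<bullet> v"
          using finS e(1) G_out[OF e(1), of x] by (cases "j \<in> e") auto
        finally have Lx: "L x = G e x \<bullet> v" .
        let ?O = "\<Inter>l\<in>e. {x. 0 < bary e x l}"
        have "open ?O" using full_simplex_finite[OF sx[OF e(1)]]
          by (intro open_INT ballI open_Collect_less continuous_on_const continuous_bary[OF sx[OF e(1)]]) 
        then obtain \<epsilon> where \<epsilon>: "\<epsilon> > 0" "ball x \<epsilon> \<subseteq> ?O" using pos open_contains_ball by (metis (no_types, lifting) INT_I mem_Collect_eq)
        have hull: "y \<in> convex hull e" if "y \<in> ball x \<epsilon>" for y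
          using \<epsilon>(2) that by (auto simp: in_hull_iff[OF sx[OF e(1)]] less_imp_le)
        let ?W = "\<lambda>s. bary e (s *\<^sub>R v + x) j * w (s *\<^sub>R v + x)"
        have "((\<lambda>s. s *\<^sub>R v + x) has_derivative (\<lambda>s. s *\<^sub>R v)) (at 0)"
          by (auto intro!: derivative_eq_intros)
        moreover have "((\<lambda>x. bary e x j * w x) has_derivative (\<lambda>h. G e x \<bullet> h)) (at (0 *\<^sub>R v + x))"
          using G_deriv[OF e(1), of x] by simp
        ultimately have "(?W has_derivative (\<lambda>s. G e x \<bullet> (s *\<^sub>R v))) (at 0)"
          by (rule has_derivative_compose)
        then have "(?W has_real_derivative (G e x \<bullet> v)) (at 0)"
          by (rule has_derivative_imp_has_field_derivative) simp
        then have "((\<lambda>h. (?W (0 + h) - ?W 0) / h) \<longlongrightarrow> G e x \<bullet> v) (at 0)"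
          by (simp add: DERIV_def)
        then have lim: "(\<lambda>n. (?W (0 + t n) - ?W 0) / t n) \<longlonglongrightarrow> G e x \<bullet> v"
          by (rule filterlim_compose[OF _ t_lim])
        have "(\<lambda>n. t n *\<^sub>R v + x) \<longlonglongrightarrow> 0 *\<^sub>R v + x"
          using t_lim by (intro tendsto_intros) (simp add: filterlim_at)
        then have "\<forall>\<^sub>F n in sequentially. t n *\<^sub>R v + x \<in> ball x \<epsilon>"
          using \<epsilon>(1) by (intro topological_tendstoD) auto
        then have "\<forall>\<^sub>F n in sequentially. (?W (0 + t n) - ?W 0) / t n = q n x"
        proof eventually_elim
          case (elim n)
          then show ?case using u_eq[OF e(1) hull[OF elim]] u_eq[OF e] by (simp add: q_def)
        qed
        from Lim_transform_eventually[OF lim this] show "(\<lambda>n. q n x) \<longlonglongrightarrow> L x" unfolding Lx .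
      qed
    qed
  qed
  then have "(\<integral>x. L x \<partial>lborel) = 0" using q_int LIMSEQ_unique[of "\<lambda>n. 0"] by auto
  moreover have "(\<integral>x. L x \<partial>lborel) = (\<Sum>e\<in>?S. simplex_integral e (\<lambda>x. G e x \<bullet> v))"
    unfolding L_def simplex_integral_def
    by (rule Bochner_Integration.integral_sum)
      (intro integrable_on_hull continuous_intros G_cont sx; simp)
  ultimately show ?thesis by (simp add: G_def inner_add_left mult.commute)
qed

section \<open>Mass transport over the nodes\<close>

text \<open>Translating the pair \<open>(j, k)\<close> so that \<open>k\<close> becomes a representative and exchanging its entries is an
  involution on the pairs with first entry in \<open>R\<close>.\<close>

lemma mass_transport:
  fixes y :: "real^'d::finite \<Rightarrow> real^'d \<Rightarrow> 'b::comm_monoid_add"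
  assumes T: "periodic_simplicial_mesh T" and R: "node_representatives T R"
    and fin: "\<And>j. j \<in> nodes T \<Longrightarrow> finite (N j)" and sub: "\<And>j. j \<in> nodes T \<Longrightarrow> N j \<subseteq> nodes T"
    and sym: "\<And>j k. j \<in> nodes T \<Longrightarrow> k \<in> N j \<Longrightarrow> j \<in> N k"
    and transl: "\<And>j k z. integer_vector z \<Longrightarrow> j \<in> nodes T \<Longrightarrow> k \<in> N j \<Longrightarrow> z + k \<in> N (z + j)"
    and per: "\<And>j k z. integer_vector z \<Longrightarrow> j \<in> nodes T \<Longrightarrow> k \<in> N j \<Longrightarrow> y (z + j) (z + k) = y j k"
  shows "(\<Sum>j\<in>R. \<Sum>k\<in>N j. y j k) = (\<Sum>j\<in>R. \<Sum>k\<in>N j. y k j)"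
proof -
  have RN: "R \<subseteq> nodes T" using R by (simp add: node_representatives_def)
  have finR: "finite R" by (rule finite_node_representatives[OF T R])
  define rep where "rep k = (THE i. i \<in> R \<and> integer_vector (k - i))" for k
  have rep: "rep k \<in> R \<and> integer_vector (k - rep k)" if "k \<in> nodes T" for k
    unfolding rep_def by (rule theI') (use R that in \<open>simp add: node_representatives_def\<close>)
  have rep_eq: "rep k = i" if "k \<in> nodes T" "i \<in> R" "integer_vector (k - i)" for k i
    using R that rep[OF that(1)] unfolding node_representatives_def by blast
  define \<phi> where "\<phi> = (\<lambda>(j, k). (rep k, (rep k - k) + j))"
  have \<phi>: "\<phi> p \<in> Sigma R N \<and> \<phi> (\<phi> p) = p \<and> y (snd (\<phi> p)) (fst (\<phi> p)) = y (fst p) (snd p)"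
    if p: "p \<in> Sigma R N" for p
  proof -
    obtain j k where jk: "p = (j, k)" "j \<in> R" "k \<in> N j" using p by auto
    have j: "j \<in> nodes T" using jk RN by blast
    have k: "k \<in> nodes T" using sub[OF j] jk by blast
    define z where "z = rep k - k"
    have z: "integer_vector z" using integer_vector_uminus[of "k - rep k"] rep[OF k] by (simp add: z_def)
    have zk: "z + k = rep k" by (simp add: z_def)
    have 1: "z + j \<in> N (rep k)" using transl[OF z k sym[OF j jk(3)]] zk by simp
    have zj: "z + j \<in> nodes T" by (rule periodic_nodes[OF T z j])
    have r: "rep (z + j) = j" by (rule rep_eq[OF zj jk(2)]) (use z in simp)
    have "\<phi> p = (rep k, z + j)" by (simp add: \<phi>_def jk(1) z_def)
    moreover have "\<phi> (rep k, z + j) = (j, k)" by (simp add: \<phi>_def r) (simp add: z_def)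
    moreover have "y (z + j) (rep k) = y j k" using per[OF z j jk(3)] zk by simp
    ultimately show ?thesis using 1 rep[OF k] jk(1) by simp
  qed
  have finN: "\<forall>j\<in>R. finite (N j)" using fin RN by blast
  have "(\<Sum>j\<in>R. \<Sum>k\<in>N j. y j k) = (\<Sum>p\<in>Sigma R N. y (fst p) (snd p))"
    using sum.Sigma[OF finR finN, of y] by (simp add: case_prod_unfold)
  also have "\<dots> = (\<Sum>p\<in>Sigma R N. y (snd p) (fst p))"
    by (rule sum.reindex_bij_witness[where i = \<phi> and j = \<phi>]) (use \<phi> in blast)+
  also have "\<dots> = (\<Sum>j\<in>R. \<Sum>k\<in>N j. y k j)"
    using sum.Sigma[OF finR finN, of "\<lambda>j k. y k j"] by (simp add: case_prod_unfold)
  finally show ?thesis .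
qed

section \<open>The element identity\<close>

text \<open>The symmetric value \<open>(f\<^sub>j + f\<^sub>k)/2 + (\<nabla>f\<^sub>j - \<nabla>f\<^sub>k) \<bullet> (k - j)/4\<close> for the cube \<open>f\<close> of an affine function with the
  values \<open>s\<close> at \<open>j\<close> and \<open>t\<close> at \<open>k\<close>.\<close>

definition edge_mean :: "real \<Rightarrow> real \<Rightarrow> real" where
  "edge_mean s t = (s^3 + t^3) / 2 + 3 * (s\<^sup>2 - t\<^sup>2) * (t - s) / 4"

lemma edge_mean_commute: "edge_mean s t = edge_mean t s"
  by (simp add: edge_mean_def algebra_simps)

lemma edge_mean_expand: "edge_mean s t = s^3 + 3 / 2 * s\<^sup>2 * (t - s) - (t - s)^3 / 4"
  by (simp add: edge_mean_def power2_eq_square power3_eq_cube field_simps)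

text \<open>The contribution of \<open>e\<close> to the flux minus the source at \<open>j\<close> for \<open>f(x) = (a \<bullet> x + b)\<^sup>3\<close> and the direction
  \<open>v\<close>, up to the common factor of the face normals.  The second directional derivative of the gradient of \<open>f\<close>
  is \<open>6 (a \<bullet> (k - j))\<^sup>2 a\<close>, and \<open>6 d / (4 (d + 2)) / d = 3 / (2 (d + 2))\<close>.  The summand for \<open>k = j\<close> is 0.\<close>

definition element_defect :: "(real^'d::finite) set \<Rightarrow> real^'d \<Rightarrow> real \<Rightarrow> real^'d \<Rightarrow> real^'d \<Rightarrow> real" where
  "element_defect e a b v j = simplex_volume e *
     ((\<Sum>k\<in>e. edge_mean (a \<bullet> j + b) (a \<bullet> k + b) * (edge_normal e j k \<bullet> v)
        + 3 / (2 * (real CARD('d) + 2)) * (a \<bullet> (k - j))\<^sup>2 * (a \<bullet> v))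
      - 3 * (a \<bullet> j + b)\<^sup>2 * (a \<bullet> v))"

text \<open>The cube \<open>f\<close> of an affine function, extrapolated linearly from \<open>x\<close> half the way to \<open>j\<close>:
  \<open>f(x) - \<nabla>f(x) \<bullet> (x - j)/2\<close>.  The Taylor expansion at \<open>j\<close> has the coefficients of \<open>f\<close> multiplied by
  1, 1/2, 0, -1/2, and these are the multiples of the Taylor terms that make \<open>element_local\<close> true.\<close>

definition extrapolated_cube :: "real^'d::finite \<Rightarrow> real \<Rightarrow> real^'d \<Rightarrow> real^'d \<Rightarrow> real" where
  "extrapolated_cube a b j x = (a \<bullet> x + b)^3 - 3 / 2 * (a \<bullet> (x - j)) * (a \<bullet> x + b)\<^sup>2"

text \<open>The gradient of \<open>extrapolated_cube\<close> is this multiple of \<open>a\<close>.\<close>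

definition extrapolated_cube_slope :: "real^'d::finite \<Rightarrow> real \<Rightarrow> real^'d \<Rightarrow> real^'d \<Rightarrow> real" where
  "extrapolated_cube_slope a b j x = 3 / 2 * ((a \<bullet> j + b)\<^sup>2 - (a \<bullet> (x - j))\<^sup>2)"

lemma extrapolated_cube_derivative:
  "(extrapolated_cube a b j has_derivative (\<lambda>h. (extrapolated_cube_slope a b j x *\<^sub>R a) \<bullet> h)) (at x)"
proof -
  have "((\<lambda>x. (a \<bullet> x + b)^3 - 3 / 2 * (a \<bullet> (x - j)) * (a \<bullet> x + b)\<^sup>2) has_derivative
      (\<lambda>h. 3 * (a \<bullet> x + b)\<^sup>2 * (a \<bullet> h) - 3 / 2 * ((a \<bullet> h) * (a \<bullet> x + b)\<^sup>2
         + (a \<bullet> (x - j)) * (2 * (a \<bullet> x + b) * (a \<bullet> h))))) (at x)"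
    by (auto intro!: derivative_eq_intros simp: field_simps)
  moreover have "3 * L\<^sup>2 * A - 3 / 2 * (A * L\<^sup>2 + \<eta> * (2 * L * A)) = 3 / 2 * ((L - \<eta>)\<^sup>2 - \<eta>\<^sup>2) * A" for L A \<eta> :: real
    by (simp add: power2_eq_square field_simps)
  moreover have "a \<bullet> j + b = (a \<bullet> x + b) - a \<bullet> (x - j)" by (simp add: inner_diff_right)
  ultimately show ?thesis
    unfolding extrapolated_cube_def[abs_def] extrapolated_cube_slope_def inner_scaleR_left by (simp only:)
qed

text \<open>The integral of the derivative, in direction \<open>v\<close>, of a product with the coordinate of \<open>j\<close>.\<close>

definition element_correction :: "(real^'d::finite) set \<Rightarrow> real^'d \<Rightarrow> real \<Rightarrow> real^'d \<Rightarrow> real^'d \<Rightarrow> real" where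
  "element_correction e a b v j = simplex_integral e
     (\<lambda>x. (bary_grad e j \<bullet> v) * extrapolated_cube a b j x + bary e x j * ((extrapolated_cube_slope a b j x *\<^sub>R a) \<bullet> v))"

lemma correction_sum:
  assumes T: "periodic_simplicial_mesh T" and j: "j \<in> nodes T"
  shows "(\<Sum>e\<in>{e\<in>T. j \<in> e}. element_correction e a b v j) = 0"
  unfolding element_correction_def
proof (rule hat_function_by_parts[OF T j])
  show "continuous_on UNIV (\<lambda>x. extrapolated_cube_slope a b j x *\<^sub>R a)"
    unfolding extrapolated_cube_slope_def by (intro continuous_intros)
qed (rule extrapolated_cube_derivative)

lemma sum_antisymmetric:
  fixes g :: "'a \<Rightarrow> 'a \<Rightarrow> real"
  assumes "\<And>j k. g k j = - g j k"
  shows "(\<Sum>j\<in>e. \<Sum>k\<in>e. g j k) = 0"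
proof -
  have "(\<Sum>j\<in>e. \<Sum>k\<in>e. g j k) = (\<Sum>k\<in>e. \<Sum>j\<in>e. g j k)" by (rule sum.swap)
  also have "\<dots> = (\<Sum>k\<in>e. \<Sum>j\<in>e. - g k j)" by (intro sum.cong refl assms)
  also have "\<dots> = - (\<Sum>j\<in>e. \<Sum>k\<in>e. g j k)" by (simp add: sum_negf)
  finally show ?thesis by simp
qed

lemma sum_differences_square:
  fixes y :: "'a \<Rightarrow> real"
  shows "(\<Sum>j\<in>e. \<Sum>k\<in>e. (y k - y j)\<^sup>2) = 2 * real (card e) * (\<Sum>j\<in>e. (y j)\<^sup>2) - 2 * (\<Sum>j\<in>e. y j)\<^sup>2"
proof -
  have "(\<Sum>j\<in>e. \<Sum>k\<in>e. (y k - y j)\<^sup>2) = (\<Sum>j\<in>e. \<Sum>k\<in>e. (y k)\<^sup>2 + (y j)\<^sup>2 - 2 * (y j * y k))"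
    by (intro sum.cong refl) (simp add: power2_eq_square algebra_simps)
  also have "\<dots> = 2 * real (card e) * (\<Sum>j\<in>e. (y j)\<^sup>2) - 2 * (\<Sum>j\<in>e. \<Sum>k\<in>e. y j * y k)"
    by (simp add: sum.distrib sum_subtractf sum_distrib_left[symmetric])
  also have "(\<Sum>j\<in>e. \<Sum>k\<in>e. y j * y k) = (\<Sum>j\<in>e. y j)\<^sup>2"
    by (simp add: power2_eq_square sum_product)
  finally show ?thesis .
qed

text \<open>With \<open>y\<^sub>j\<close> the values of the affine function at the vertices, the mean values on the edges cancel in pairs,
  and the corrections add up to the integral of the derivative of the cube, since the factors
  \<open>(x - j)/2\<close> weighted with the coordinates add up to 0.  What is left is the quadrature of a square:
  both sides are combinations of \<open>\<Sum> y\<^sub>j\<^sup>2\<close> and \<open>(\<Sum> y\<^sub>j)\<^sup>2\<close>.\<close>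

lemma element_balance:
  fixes e :: "(real^'d::finite) set"
  assumes e: "full_simplex e"
  shows "(\<Sum>j\<in>e. element_defect e a b v j + (real CARD('d) + 1) * element_correction e a b v j) = 0"
proof -
  let ?d = "real CARD('d)" and ?V = "simplex_volume e" and ?\<alpha> = "a \<bullet> v"
  define y where "y l = a \<bullet> l + b" for l
  have fin: "finite e" by (rule full_simplex_finite[OF e])
  have card: "real (card e) = ?d + 1" using e by (simp add: full_simplex_def)
  have diff: "a \<bullet> (k - j) = y k - y j" for k j by (simp add: y_def inner_diff_right)
  have yx: "(\<Sum>l\<in>e. bary e x l * y l) = y x" for x unfolding y_def by (rule bary_interpolates[OF e])
  have g0: "(\<Sum>l\<in>e. bary_grad e l \<bullet> v) = 0"
    using bary_grad_sum[OF e] by (simp add: inner_sum_left[symmetric])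
  have g1: "(\<Sum>l\<in>e. y l * (bary_grad e l \<bullet> v)) = ?\<alpha>"
    using bary_grad_moment[OF e, of a v] g0
    by (simp add: y_def distrib_right sum.distrib sum_distrib_left[symmetric])
  define S1 where "S1 = (\<Sum>l\<in>e. y l)"
  define S2 where "S2 = (\<Sum>l\<in>e. (y l)\<^sup>2)"
  have hg: "extrapolated_cube a b j x = (y x)^3 - 3 / 2 * (y x - y j) * (y x)\<^sup>2" for j x
    unfolding extrapolated_cube_def diff by (simp only: y_def)
  have hs: "extrapolated_cube_slope a b j x = 3 / 2 * ((y j)\<^sup>2 - (y x - y j)\<^sup>2)" for j x
    unfolding extrapolated_cube_slope_def diff by (simp only: y_def)
  have "(\<Sum>j\<in>e. element_correction e a b v j) = simplex_integral e (\<lambda>x. \<Sum>j\<in>e.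
       (bary_grad e j \<bullet> v) * extrapolated_cube a b j x + bary e x j * ((extrapolated_cube_slope a b j x *\<^sub>R a) \<bullet> v))"
    unfolding element_correction_def extrapolated_cube_def extrapolated_cube_slope_def
    by (rule simplex_integral_sum[OF e fin, symmetric]) (intro continuous_intros continuous_bary[OF e])
  also have "\<dots> = simplex_integral e (\<lambda>x. 3 * ?\<alpha> * (a \<bullet> x + b)\<^sup>2)"
  proof (rule simplex_integral_cong)
    fix x
    have "(\<Sum>j\<in>e. (bary_grad e j \<bullet> v) * extrapolated_cube a b j x + bary e x j * ((extrapolated_cube_slope a b j x *\<^sub>R a) \<bullet> v)) =
      (\<Sum>j\<in>e. - 1 / 2 * (y x)^3 * (bary_grad e j \<bullet> v) + 3 / 2 * (y x)\<^sup>2 * (y j * (bary_grad e j \<bullet> v))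
         + 3 * ?\<alpha> * y x * (bary e x j * y j) - 3 / 2 * ?\<alpha> * (y x)\<^sup>2 * bary e x j)"
      by (intro sum.cong refl) (simp add: hg hs power2_eq_square power3_eq_cube field_simps)
    also have "\<dots> = - 1 / 2 * (y x)^3 * 0 + 3 / 2 * (y x)\<^sup>2 * ?\<alpha> + 3 * ?\<alpha> * y x * y x - 3 / 2 * ?\<alpha> * (y x)\<^sup>2 * 1"
      unfolding sum_subtractf sum.distrib sum_distrib_left[symmetric] g0 g1 yx bary_sum[OF e] ..
    finally show "(\<Sum>j\<in>e. (bary_grad e j \<bullet> v) * extrapolated_cube a b j x + bary e x j * ((extrapolated_cube_slope a b j x *\<^sub>R a) \<bullet> v)) =
      3 * ?\<alpha> * (a \<bullet> x + b)\<^sup>2"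
      by (simp add: y_def power2_eq_square)
  qed
  also have "\<dots> = 3 * ?\<alpha> * (?V / ((?d + 1) * (?d + 2)) * (S2 + S1\<^sup>2))"
    unfolding simplex_integral_cmult simplex_integral_affine_square[OF e] S1_def S2_def y_def ..
  finally have corr: "(\<Sum>j\<in>e. element_correction e a b v j) = 3 * ?\<alpha> * (?V / ((?d + 1) * (?d + 2)) * (S2 + S1\<^sup>2))" .
  have anti: "(\<Sum>j\<in>e. \<Sum>k\<in>e. edge_mean (y j) (y k) * (edge_normal e j k \<bullet> v)) = 0"
  proof (rule sum_antisymmetric)
    fix j k
    have "edge_normal e k j = - edge_normal e j k" by (simp add: edge_normal_def)
    then show "edge_mean (y k) (y j) * (edge_normal e k j \<bullet> v) = - (edge_mean (y j) (y k) * (edge_normal e j k \<bullet> v))"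
      by (simp add: edge_mean_commute)
  qed
  have collect: "(\<Sum>j\<in>e. V * ((\<Sum>k\<in>e. P j k + q * Q j k * A) - 3 * r j * A)) =
      V * ((\<Sum>j\<in>e. \<Sum>k\<in>e. P j k) + q * A * (\<Sum>j\<in>e. \<Sum>k\<in>e. Q j k) - 3 * A * (\<Sum>j\<in>e. r j))"
    for V q A :: real and P Q :: "real^'d \<Rightarrow> real^'d \<Rightarrow> real" and r
    by (simp add: sum_subtractf sum.distrib sum_distrib_left sum_distrib_right right_diff_distrib distrib_left mult_ac)
  have "(\<Sum>j\<in>e. element_defect e a b v j) =
      ?V * ((\<Sum>j\<in>e. \<Sum>k\<in>e. edge_mean (y j) (y k) * (edge_normal e j k \<bullet> v))
        + 3 / (2 * (?d + 2)) * ?\<alpha> * (\<Sum>j\<in>e. \<Sum>k\<in>e. (y k - y j)\<^sup>2) - 3 * ?\<alpha> * S2)"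
    unfolding element_defect_def diff y_def[symmetric] S2_def
    by (rule collect)
  also have "\<dots> = ?V * (3 / (2 * (?d + 2)) * ?\<alpha> * (2 * (?d + 1) * S2 - 2 * S1\<^sup>2) - 3 * ?\<alpha> * S2)"
    unfolding anti sum_differences_square card S1_def S2_def by simp
  finally have def: "(\<Sum>j\<in>e. element_defect e a b v j) =
    ?V * (3 / (2 * (?d + 2)) * ?\<alpha> * (2 * (?d + 1) * S2 - 2 * S1\<^sup>2) - 3 * ?\<alpha> * S2)" .
  have pos: "?d + 1 \<noteq> 0" "?d + 2 \<noteq> 0" by (simp_all add: add_nonneg_eq_0_iff)
  have arith: "V * (3 / (2 * (D + 2)) * A * (2 * (D + 1) * S2 - 2 * S1\<^sup>2) - 3 * A * S2)
     + (D + 1) * (3 * A * (V / ((D + 1) * (D + 2)) * (S2 + S1\<^sup>2))) = 0"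
    if "D + 1 \<noteq> 0" "D + 2 \<noteq> 0" for V A D S1 S2 :: real
    using that by (simp add: divide_simps) (simp add: algebra_simps)
  show ?thesis
    unfolding sum.distrib sum_distrib_left[symmetric] corr def by (rule arith[OF pos])
qed

text \<open>The constant term of the affine function may be changed so that the function vanishes at \<open>j\<close>.  The
  Taylor terms of the cube that disappear have degree at most 2.  On them the defect is opposite to
  the correction; this is computed from the integrals of constants, of affine functions and of one
  coordinate.\<close>

lemma element_local:
  fixes e :: "(real^'d::finite) set"
  assumes e: "full_simplex e" and j: "j \<in> e"
  shows "element_defect e a b v j + (real CARD('d) + 1) * element_correction e a b v j =
    element_defect e a (- (a \<bullet> j)) v j + (real CARD('d) + 1) * element_correction e a (- (a \<bullet> j)) v j"
proof -
  let ?d = "real CARD('d)" and ?V = "simplex_volume e" and ?\<alpha> = "a \<bullet> v" and ?g = "\<lambda>l. bary_grad e l \<bullet> v"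
  define Y where "Y = a \<bullet> j + b"
  define \<delta> where "\<delta> x = a \<bullet> (x - j)" for x
  have fin: "finite e" by (rule full_simplex_finite[OF e])
  have card: "real (card e) = ?d + 1" using e by (simp add: full_simplex_def)
  have val: "a \<bullet> x + b = Y + \<delta> x" "a \<bullet> x + - (a \<bullet> j) = \<delta> x" for x by (auto simp: Y_def \<delta>_def inner_diff_right)
  have \<delta>j: "\<delta> j = 0" by (simp add: \<delta>_def)
  have g0: "(\<Sum>l\<in>e. ?g l) = 0" using bary_grad_sum[OF e] by (simp add: inner_sum_left[symmetric])
  have g1: "(\<Sum>l\<in>e. \<delta> l * ?g l) = ?\<alpha>"
    using bary_grad_moment[OF e, of a v] g0
    by (simp add: \<delta>_def inner_diff_right left_diff_distrib sum_subtractf sum_distrib_left[symmetric])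
  define S where "S = (\<Sum>l\<in>e. \<delta> l)"
  have "element_defect e a b v j - element_defect e a (- (a \<bullet> j)) v j =
      ?V * ((\<Sum>k\<in>e. (Y^3 + 3 / 2 * Y\<^sup>2 * \<delta> k) * (edge_normal e j k \<bullet> v)) - 3 * Y\<^sup>2 * ?\<alpha>)"
  proof -
    have em: "edge_mean (a \<bullet> j + b) (a \<bullet> k + b) - edge_mean (a \<bullet> j + - (a \<bullet> j)) (a \<bullet> k + - (a \<bullet> j)) =
        Y^3 + 3 / 2 * Y\<^sup>2 * \<delta> k" for k
      unfolding edge_mean_expand val \<delta>j by simp
    have "V * ((\<Sum>k\<in>e. f k * n k + r k) - c) - V * ((\<Sum>k\<in>e. g k * n k + r k) - c') =
        V * ((\<Sum>k\<in>e. (f k - g k) * n k) - (c - c'))"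
      for V c c' :: real and f g n r :: "real^'d \<Rightarrow> real"
      by (simp add: sum.distrib sum_subtractf left_diff_distrib right_diff_distrib distrib_left)
    note this[of ?V "\<lambda>k. edge_mean (a \<bullet> j + b) (a \<bullet> k + b)" "\<lambda>k. edge_normal e j k \<bullet> v"
        "\<lambda>k. 3 / (2 * (?d + 2)) * (a \<bullet> (k - j))\<^sup>2 * ?\<alpha>" "3 * (a \<bullet> j + b)\<^sup>2 * ?\<alpha>"
        "\<lambda>k. edge_mean (a \<bullet> j + - (a \<bullet> j)) (a \<bullet> k + - (a \<bullet> j))" "3 * (a \<bullet> j + - (a \<bullet> j))\<^sup>2 * ?\<alpha>"]
    then show ?thesis unfolding em unfolding element_defect_def by (simp add: Y_def)
  qed
  also have "(\<Sum>k\<in>e. (Y^3 + 3 / 2 * Y\<^sup>2 * \<delta> k) * (edge_normal e j k \<bullet> v)) =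
      (\<Sum>k\<in>e. Y^3 * ?g k - Y^3 * ?g j + 3 / 2 * Y\<^sup>2 * (\<delta> k * ?g k) - 3 / 2 * Y\<^sup>2 * ?g j * \<delta> k)"
    by (intro sum.cong refl) (simp add: edge_normal_def inner_diff_left field_simps)
  also have "\<dots> = - (?d + 1) * Y^3 * ?g j + 3 / 2 * Y\<^sup>2 * ?\<alpha> - 3 / 2 * Y\<^sup>2 * ?g j * S"
    unfolding sum_subtractf sum.distrib sum_distrib_left[symmetric] g0 g1 S_def[symmetric] by (simp add: card algebra_simps)
  finally have D: "element_defect e a b v j - element_defect e a (- (a \<bullet> j)) v j =
     ?V * (- (?d + 1) * Y^3 * ?g j + 3 / 2 * Y\<^sup>2 * ?\<alpha> - 3 / 2 * Y\<^sup>2 * ?g j * S - 3 * Y\<^sup>2 * ?\<alpha>)" .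
  have "element_correction e a b v j = simplex_integral e (\<lambda>x.
      ((bary_grad e j \<bullet> v) * extrapolated_cube a (- (a \<bullet> j)) j x + bary e x j * ((extrapolated_cube_slope a (- (a \<bullet> j)) j x *\<^sub>R a) \<bullet> v))
      + (?g j * Y^3 + (3 / 2 * Y\<^sup>2 * ?g j * (a \<bullet> x + - (a \<bullet> j)) + 3 / 2 * Y\<^sup>2 * ?\<alpha> * bary e x j)))"
    unfolding element_correction_def
    by (rule simplex_integral_cong)
      (simp only: extrapolated_cube_def extrapolated_cube_slope_def val \<delta>_def[symmetric] \<delta>j inner_scaleR_left
        power2_eq_square power3_eq_cube, simp add: field_simps)
  also have "\<dots> = element_correction e a (- (a \<bullet> j)) v j +
     (?g j * Y^3 * ?V + (3 / 2 * Y\<^sup>2 * ?g j * (?V / (?d + 1) * S) + 3 / 2 * Y\<^sup>2 * ?\<alpha> * (?V / (?d + 1))))"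
  proof -
    have c: "continuous_on UNIV (\<lambda>x. ?g j * extrapolated_cube a (- (a \<bullet> j)) j x + bary e x j * ((extrapolated_cube_slope a (- (a \<bullet> j)) j x *\<^sub>R a) \<bullet> v))"
      "continuous_on UNIV (\<lambda>x. ?g j * Y^3 + (3 / 2 * Y\<^sup>2 * ?g j * (a \<bullet> x + - (a \<bullet> j)) + 3 / 2 * Y\<^sup>2 * ?\<alpha> * bary e x j))"
      "continuous_on UNIV (\<lambda>x. 3 / 2 * Y\<^sup>2 * ?g j * (a \<bullet> x + - (a \<bullet> j)) + 3 / 2 * Y\<^sup>2 * ?\<alpha> * bary e x j)"
      "continuous_on UNIV (\<lambda>x. 3 / 2 * Y\<^sup>2 * ?g j * (a \<bullet> x + - (a \<bullet> j)))"
      "continuous_on UNIV (\<lambda>x. 3 / 2 * Y\<^sup>2 * ?\<alpha> * bary e x j)"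
      unfolding extrapolated_cube_def extrapolated_cube_slope_def by (intro continuous_intros continuous_bary[OF e])+
    have aff: "(\<Sum>l\<in>e. a \<bullet> l + - (a \<bullet> j)) = S" unfolding S_def by (simp add: \<delta>_def inner_diff_right)
    show ?thesis
      unfolding simplex_integral_add[OF e c(1,2)] simplex_integral_add[OF e continuous_on_const c(3)]
        simplex_integral_add[OF e c(4,5)] simplex_integral_cmult simplex_integral_const[OF e]
        simplex_integral_affine[OF e] simplex_integral_bary[OF e j] aff element_correction_def by (simp only: mult.assoc)
  qed
  finally have C: "element_correction e a b v j - element_correction e a (- (a \<bullet> j)) v j =
     ?g j * Y^3 * ?V + (3 / 2 * Y\<^sup>2 * ?g j * (?V / (?d + 1) * S) + 3 / 2 * Y\<^sup>2 * ?\<alpha> * (?V / (?d + 1)))" by simp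
  have pos: "?d + 1 \<noteq> 0" by (simp add: add_nonneg_eq_0_iff)
  have arith: "p - p' = V * (- D * Y3 * g + 3 / 2 * Y2 * A - 3 / 2 * Y2 * g * S - 3 * Y2 * A) \<Longrightarrow>
     q - q' = g * Y3 * V + (3 / 2 * Y2 * g * (V / D * S) + 3 / 2 * Y2 * A * (V / D)) \<Longrightarrow> p + D * q = p' + D * q'"
    if "D \<noteq> 0" for p p' V D Y3 Y2 g A S q q' :: real
  proof -
    assume 1: "p - p' = V * (- D * Y3 * g + 3 / 2 * Y2 * A - 3 / 2 * Y2 * g * S - 3 * Y2 * A)"
      and 2: "q - q' = g * Y3 * V + (3 / 2 * Y2 * g * (V / D * S) + 3 / 2 * Y2 * A * (V / D))"
    have "(p - p') + D * (q - q') = 0" unfolding 1 2 using that by (simp add: field_simps)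
    then show ?thesis by (simp add: algebra_simps)
  qed
  show ?thesis by (rule arith[OF pos D C])
qed

text \<open>Normalized to vanish at the vertex, the affine function moves along with the simplex.\<close>

lemma element_translate:
  fixes e :: "(real^'d::finite) set"
  assumes e: "full_simplex e" and j: "j \<in> e"
  shows "element_defect ((+) z ` e) a b v (z + j) + (real CARD('d) + 1) * element_correction ((+) z ` e) a b v (z + j) =
    element_defect e a b v j + (real CARD('d) + 1) * element_correction e a b v j"
proof -
  have e': "full_simplex ((+) z ` e)" by (rule full_simplex_translate[OF e])
  have "element_defect ((+) z ` e) a (- (a \<bullet> (z + j))) v (z + j) = element_defect e a (- (a \<bullet> j)) v j"
    unfolding element_defect_def
    by (simp add: sum.reindex simplex_volume_translate[OF e] edge_normal_def bary_grad_translate[OF e] inner_add_right)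
  moreover have "element_correction ((+) z ` e) a (- (a \<bullet> (z + j))) v (z + j) = element_correction e a (- (a \<bullet> j)) v j"
    unfolding element_correction_def
  proof (subst simplex_integral_translate[OF _ e])
    show "continuous_on UNIV (\<lambda>x. (bary_grad ((+) z ` e) (z + j) \<bullet> v) * extrapolated_cube a (- (a \<bullet> (z + j))) (z + j) x
       + bary ((+) z ` e) x (z + j) * ((extrapolated_cube_slope a (- (a \<bullet> (z + j))) (z + j) x *\<^sub>R a) \<bullet> v))"
      unfolding extrapolated_cube_def extrapolated_cube_slope_def by (intro continuous_intros continuous_bary[OF e'])
  qed (simp add: bary_grad_translate[OF e] bary_translate[OF e] extrapolated_cube_def extrapolated_cube_slope_def inner_add_right)
  ultimately show ?thesis
    using element_local[OF e j, of a b v] element_local[OF e', of "z + j" a b v] j by simp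
qed

text \<open>Both sides run over the simplexes at \<open>j\<close> together with one of their vertices.\<close>

lemma star_sum_swap:
  fixes g :: "(real^'d::finite) set \<Rightarrow> real^'d \<Rightarrow> real"
  assumes T: "conforming_simplicial_mesh T" and j: "j \<in> nodes T"
  shows "(\<Sum>k\<in>\<Union>{e\<in>T. j \<in> e}. \<Sum>e\<in>{e\<in>T. j \<in> e \<and> k \<in> e}. g e k) = (\<Sum>e\<in>{e\<in>T. j \<in> e}. \<Sum>k\<in>e. g e k)"
proof -
  let ?S = "{e\<in>T. j \<in> e}"
  have finS: "finite ?S" using T j by (simp add: conforming_simplicial_mesh_def)
  have finU: "finite (\<Union>?S)" using finS full_simplex_finite mesh_full_simplex[OF T] by blast
  have "(\<Sum>k\<in>\<Union>?S. \<Sum>e\<in>{e\<in>?S. k \<in> e}. g e k) = (\<Sum>e\<in>?S. \<Sum>k\<in>{k\<in>\<Union>?S. k \<in> e}. g e k)"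
    by (rule sum.swap_restrict[OF finU finS])
  moreover have "{e\<in>?S. k \<in> e} = {e\<in>T. j \<in> e \<and> k \<in> e}" for k by blast
  moreover have "{k\<in>\<Union>?S. k \<in> e} = e" if "e \<in> ?S" for e using that by blast
  ultimately show ?thesis by simp
qed

text \<open>Corrected defects may be used, since the corrections cancel around each node.  They are periodic, so
  with the same amount of the defect of \<open>e\<close> at \<open>j\<close> sent to each vertex \<open>k\<close> of \<open>e\<close> mass transport applies;
  each node receives complete sums over the vertices of simplexes.\<close>

lemma element_defects_cancel:
  fixes T :: "(real^'d::finite) set set"
  assumes T: "periodic_simplicial_mesh T" and R: "node_representatives T R"
  shows "(\<Sum>j\<in>R. \<Sum>e\<in>{e\<in>T. j \<in> e}. element_defect e a b v j) = 0"
proof -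
  note TC = periodic_conforming[OF T]
  let ?D = "real CARD('d) + 1"
  define E where "E e j = element_defect e a b v j + ?D * element_correction e a b v j" for e j
  define y where "y j k = (\<Sum>e\<in>{e\<in>T. j \<in> e \<and> k \<in> e}. E e j)" for j k
  let ?N = "\<lambda>j. \<Union>{e\<in>T. j \<in> e}"
  have RN: "j \<in> nodes T" if "j \<in> R" for j using R that by (auto simp: node_representatives_def)
  have finS: "finite {e\<in>T. j \<in> e}" if "j \<in> nodes T" for j using TC that by (simp add: conforming_simplicial_mesh_def)
  have defect: "(\<Sum>e\<in>{e\<in>T. j \<in> e}. element_defect e a b v j) = (\<Sum>e\<in>{e\<in>T. j \<in> e}. E e j)" if "j \<in> nodes T" for j
    unfolding E_def sum.distrib sum_distrib_left[symmetric] correction_sum[OF T that] by simp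
  have outflow: "(\<Sum>k\<in>?N j. y j k) = ?D * (\<Sum>e\<in>{e\<in>T. j \<in> e}. E e j)" if j: "j \<in> nodes T" for j
  proof -
    have "(\<Sum>k\<in>?N j. y j k) = (\<Sum>e\<in>{e\<in>T. j \<in> e}. \<Sum>k\<in>e. E e j)"
      unfolding y_def by (rule star_sum_swap[OF TC j])
    also have "\<dots> = (\<Sum>e\<in>{e\<in>T. j \<in> e}. ?D * E e j)"
      by (intro sum.cong refl) (use mesh_full_simplex[OF TC] in \<open>simp add: full_simplex_def\<close>)
    finally show ?thesis by (simp add: sum_distrib_left)
  qed
  have inflow: "(\<Sum>k\<in>?N j. y k j) = 0" if j: "j \<in> nodes T" for j
  proof -
    have "(\<Sum>k\<in>?N j. y k j) = (\<Sum>k\<in>?N j. \<Sum>e\<in>{e\<in>T. j \<in> e \<and> k \<in> e}. E e k)"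
      unfolding y_def by (simp add: conj_commute)
    also have "\<dots> = (\<Sum>e\<in>{e\<in>T. j \<in> e}. \<Sum>k\<in>e. E e k)" by (rule star_sum_swap[OF TC j])
    also have "\<dots> = 0"
      unfolding E_def by (intro sum.neutral ballI element_balance mesh_full_simplex[OF TC]) simp
    finally show ?thesis .
  qed
  have "(\<Sum>j\<in>R. \<Sum>k\<in>?N j. y j k) = (\<Sum>j\<in>R. \<Sum>k\<in>?N j. y k j)"
  proof (rule mass_transport[OF T R])
    fix j assume j: "j \<in> nodes T"
    show "finite (?N j)" using finS[OF j] full_simplex_finite mesh_full_simplex[OF TC] by blast
    show "?N j \<subseteq> nodes T" by (auto simp: nodes_def)
    show "j \<in> ?N k" if "k \<in> ?N j" for k using that by blast
    fix k and z :: "real^'d" assume z: "integer_vector z" and k: "k \<in> ?N j"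
    show "z + k \<in> ?N (z + j)" using k periodic_translate[OF T z] by blast
    show "y (z + j) (z + k) = y j k"
      unfolding y_def
    proof (rule sum.reindex_bij_witness[where i = "\<lambda>e. (+) z ` e" and j = "\<lambda>e. (+) (- z) ` e"])
      fix e assume e: "e \<in> {e\<in>T. z + j \<in> e \<and> z + k \<in> e}"
      show "(+) z ` (+) (- z) ` e = e" by (simp add: image_image)
      have "j \<in> (+) (- z) ` e" "k \<in> (+) (- z) ` e" using e by force+
      then show m: "(+) (- z) ` e \<in> {e\<in>T. j \<in> e \<and> k \<in> e}"
        using e periodic_translate[OF T integer_vector_uminus[OF z]] by blast
      have "(+) z ` (+) (- z) ` e = e" by (simp add: image_image)
      then show "E ((+) (- z) ` e) j = E e (z + j)"
        using element_translate[of "(+) (- z) ` e" j z a b v] m mesh_full_simplex[OF TC] unfolding E_def by auto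
    next
      fix e assume e: "e \<in> {e\<in>T. j \<in> e \<and> k \<in> e}"
      show "(+) (- z) ` (+) z ` e = e" by (simp add: image_image)
      show "(+) z ` e \<in> {e\<in>T. z + j \<in> e \<and> z + k \<in> e}" using e periodic_translate[OF T z] by blast
    qed
  qed
  then have "?D * (\<Sum>j\<in>R. \<Sum>e\<in>{e\<in>T. j \<in> e}. E e j) = 0"
    using outflow inflow RN by (simp add: sum_distrib_left)
  then have "(\<Sum>j\<in>R. \<Sum>e\<in>{e\<in>T. j \<in> e}. E e j) = 0" by (simp add: add_nonneg_eq_0_iff)
  then show ?thesis using defect RN by simp
qed

section \<open>Cubic polynomials as sums of cubes\<close>

lemma polynomials_upto_sum_of_monomials:
  "p \<in> polynomials_upto q \<longleftrightarrow>
    (\<exists>c. p = (\<lambda>x. \<Sum>\<alpha> | (\<Sum>i\<in>UNIV. \<alpha> i) \<le> q. c \<alpha> * (\<Prod>i\<in>UNIV. (x $ i) ^ \<alpha> i)))"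
  by (auto simp: polynomials_upto_def fun_eq_iff)

lemma polynomials_upto_add:
  assumes "p \<in> polynomials_upto n" "q \<in> polynomials_upto n"
  shows "(\<lambda>x. p x + q x) \<in> polynomials_upto n"
proof -
  obtain c c' where c: "p = (\<lambda>x. \<Sum>\<alpha> | (\<Sum>i\<in>UNIV. \<alpha> i) \<le> n. c \<alpha> * (\<Prod>i\<in>UNIV. (x $ i) ^ \<alpha> i))"
    "q = (\<lambda>x. \<Sum>\<alpha> | (\<Sum>i\<in>UNIV. \<alpha> i) \<le> n. c' \<alpha> * (\<Prod>i\<in>UNIV. (x $ i) ^ \<alpha> i))"
    using assms unfolding polynomials_upto_sum_of_monomials by blast
  show ?thesis
    unfolding polynomials_upto_sum_of_monomials c
    by (rule exI[of _ "\<lambda>\<alpha>. c \<alpha> + c' \<alpha>"]) (simp add: distrib_right sum.distrib)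
qed

lemma polynomials_upto_cmult:
  assumes "p \<in> polynomials_upto n"
  shows "(\<lambda>x. r * p x) \<in> polynomials_upto n"
proof -
  obtain c where c: "p = (\<lambda>x. \<Sum>\<alpha> | (\<Sum>i\<in>UNIV. \<alpha> i) \<le> n. c \<alpha> * (\<Prod>i\<in>UNIV. (x $ i) ^ \<alpha> i))"
    using assms unfolding polynomials_upto_sum_of_monomials by blast
  show ?thesis
    unfolding polynomials_upto_sum_of_monomials c
    by (rule exI[of _ "\<lambda>\<alpha>. r * c \<alpha>"]) (simp add: sum_distrib_left mult.assoc)
qed

lemma polynomials_upto_sum:
  assumes "finite I" "\<And>i. i \<in> I \<Longrightarrow> p i \<in> polynomials_upto n"
  shows "(\<lambda>x. \<Sum>i\<in>I. p i x) \<in> polynomials_upto n"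
  using assms
proof (induction I rule: finite_induct)
  case empty
  show ?case unfolding polynomials_upto_sum_of_monomials by (rule exI[of _ "\<lambda>_. 0"]) simp
next
  case (insert i I)
  then show ?case using polynomials_upto_add[of "p i" n "\<lambda>x. \<Sum>i\<in>I. p i x"] by simp
qed

lemma polynomials_upto_monomial:
  fixes \<alpha> :: "'d::finite \<Rightarrow> nat"
  assumes "(\<Sum>i\<in>UNIV. \<alpha> i) \<le> n"
  shows "(\<lambda>x. \<Prod>i\<in>UNIV. (x $ i) ^ \<alpha> i) \<in> polynomials_upto n"
  unfolding polynomials_upto_sum_of_monomials
proof (rule exI[of _ "\<lambda>\<beta>. if \<beta> = \<alpha> then 1 else 0"], rule ext)
  fix x :: "real^'d"
  have "(\<Sum>\<beta> | (\<Sum>i\<in>UNIV. \<beta> i) \<le> n. (if \<beta> = \<alpha> then 1 else 0) * (\<Prod>i\<in>UNIV. (x $ i) ^ \<beta> i)) =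
      (\<Sum>\<beta> | (\<Sum>i\<in>UNIV. \<beta> i) \<le> n. if \<beta> = \<alpha> then (\<Prod>i\<in>UNIV. (x $ i) ^ \<alpha> i) else 0)"
    by (rule sum.cong) auto
  also have "\<dots> = (if \<alpha> \<in> {\<beta>. (\<Sum>i\<in>UNIV. \<beta> i) \<le> n} then (\<Prod>i\<in>UNIV. (x $ i) ^ \<alpha> i) else 0)"
    by (rule sum.delta[OF finite_multi_indices])
  finally show "(\<Prod>i\<in>UNIV. (x $ i) ^ \<alpha> i) =
      (\<Sum>\<beta> | (\<Sum>i\<in>UNIV. \<beta> i) \<le> n. (if \<beta> = \<alpha> then 1 else 0) * (\<Prod>i\<in>UNIV. (x $ i) ^ \<beta> i))"
    using assms by simp
qed

lemma polynomials_upto_mult: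
  assumes "p \<in> polynomials_upto m" "q \<in> polynomials_upto n"
  shows "(\<lambda>x. p x * q x) \<in> polynomials_upto (m + n)"
proof -
  obtain c c' where c: "p = (\<lambda>x. \<Sum>\<alpha> | (\<Sum>i\<in>UNIV. \<alpha> i) \<le> m. c \<alpha> * (\<Prod>i\<in>UNIV. (x $ i) ^ \<alpha> i))"
    "q = (\<lambda>x. \<Sum>\<alpha> | (\<Sum>i\<in>UNIV. \<alpha> i) \<le> n. c' \<alpha> * (\<Prod>i\<in>UNIV. (x $ i) ^ \<alpha> i))"
    using assms unfolding polynomials_upto_sum_of_monomials by blast
  have "(\<lambda>x. p x * q x) = (\<lambda>x. \<Sum>\<alpha> | (\<Sum>i\<in>UNIV. \<alpha> i) \<le> m. \<Sum>\<beta> | (\<Sum>i\<in>UNIV. \<beta> i) \<le> n.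
      (c \<alpha> * c' \<beta>) * (\<Prod>i\<in>UNIV. (x $ i) ^ (\<alpha> i + \<beta> i)))"
    unfolding c sum_product by (intro ext sum.cong refl) (simp add: power_add prod.distrib mult_ac)
  also have "\<dots> \<in> polynomials_upto (m + n)"
    by (intro polynomials_upto_sum finite_multi_indices polynomials_upto_cmult polynomials_upto_monomial)
      (auto simp: sum.distrib intro: add_mono)
  finally show ?thesis .
qed

lemma polynomials_upto_const: "(\<lambda>x. r) \<in> polynomials_upto n"
  using polynomials_upto_cmult[OF polynomials_upto_monomial[of "\<lambda>_. 0" n], of r] by simp

lemma polynomials_upto_affine: "(\<lambda>x. a \<bullet> x + b) \<in> polynomials_upto 1"
proof -
  have "(\<lambda>x::real^'a. x $ i) \<in> polynomials_upto 1" for i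
  proof -
    have "(\<Prod>k\<in>UNIV. (x $ k) ^ (if k = i then 1 else 0)) = x $ i" for x :: "real^'a"
      by (simp add: if_distrib[of "\<lambda>n. _ ^ n"] cong: if_cong)
    then show ?thesis using polynomials_upto_monomial[of "\<lambda>k. if k = i then 1 else 0" 1] by simp
  qed
  then have "(\<lambda>x. (\<Sum>i\<in>UNIV. a $ i * x $ i) + b) \<in> polynomials_upto 1"
    by (intro polynomials_upto_add polynomials_upto_sum polynomials_upto_cmult polynomials_upto_const) auto
  then show ?thesis by (simp add: inner_vec_def)
qed

lemma polynomials_upto_affine_square: "(\<lambda>x. (a \<bullet> x + b)\<^sup>2) \<in> polynomials_upto 2"
  using polynomials_upto_mult[OF polynomials_upto_affine[of a b] polynomials_upto_affine[of a b]]
  by (simp add: power2_eq_square numeral_2_eq_2)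

text \<open>Split off one coordinate at a time; missing factors are the constant 1.\<close>

lemma monomial_product_of_affine:
  fixes \<alpha> :: "'d::finite \<Rightarrow> nat"
  assumes "(\<Sum>i\<in>UNIV. \<alpha> i) \<le> n"
  shows "\<exists>a b. \<forall>x. (\<Prod>i\<in>UNIV. (x $ i) ^ \<alpha> i) = (\<Prod>m<n. a m \<bullet> x + (b m :: real))"
  using assms
proof (induction n arbitrary: \<alpha>)
  case 0
  then show ?case by simp
next
  case (Suc n)
  show ?case
  proof (cases "\<forall>i. \<alpha> i = 0")
    case True
    then show ?thesis by (intro exI[of _ "\<lambda>_. 0"] exI[of _ "\<lambda>_. 1"]) simp
  next
    case False
    then obtain i where i: "\<alpha> i > 0" by auto
    define \<beta> where "\<beta> k = (if k = i then \<alpha> i - 1 else \<alpha> k)" for k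
    have split: "(\<Sum>k\<in>UNIV. \<alpha> k) = (\<Sum>k\<in>UNIV. \<beta> k) + 1"
    proof -
      have "(\<Sum>k\<in>UNIV. \<alpha> k) = (\<Sum>k\<in>UNIV. \<beta> k + (if k = i then 1 else 0))"
        by (rule sum.cong) (use i in \<open>auto simp: \<beta>_def\<close>)
      then show ?thesis by (simp add: sum.distrib)
    qed
    then obtain a b where ab: "\<forall>x. (\<Prod>k\<in>UNIV. (x $ k) ^ \<beta> k) = (\<Prod>m<n. a m \<bullet> x + (b m :: real))"
      using Suc.IH[of \<beta>] Suc.prems by auto
    have "(\<Prod>k\<in>UNIV. (x $ k) ^ \<alpha> k) = (\<Prod>m<Suc n. (a(n := axis i 1)) m \<bullet> x + (b(n := 0)) m)" for x :: "real^'d"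
    proof -
      have "(\<Prod>k\<in>UNIV. (x $ k) ^ \<alpha> k) = (\<Prod>k\<in>UNIV. (x $ k) ^ \<beta> k * (if k = i then x $ i else 1))"
        by (rule prod.cong) (use i in \<open>auto simp: \<beta>_def power_eq_if mult.commute\<close>)
      also have "\<dots> = (\<Prod>m<n. a m \<bullet> x + b m) * (axis i 1 \<bullet> x + 0)"
        by (simp add: prod.distrib ab inner_axis')
      also have "(\<Prod>m<n. a m \<bullet> x + b m) = (\<Prod>m<n. (a(n := axis i 1)) m \<bullet> x + (b(n := 0)) m)"
        by (rule prod.cong) auto
      finally show ?thesis by simp
    qed
    then show ?thesis by blast
  qed
qed

definition sum_of_cubes :: "((real^'d::finite) \<times> real) list \<Rightarrow> real^'d \<Rightarrow> real" where
  "sum_of_cubes L x = (\<Sum>(a, b)\<leftarrow>L. (a \<bullet> x + b)^3)"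

lemma sum_of_cubes_append: "sum_of_cubes (L @ L') x = sum_of_cubes L x + sum_of_cubes L' x"
  by (simp add: sum_of_cubes_def)

text \<open>Real numbers have real cube roots.\<close>

lemma sum_of_cubes_scale: "\<exists>L'. \<forall>x. r * sum_of_cubes L x = sum_of_cubes L' x"
proof -
  have r: "root 3 r ^ 3 = r" by (rule odd_real_root_pow) simp
  have "r * sum_of_cubes L x = sum_of_cubes (map (\<lambda>(a, b). (root 3 r *\<^sub>R a, root 3 r * b)) L) x" for x
  proof (induction L)
    case (Cons p L)
    obtain a b where p: "p = (a, b)" by fastforce
    have "(root 3 r * (a \<bullet> x) + root 3 r * b)^3 = r * (a \<bullet> x + b)^3"
      using r by (simp add: distrib_left[symmetric] power_mult_distrib)
    then show ?case using Cons by (simp add: sum_of_cubes_def p distrib_left)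
  qed (simp add: sum_of_cubes_def)
  then show ?thesis by blast
qed

text \<open>The polarization identity
  \<open>24 u v w = (u + v + w)\<^sup>3 + (w - u - v)\<^sup>3 + (v - u - w)\<^sup>3 + (u - v - w)\<^sup>3\<close>.\<close>

lemma affine_product_sum_of_cubes:
  "\<exists>L. \<forall>x. (a1 \<bullet> x + b1) * (a2 \<bullet> x + b2) * (a3 \<bullet> x + b3) = sum_of_cubes L x"
proof -
  let ?L = "[(a1 + a2 + a3, b1 + b2 + b3), (a3 - a1 - a2, b3 - b1 - b2), (a2 - a1 - a3, b2 - b1 - b3), (a1 - a2 - a3, b1 - b2 - b3)]"
  have pol: "u * v * w = 1 / 24 * ((u + v + w)^3 + ((w - u - v)^3 + ((v - u - w)^3 + (u - v - w)^3)))" for u v w :: real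
    by (simp add: power3_eq_cube algebra_simps)
  have "(a1 \<bullet> x + b1) * (a2 \<bullet> x + b2) * (a3 \<bullet> x + b3) = 1 / 24 * sum_of_cubes ?L x" for x
    unfolding pol[of "a1 \<bullet> x + b1"] by (simp add: sum_of_cubes_def inner_add_left inner_diff_left algebra_simps)
  then show ?thesis using sum_of_cubes_scale[of "1 / 24" ?L] by metis
qed

lemma cubic_sum_of_cubes:
  assumes "p \<in> polynomials_upto 3"
  shows "\<exists>L. \<forall>x. p x = sum_of_cubes L x"
proof -
  obtain c where c: "p = (\<lambda>x. \<Sum>\<alpha> | (\<Sum>i\<in>UNIV. \<alpha> i) \<le> 3. c \<alpha> * (\<Prod>i\<in>UNIV. (x $ i) ^ \<alpha> i))"
    using assms unfolding polynomials_upto_sum_of_monomials by blast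
  have "\<exists>L. \<forall>x. (\<Sum>\<alpha>\<in>I. c \<alpha> * (\<Prod>i\<in>UNIV. (x $ i) ^ \<alpha> i)) = sum_of_cubes L x"
    if "finite I" "I \<subseteq> {\<alpha>. (\<Sum>i\<in>UNIV. \<alpha> i) \<le> 3}" for I
    using that
  proof (induction I rule: finite_induct)
    case empty
    show ?case by (rule exI[of _ "[]"]) (simp add: sum_of_cubes_def)
  next
    case (insert \<alpha> I)
    then obtain L where L: "\<forall>x. (\<Sum>\<alpha>\<in>I. c \<alpha> * (\<Prod>i\<in>UNIV. (x $ i) ^ \<alpha> i)) = sum_of_cubes L x" by auto
    have "(\<Sum>i\<in>UNIV. \<alpha> i) \<le> 3" using insert.prems by simp
    then obtain a b where ab: "\<forall>x. (\<Prod>i\<in>UNIV. (x $ i) ^ \<alpha> i) = (\<Prod>m<(3::nat). a m \<bullet> x + (b m :: real))"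
      using monomial_product_of_affine by blast
    obtain L1 where L1: "\<forall>x. (a 0 \<bullet> x + b 0) * (a 1 \<bullet> x + b 1) * (a 2 \<bullet> x + b 2) = sum_of_cubes L1 x"
      using affine_product_sum_of_cubes by blast
    have "(\<Prod>i\<in>UNIV. (x $ i) ^ \<alpha> i) = sum_of_cubes L1 x" for x
      using ab L1 by (simp add: numeral_3_eq_3 numeral_2_eq_2 lessThan_Suc mult_ac)
    moreover obtain L2 where "\<forall>x. c \<alpha> * sum_of_cubes L1 x = sum_of_cubes L2 x" using sum_of_cubes_scale by blast
    ultimately have "\<forall>x. (\<Sum>\<alpha>\<in>insert \<alpha> I. c \<alpha> * (\<Prod>i\<in>UNIV. (x $ i) ^ \<alpha> i)) = sum_of_cubes (L2 @ L) x"
      using insert.hyps L by (simp add: sum_of_cubes_append)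
    then show ?case by blast
  qed
  from this[OF finite_multi_indices[of 3]] show ?thesis unfolding c by simp
qed

lemma cubic_indexed_cubes:
  fixes p :: "real^'d::finite \<Rightarrow> real"
  assumes "p \<in> polynomials_upto 3"
  obtains N :: nat and a :: "nat \<Rightarrow> real^'d" and b where "\<And>x. p x = (\<Sum>m<N. (a m \<bullet> x + b m)^3)"
proof -
  obtain L where L: "\<forall>x. p x = sum_of_cubes L x" using cubic_sum_of_cubes[OF assms] by blast
  have "p x = (\<Sum>m<length L. (fst (L ! m) \<bullet> x + snd (L ! m))^3)" for x
    using L by (simp add: sum_of_cubes_def sum_list_sum_nth atLeast0LessThan case_prod_unfold)
  then show thesis by (rule that)
qed

section \<open>Derivatives of sums of squares\<close>

lemma partial_deriv_eq: "(f has_derivative D) (at x) \<Longrightarrow> partial_deriv i f x = D (axis i 1)"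
  unfolding partial_deriv_def using frechet_derivative_at by metis

lemma directional_deriv_eq:
  fixes f :: "real^'d::finite \<Rightarrow> real"
  assumes "(f has_derivative (\<lambda>h. g \<bullet> h)) (at x)"
  shows "directional_deriv v f x = g \<bullet> v"
  unfolding directional_deriv_def partial_deriv_eq[OF assms] by (simp add: inner_axis) (simp add: inner_vec_def mult.commute)

lemma gradient_eq:
  fixes f :: "real^'d::finite \<Rightarrow> real"
  assumes "(f has_derivative (\<lambda>h. g \<bullet> h)) (at x)"
  shows "gradient f x = g"
  unfolding gradient_def partial_deriv_eq[OF assms] by (simp add: inner_axis vec_eq_iff)

lemma sum_of_squares_derivative:
  fixes a :: "'i \<Rightarrow> real^'d::finite"
  shows "((\<lambda>x. \<Sum>m\<in>I. \<kappa> m * (a m \<bullet> x + b m)\<^sup>2) has_derivative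
     (\<lambda>h. (\<Sum>m\<in>I. (2 * \<kappa> m * (a m \<bullet> x + b m)) *\<^sub>R a m) \<bullet> h)) (at x)"
  by (auto intro!: derivative_eq_intros simp: inner_sum_left sum_distrib_left mult_ac intro!: sum.cong)

lemma second_directional_deriv_squares:
  fixes a :: "'i \<Rightarrow> real^'d::finite"
  shows "(directional_deriv v ^^ 2) (\<lambda>x. \<Sum>m\<in>I. \<kappa> m * (a m \<bullet> x + b m)\<^sup>2) x = (\<Sum>m\<in>I. 2 * \<kappa> m * (a m \<bullet> v)\<^sup>2)"
proof -
  have "directional_deriv v (\<lambda>x. \<Sum>m\<in>I. \<kappa> m * (a m \<bullet> x + b m)\<^sup>2) =
      (\<lambda>x. (\<Sum>m\<in>I. (2 * \<kappa> m * (a m \<bullet> x + b m)) *\<^sub>R a m) \<bullet> v)"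
    by (rule ext) (rule directional_deriv_eq[OF sum_of_squares_derivative])
  also have "\<dots> = (\<lambda>x. \<Sum>m\<in>I. 2 * \<kappa> m * (a m \<bullet> x + b m) * (a m \<bullet> v))"
    by (simp add: inner_sum_left)
  finally have 1: "directional_deriv v (\<lambda>x. \<Sum>m\<in>I. \<kappa> m * (a m \<bullet> x + b m)\<^sup>2) = \<dots>" .
  have "((\<lambda>x. \<Sum>m\<in>I. 2 * \<kappa> m * (a m \<bullet> x + b m) * (a m \<bullet> v)) has_derivative
     (\<lambda>h. (\<Sum>m\<in>I. (2 * \<kappa> m * (a m \<bullet> v)) *\<^sub>R a m) \<bullet> h)) (at x)"
    by (auto intro!: derivative_eq_intros simp: inner_sum_left mult_ac intro!: sum.cong)
  from directional_deriv_eq[OF this, of v]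
  have 2: "directional_deriv v (\<lambda>x. \<Sum>m\<in>I. 2 * \<kappa> m * (a m \<bullet> x + b m) * (a m \<bullet> v)) x = (\<Sum>m\<in>I. 2 * \<kappa> m * (a m \<bullet> v)\<^sup>2)"
    by (simp add: inner_sum_left power2_eq_square mult.assoc)
  have twice: "(directional_deriv v ^^ 2) F x = directional_deriv v (directional_deriv v F) x" for F
    by (simp add: numeral_2_eq_2)
  show ?thesis unfolding twice 1 by (rule 2)
qed

section \<open>From simplices to nodes\<close>

lemma neighbour_node: "k \<in> neighbours T j \<Longrightarrow> j \<in> nodes T \<and> k \<in> nodes T \<and> j \<noteq> k"
  by (auto simp: neighbours_def nodes_def)

lemma neighbours_sym: "k \<in> neighbours T j \<longleftrightarrow> j \<in> neighbours T k"
  by (auto simp: neighbours_def)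

context
  fixes T :: "(real^'d::finite) set set"
  assumes T: "periodic_simplicial_mesh T"
begin

lemma face_normal_eq:
  assumes "k \<in> neighbours T j"
  shows "face_normal T j k = (prism_ratio TYPE('d) / 2) *\<^sub>R (\<Sum>e\<in>{e\<in>T. j \<in> e \<and> k \<in> e}. simplex_volume e *\<^sub>R edge_normal e j k)"
proof -
  have "j \<in> nodes T" "k \<in> nodes T" "j \<noteq> k" using neighbour_node[OF assms] by auto
  from face_normal_formula[OF periodic_conforming[OF T] this] show ?thesis .
qed

lemma neighbours_translate:
  assumes "integer_vector z" "k \<in> neighbours T j"
  shows "z + k \<in> neighbours T (z + j)"
proof -
  obtain e where e: "e \<in> T" "j \<in> e" "k \<in> e" "k \<noteq> j" using assms(2) by (auto simp: neighbours_def)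
  have "(+) z ` e \<in> T" by (rule periodic_translate[OF T assms(1) e(1)])
  moreover have "z + j \<in> (+) z ` e" "z + k \<in> (+) z ` e" "z + k \<noteq> z + j" using e by auto
  ultimately show ?thesis unfolding neighbours_def by (intro CollectI conjI bexI[of _ "(+) z ` e"])
qed

lemma face_normal_swap:
  assumes "k \<in> neighbours T j"
  shows "face_normal T k j = - face_normal T j k"
proof -
  have "edge_normal e k j = - edge_normal e j k" for e by (simp add: edge_normal_def)
  then show ?thesis
    unfolding face_normal_eq[OF assms] face_normal_eq[OF assms[unfolded neighbours_sym[of k T]]]
    by (simp add: conj_commute sum_negf)
qed

lemma face_normal_translate:
  assumes z: "integer_vector z" and k: "k \<in> neighbours T j"
  shows "face_normal T (z + j) (z + k) = face_normal T j k"
proof -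
  have "(\<Sum>e\<in>{e\<in>T. z + j \<in> e \<and> z + k \<in> e}. simplex_volume e *\<^sub>R edge_normal e (z + j) (z + k)) =
      (\<Sum>e\<in>{e\<in>T. j \<in> e \<and> k \<in> e}. simplex_volume e *\<^sub>R edge_normal e j k)"
  proof (rule sum.reindex_bij_witness[where i = "\<lambda>e. (+) z ` e" and j = "\<lambda>e. (+) (- z) ` e"])
    fix e assume e: "e \<in> {e\<in>T. z + j \<in> e \<and> z + k \<in> e}"
    show eq: "(+) z ` (+) (- z) ` e = e" by (simp add: image_image)
    have "j \<in> (+) (- z) ` e" "k \<in> (+) (- z) ` e" using e by force+
    then show m: "(+) (- z) ` e \<in> {e\<in>T. j \<in> e \<and> k \<in> e}"
      using e periodic_translate[OF T integer_vector_uminus[OF z]] by blast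
    then have s: "full_simplex ((+) (- z) ` e)" using mesh_full_simplex[OF periodic_conforming[OF T]] by blast
    show "simplex_volume ((+) (- z) ` e) *\<^sub>R edge_normal ((+) (- z) ` e) j k =
        simplex_volume e *\<^sub>R edge_normal e (z + j) (z + k)"
      using simplex_volume_translate[OF s, of z] bary_grad_translate[OF s, of z j] bary_grad_translate[OF s, of z k]
      unfolding eq edge_normal_def by simp
  next
    fix e assume e: "e \<in> {e\<in>T. j \<in> e \<and> k \<in> e}"
    show "(+) (- z) ` (+) z ` e = e" by (simp add: image_image)
    show "(+) z ` e \<in> {e\<in>T. z + j \<in> e \<and> z + k \<in> e}" using e periodic_translate[OF T z] by blast
  qed
  then show ?thesis unfolding face_normal_eq[OF k] face_normal_eq[OF neighbours_translate[OF z k]] by simp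
qed

lemma neighbours_star: "j \<in> nodes T \<Longrightarrow> \<Union>{e\<in>T. j \<in> e} = insert j (neighbours T j)"
  by (auto simp: neighbours_def nodes_def)

text \<open>Both the face normal and the volume weight are sums over the simplexes at the edge; the derivative
  of \<open>\<lambda>\<^sub>k - \<lambda>\<^sub>j\<close> along the edge is 2, so each simplex contributes a fixed multiple of its volume to the weight.\<close>

lemma node_defect:
  assumes j: "j \<in> nodes T"
  shows "(\<Sum>k\<in>neighbours T j. edge_mean (a \<bullet> j + b) (a \<bullet> k + b) * (face_normal T j k \<bullet> v) -
      volume_weight T j k * ((3 * (a \<bullet> j + b)\<^sup>2 - real CARD('d) / (4 * (real CARD('d) + 2)) * (6 * (a \<bullet> (k - j))\<^sup>2)) * (a \<bullet> v))) =
    prism_ratio TYPE('d) / 2 * (\<Sum>e\<in>{e\<in>T. j \<in> e}. element_defect e a b v j)"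
proof -
  note TC = periodic_conforming[OF T]
  let ?d = "real CARD('d)" and ?\<alpha> = "a \<bullet> v" and ?Y = "a \<bullet> j + b"
  have d: "?d > 0" by simp
  define w where "w k = (3 * ?Y\<^sup>2 - ?d / (4 * (?d + 2)) * (6 * (a \<bullet> (k - j))\<^sup>2)) * ?\<alpha>" for k
  define g where "g e k = (if k = j then 0 else simplex_volume e *
      (edge_mean ?Y (a \<bullet> k + b) * (edge_normal e j k \<bullet> v) - w k / ?d))" for e k
  have fin: "finite (neighbours T j)" by (rule finite_neighbours[OF TC j])
  have edge_term: "edge_mean ?Y (a \<bullet> k + b) * (face_normal T j k \<bullet> v) - volume_weight T j k * w k =
     prism_ratio TYPE('d) / 2 * (\<Sum>e\<in>{e\<in>T. j \<in> e \<and> k \<in> e}. g e k)" if k: "k \<in> neighbours T j" for k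
  proof -
    have ne: "j \<noteq> k" using neighbour_node[OF k] by blast
    have "(k - j) \<bullet> face_normal T j k = prism_ratio TYPE('d) / 2 * (\<Sum>e\<in>{e\<in>T. j \<in> e \<and> k \<in> e}. simplex_volume e * 2)"
    proof -
      have "edge_normal e j k \<bullet> (k - j) = 2" if "e \<in> {e\<in>T. j \<in> e \<and> k \<in> e}" for e
        using edge_normal_edge[OF mesh_full_simplex[OF TC] _ _ ne] that by blast
      then show ?thesis unfolding face_normal_eq[OF k]
        by (simp add: inner_commute[of "k - j"] inner_sum_left)
    qed
    then have vw: "volume_weight T j k = prism_ratio TYPE('d) / 2 * (\<Sum>e\<in>{e\<in>T. j \<in> e \<and> k \<in> e}. simplex_volume e / ?d)"
      unfolding volume_weight_def by (simp add: sum_distrib_left sum_distrib_right sum_divide_distrib)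
    have fv: "face_normal T j k \<bullet> v = prism_ratio TYPE('d) / 2 * (\<Sum>e\<in>{e\<in>T. j \<in> e \<and> k \<in> e}. simplex_volume e * (edge_normal e j k \<bullet> v))"
      unfolding face_normal_eq[OF k] by (simp add: inner_sum_left)
    have "m * (c * (\<Sum>e\<in>E. V e * n e)) - c * (\<Sum>e\<in>E. V e / D) * W = c * (\<Sum>e\<in>E. V e * (m * n e - W / D))"
      for m c W D :: real and V n :: "(real^'d) set \<Rightarrow> real" and E
      by (simp add: sum_distrib_left sum_distrib_right sum_subtractf[symmetric] right_diff_distrib mult_ac)
    then show ?thesis unfolding vw fv g_def using ne by simp
  qed
  have elem: "(\<Sum>k\<in>e. g e k) = element_defect e a b v j" if e: "e \<in> {e\<in>T. j \<in> e}" for e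
  proof -
    have se: "full_simplex e" "j \<in> e" using e mesh_full_simplex[OF TC] by auto
    have fe: "finite e" by (rule full_simplex_finite[OF se(1)])
    have card: "real (card e) = ?d + 1" using se by (simp add: full_simplex_def)
    let ?V = "simplex_volume e"
    define u where "u k = edge_mean ?Y (a \<bullet> k + b) * (edge_normal e j k \<bullet> v) + 3 / (2 * (?d + 2)) * (a \<bullet> (k - j))\<^sup>2 * ?\<alpha>" for k
    have "g e k = ?V * u k - ?V * (3 * ?Y\<^sup>2 * ?\<alpha> / ?d) + (if k = j then ?V * (3 * ?Y\<^sup>2 * ?\<alpha> / ?d) else 0)" for k
    proof (cases "k = j")
      case True
      then show ?thesis by (simp add: g_def u_def edge_normal_def)
    next
      case False
      have wd: "w k / ?d = 3 * ?Y\<^sup>2 * ?\<alpha> / ?d - 3 / (2 * (?d + 2)) * (a \<bullet> (k - j))\<^sup>2 * ?\<alpha>"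
      proof -
        have "(3 * Y2 - D / (4 * (D + 2)) * (6 * q)) * A / D = 3 * Y2 * A / D - 3 / (2 * (D + 2)) * q * A"
          if "D > 0" for Y2 D q A :: real
        proof -
          have "D + 2 \<noteq> 0" "D \<noteq> 0" using that by auto
          then show ?thesis by (simp add: divide_simps) (simp add: algebra_simps)
        qed
        then show ?thesis unfolding w_def using d by blast
      qed
      have "V * (m - (p - q)) = V * (m + q) - V * p + 0" for V m p q :: real by (simp add: algebra_simps)
      then show ?thesis unfolding g_def u_def wd by (simp only: False if_False)
    qed
    then have "(\<Sum>k\<in>e. g e k) = (\<Sum>k\<in>e. ?V * u k) - (?d + 1) * (?V * (3 * ?Y\<^sup>2 * ?\<alpha> / ?d)) + ?V * (3 * ?Y\<^sup>2 * ?\<alpha> / ?d)"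
      using fe se(2) by (simp add: sum.distrib sum_subtractf card)
    also have "\<dots> = ?V * ((\<Sum>k\<in>e. u k) - 3 * ?Y\<^sup>2 * ?\<alpha>)"
      using d by (simp add: sum_distrib_left[symmetric] field_simps)
    finally show ?thesis unfolding element_defect_def u_def .
  qed
  have "(\<Sum>k\<in>neighbours T j. edge_mean ?Y (a \<bullet> k + b) * (face_normal T j k \<bullet> v) - volume_weight T j k * w k) =
      prism_ratio TYPE('d) / 2 * (\<Sum>k\<in>neighbours T j. \<Sum>e\<in>{e\<in>T. j \<in> e \<and> k \<in> e}. g e k)"
    by (simp add: edge_term sum_distrib_left)
  also have "(\<Sum>k\<in>neighbours T j. \<Sum>e\<in>{e\<in>T. j \<in> e \<and> k \<in> e}. g e k) =
      (\<Sum>k\<in>insert j (neighbours T j). \<Sum>e\<in>{e\<in>T. j \<in> e \<and> k \<in> e}. g e k)"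
    using fin by (subst sum.insert) (auto simp: neighbours_def g_def)
  also have "\<dots> = (\<Sum>e\<in>{e\<in>T. j \<in> e}. \<Sum>k\<in>e. g e k)"
    using star_sum_swap[OF TC j, of g] unfolding neighbours_star[OF j] .
  also have "\<dots> = (\<Sum>e\<in>{e\<in>T. j \<in> e}. element_defect e a b v j)" by (intro sum.cong refl elem)
  finally show ?thesis unfolding w_def .
qed

lemma cube_defects_cancel:
  assumes R: "node_representatives T R"
  shows "(\<Sum>j\<in>R. \<Sum>k\<in>neighbours T j. edge_mean (a \<bullet> j + b) (a \<bullet> k + b) * (face_normal T j k \<bullet> v) -
      volume_weight T j k * ((3 * (a \<bullet> j + b)\<^sup>2 - real CARD('d) / (4 * (real CARD('d) + 2)) * (6 * (a \<bullet> (k - j))\<^sup>2)) * (a \<bullet> v))) = 0"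
proof -
  have "j \<in> nodes T" if "j \<in> R" for j using R that by (auto simp: node_representatives_def)
  then have "?thesis \<longleftrightarrow> (\<Sum>j\<in>R. prism_ratio TYPE('d) / 2 * (\<Sum>e\<in>{e\<in>T. j \<in> e}. element_defect e a b v j)) = 0"
    by (intro arg_cong[of _ _ "\<lambda>s. s = 0"] sum.cong refl node_defect)
  then show ?thesis
    unfolding sum_distrib_left[symmetric] element_defects_cancel[OF T R] by simp
qed

end

section \<open>The upwind fluxes\<close>

text \<open>A matrix and its negative are diagonalized by the same basis.\<close>

lemma matrix_abs_uminus:
  fixes B :: "real^'n::finite^'n"
  assumes "real_diagonalizable B"
  shows "matrix_abs (- B) = matrix_abs B"
proof -
  obtain S L where B: "diagonalized_by B S L" using assms by (auto simp: real_diagonalizable_def)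
  have "S ** (- L) ** matrix_inv S = - (S ** L ** matrix_inv S)"
    by (simp add: vec_eq_iff matrix_matrix_mult_def sum_negf)
  then have "diagonalized_by (- B) S (- L)"
    using B by (simp add: diagonalized_by_def diagonal_matrix_def)
  from matrix_abs_eq[OF this] show ?thesis using matrix_abs_eq[OF B] by simp
qed

lemma matrix_dot_uminus: "matrix_dot A (- e) = - matrix_dot A e"
  by (simp add: matrix_dot_def sum_negf)

lemma stencil_agree:
  "finite_stencil_functional T L \<Longrightarrow> (\<And>l. l \<in> nodes T \<Longrightarrow> u l = v l) \<Longrightarrow> L u = L v"
  unfolding finite_stencil_functional_def by blast

lemma gradient_approximation_agree:
  assumes G: "gradient_approximation T G" and j: "j \<in> nodes T" and uv: "\<And>l. l \<in> nodes T \<Longrightarrow> u l = v l"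
  shows "G u j = G v j"
proof -
  have "G u j $ i = G v j $ i" for i
    using stencil_agree[of T "\<lambda>u. G u j $ i" u v] G j uv by (simp add: gradient_approximation_def)
  then show ?thesis by (simp add: vec_eq_iff)
qed

lemma gradient_approximation_add:
  assumes G: "gradient_approximation T G" and j: "j \<in> nodes T"
  shows "G (\<lambda>l. u l + v l) j = G u j + G v j"
proof -
  have "G (\<lambda>l. u l + v l) j $ i = G u j $ i + G v j $ i" for i
    using G j by (simp add: gradient_approximation_def finite_stencil_functional_def)
  then show ?thesis by (simp add: vec_eq_iff)
qed

lemma nodal_values_node: "j \<in> nodes T \<Longrightarrow> nodal_values T f j = f j"
  by (simp add: nodal_values_def)

definition exact_edge_value :: "nat \<Rightarrow> (nat \<Rightarrow> real^'d::finite) \<Rightarrow> (nat \<Rightarrow> real) \<Rightarrow> real^'d \<Rightarrow> real^'d \<Rightarrow> real" where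
  "exact_edge_value N a b j k = (\<Sum>m<N. edge_mean (a m \<bullet> j + b m) (a m \<bullet> k + b m))"

text \<open>The reconstruction from \<open>j\<close> at the middle of the edge, minus the symmetric edge value.\<close>

definition reconstruction_excess ::
  "(real^'d::finite) set set \<Rightarrow> ((real^'d \<Rightarrow> real) \<Rightarrow> real^'d \<Rightarrow> real^'d) \<Rightarrow> nat \<Rightarrow> (nat \<Rightarrow> real^'d) \<Rightarrow> (nat \<Rightarrow> real) \<Rightarrow>
   real^'d \<Rightarrow> real^'d \<Rightarrow> real" where
  "reconstruction_excess T G N a b j k =
     (\<Sum>m<N. (a m \<bullet> j + b m)^3) + ((1/2) *\<^sub>R (k - j)) \<bullet> G (nodal_values T (\<lambda>x. \<Sum>m<N. (a m \<bullet> x + b m)^3)) j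
     - exact_edge_value N a b j k"

text \<open>Translation changes the cubic polynomial by a quadratic one, \<open>\<psi>\<close>.  The discrete gradient is exact on
  \<open>\<psi>\<close>, and for a quadratic polynomial the edge value is \<open>\<psi>(j) + \<nabla>\<psi>(j) \<bullet> (k - j)/2\<close>.\<close>

lemma reconstruction_excess_periodic:
  fixes T :: "(real^'d::finite) set set"
  assumes T: "periodic_simplicial_mesh T" and G: "gradient_approximation T G"
    and z: "integer_vector z" and j: "j \<in> nodes T"
  shows "reconstruction_excess T G N a b (z + j) (z + k) = reconstruction_excess T G N a b j k"
proof -
  define \<phi> where "\<phi> x = (\<Sum>m<N. (a m \<bullet> x + b m)^3)" for x
  define \<tau> where "\<tau> m = a m \<bullet> z" for m
  define \<psi> where "\<psi> x = (\<Sum>m<N. (3 * \<tau> m) * (a m \<bullet> x + (b m + \<tau> m / 2))\<^sup>2) + (\<Sum>m<N. \<tau> m ^ 3 / 4)" for x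
  define g where "g = (\<Sum>m<N. (2 * (3 * \<tau> m) * (a m \<bullet> j + (b m + \<tau> m / 2))) *\<^sub>R a m)"
  have cube: "(y + t)^3 = y^3 + ((3 * t) * (y + t / 2)\<^sup>2 + t ^ 3 / 4)" for y t :: real
    by (simp add: power2_eq_square power3_eq_cube field_simps)
  have shift: "\<phi> (z + x) = \<phi> x + \<psi> x" for x
  proof -
    have "\<phi> (z + x) = (\<Sum>m<N. ((a m \<bullet> x + b m) + \<tau> m)^3)"
      by (simp add: \<phi>_def \<tau>_def inner_add_right add_ac)
    then show ?thesis unfolding cube \<phi>_def \<psi>_def by (simp add: sum.distrib add.assoc)
  qed
  have \<psi>2: "\<psi> \<in> polynomials_upto 2"
    unfolding \<psi>_def[abs_def]
    by (intro polynomials_upto_add polynomials_upto_sum polynomials_upto_cmult polynomials_upto_affine_square polynomials_upto_const) auto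
  have "(\<psi> has_derivative (\<lambda>h. g \<bullet> h)) (at j)"
    unfolding \<psi>_def[abs_def] g_def
    by (rule has_derivative_eq_rhs[OF has_derivative_add[OF sum_of_squares_derivative has_derivative_const]]) simp
  then have grad: "gradient \<psi> j = g" by (rule gradient_eq)
  have tr: "mesh_translation T z" using T z by (simp add: mesh_translation_def periodic_simplicial_mesh_def)
  have "G (nodal_values T \<phi>) (z + j) = G (\<lambda>l. nodal_values T \<phi> (l + z)) j"
    using G tr j unfolding gradient_approximation_def by (metis add.commute)
  also have "\<dots> = G (\<lambda>l. nodal_values T \<phi> l + nodal_values T \<psi> l) j"
  proof (rule gradient_approximation_agree[OF G j])
    fix l assume l: "l \<in> nodes T"
    have "z + l \<in> nodes T" by (rule periodic_nodes[OF T z l])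
    then show "nodal_values T \<phi> (l + z) = nodal_values T \<phi> l + nodal_values T \<psi> l"
      using shift[of l] l by (simp add: nodal_values_node add.commute)
  qed
  also have "\<dots> = G (nodal_values T \<phi>) j + g"
    using gradient_approximation_add[OF G j] G \<psi>2 j grad by (simp add: gradient_approximation_def)
  finally have Gz: "G (nodal_values T \<phi>) (z + j) = G (nodal_values T \<phi>) j + g" .
  have em: "edge_mean (y + t) (y' + t) = edge_mean y y' + ((3 * t) * (y + t / 2)\<^sup>2 + t^3 / 4
      + (1 / 2) * (2 * (3 * t) * (y + t / 2)) * (y' - y))" for y y' t :: real
    by (simp add: edge_mean_expand power2_eq_square power3_eq_cube field_simps)
  have ex: "exact_edge_value N a b (z + j) (z + k) = exact_edge_value N a b j k + (\<psi> j + ((1/2) *\<^sub>R (k - j)) \<bullet> g)"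
  proof -
    have "exact_edge_value N a b (z + j) (z + k) =
        (\<Sum>m<N. edge_mean ((a m \<bullet> j + b m) + \<tau> m) ((a m \<bullet> k + b m) + \<tau> m))"
      by (simp add: exact_edge_value_def \<tau>_def inner_add_right add_ac)
    also have "\<dots> = exact_edge_value N a b j k + (\<psi> j + (\<Sum>m<N. (1 / 2) * (2 * (3 * \<tau> m) * (a m \<bullet> j + b m + \<tau> m / 2)) * (a m \<bullet> k - a m \<bullet> j)))"
      unfolding em exact_edge_value_def \<psi>_def by (simp add: sum.distrib add.assoc)
    also have "(\<Sum>m<N. (1 / 2) * (2 * (3 * \<tau> m) * (a m \<bullet> j + b m + \<tau> m / 2)) * (a m \<bullet> k - a m \<bullet> j)) = ((1/2) *\<^sub>R (k - j)) \<bullet> g"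
      unfolding g_def inner_sum_right
      by (intro sum.cong refl) (simp add: inner_commute[of _ "a _"] inner_diff_right add.assoc)
    finally show ?thesis .
  qed
  show ?thesis
    unfolding reconstruction_excess_def \<phi>_def[symmetric, abs_def] ex Gz shift
    using shift[of j] by (simp add: \<phi>_def[symmetric] inner_add_right)
qed

text \<open>With the two reconstructions \<open>h + p\<close> and \<open>h + q\<close>, the upwind flux is the flux of the common part \<open>h\<close> plus
  a term that depends on the excesses only.\<close>

lemma upwind_flux_split:
  fixes B M :: "real^'n::finite^'n"
  shows "((1/2) *\<^sub>R (B + M)) *v (h + p) + ((1/2) *\<^sub>R (B - M)) *v (h + q) =
    B *v h + ((1/2) *\<^sub>R (B *v (p + q)) + (1/2) *\<^sub>R (M *v (p - q)))"
proof -
  have "(1/2 * (b + m)) * (h + p) + (1/2 * (b - m)) * (h + q) = b * h + (1/2 * (b * (p + q)) + 1/2 * (m * (p - q)))"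
    for b m h p q :: real by (simp add: field_simps)
  then show ?thesis
    by (simp add: vec_eq_iff matrix_vector_mult_def sum_distrib_left sum.distrib[symmetric])
qed

lemma upwind_dissipation_antisymmetric:
  fixes B M :: "real^'n::finite^'n"
  shows "(1/2) *\<^sub>R ((- B) *v (q + p)) + (1/2) *\<^sub>R (M *v (q - p)) =
    - ((1/2) *\<^sub>R (B *v (p + q)) + (1/2) *\<^sub>R (M *v (p - q)))"
proof -
  have "(- B) *v x = - (B *v x)" for x
    by (simp add: vec_eq_iff matrix_vector_mult_def sum_negf)
  then show ?thesis
    by (simp add: matrix_vector_mult_diff_distrib add.commute algebra_simps)
qed

theorem proposition7p9:
  fixes T :: "(real^'d::finite) set set"
    and A :: "'d \<Rightarrow> real^'n::finite^'n"
    and G :: "(real^'d \<Rightarrow> real) \<Rightarrow> real^'d \<Rightarrow> real^'d"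
    and s :: "real^'d \<Rightarrow> real^'d \<Rightarrow> (real^'d \<Rightarrow> real) \<Rightarrow> real"
    and f :: "real^'d \<Rightarrow> real^'n"
    and N1 :: "(real^'d) set"
  assumes "\<And>e. real_diagonalizable (matrix_dot A e)"
    and "periodic_simplicial_mesh T"
    and "node_representatives T N1"
    and "gradient_approximation T G"
    and "extended_Galerkin T s"
    and "f \<in> vector_polynomials_upto 3"
  shows "(\<Sum>j\<in>N1. measure lebesgue (control_volume T j) *\<^sub>R truncation_error T A G s f j) = 0"
proof -
  note diag = assms(1) and T = assms(2) and R = assms(3) and G = assms(4) and S = assms(5)
  note TC = periodic_conforming[OF T]
  have RN: "j \<in> nodes T" if "j \<in> N1" for j using R that by (auto simp: node_representatives_def)
  have "\<forall>c. \<exists>t :: nat \<times> (nat \<Rightarrow> real^'d) \<times> (nat \<Rightarrow> real).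
      \<forall>x. f x $ c = (\<Sum>m<fst t. (fst (snd t) m \<bullet> x + snd (snd t) m)^3)"
  proof
    fix c
    have "(\<lambda>x. f x $ c) \<in> polynomials_upto 3" using assms(6) by (simp add: vector_polynomials_upto_def)
    then obtain N :: nat and a b where "\<And>x. f x $ c = (\<Sum>m<N. (a m \<bullet> x + b m)^3)"
      by (rule cubic_indexed_cubes) (rule that)
    then show "\<exists>t :: nat \<times> (nat \<Rightarrow> real^'d) \<times> (nat \<Rightarrow> real).
      \<forall>x. f x $ c = (\<Sum>m<fst t. (fst (snd t) m \<bullet> x + snd (snd t) m)^3)"
      by (intro exI[of _ "(N, a, b)"]) simp
  qed
  from choice[OF this] obtain t :: "'n \<Rightarrow> nat \<times> (nat \<Rightarrow> real^'d) \<times> (nat \<Rightarrow> real)" where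
    t: "\<forall>c x. f x $ c = (\<Sum>m<fst (t c). (fst (snd (t c)) m \<bullet> x + snd (snd (t c)) m)^3)" ..
  define N where "N c = fst (t c)" for c
  define a where "a c = fst (snd (t c))" for c
  define b where "b c = snd (snd (t c))" for c
  have fc: "f x $ c = (\<Sum>m<N c. (a c m \<bullet> x + b c m)^3)" for c x
    using t by (simp add: N_def a_def b_def)
  \<comment> \<open>The cubes in the components of \<open>f\<close> are indexed by pairs of the component and a number.  In row \<open>r\<close>
      of the system, component \<open>c\<close> is advected in the direction \<open>w r c\<close>.\<close>
  define P where "P = (SIGMA c:(UNIV :: 'n set). {..<N c})"
  define \<alpha> where "\<alpha> p = a (fst p) (snd p)" for p
  define \<beta> where "\<beta> p = b (fst p) (snd p)" for p
  define w where "w r c = (\<chi> i. A i $ r $ c)" for r c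
  have finP: "finite P" unfolding P_def by simp
  have sumP: "(\<Sum>c\<in>UNIV. \<Sum>m<N c. F c m) = (\<Sum>p\<in>P. F (fst p) (snd p))" for F :: "'n \<Rightarrow> nat \<Rightarrow> real"
    unfolding P_def by (subst sum.Sigma) (auto simp: case_prod_unfold)
  have adv: "advection A f x $ r = (\<Sum>p\<in>P. (3 * (\<alpha> p \<bullet> w r (fst p))) * (\<alpha> p \<bullet> x + \<beta> p)\<^sup>2)" for x r
  proof -
    have "(f has_derivative (\<lambda>h. \<chi> c. \<Sum>m<N c. 3 * (a c m \<bullet> x + b c m)\<^sup>2 * (a c m \<bullet> h))) (at x)"
    proof (subst has_derivative_componentwise_within, intro ballI)
      fix i :: "real^'n" assume "i \<in> Basis"
      then obtain c where c: "i = axis c 1" by (auto simp: Basis_vec_def)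
      have "((\<lambda>x. \<Sum>m<N c. (a c m \<bullet> x + b c m)^3) has_derivative
          (\<lambda>h. \<Sum>m<N c. 3 * (a c m \<bullet> x + b c m)\<^sup>2 * (a c m \<bullet> h))) (at x)"
        by (auto intro!: derivative_eq_intros sum.cong)
      then show "((\<lambda>x. f x \<bullet> i) has_derivative
          (\<lambda>h. (\<chi> c. \<Sum>m<N c. 3 * (a c m \<bullet> x + b c m)\<^sup>2 * (a c m \<bullet> h)) \<bullet> i)) (at x)"
        by (simp add: c inner_axis fc)
    qed
    from partial_deriv_eq[OF this]
    have pd: "partial_deriv i f x $ c = (\<Sum>m<N c. 3 * (a c m \<bullet> x + b c m)\<^sup>2 * (a c m $ i))" for i c
      by (simp add: inner_axis)
    have "advection A f x $ r = (\<Sum>i\<in>UNIV. \<Sum>c\<in>UNIV. \<Sum>m<N c. A i $ r $ c * (3 * (a c m \<bullet> x + b c m)\<^sup>2 * (a c m $ i)))"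
      by (simp add: advection_def matrix_vector_mult_def pd sum_distrib_left)
    also have "\<dots> = (\<Sum>c\<in>UNIV. \<Sum>m<N c. \<Sum>i\<in>UNIV. A i $ r $ c * (3 * (a c m \<bullet> x + b c m)\<^sup>2 * (a c m $ i)))"
      by (subst sum.swap, intro sum.cong refl, rule sum.swap)
    also have "\<dots> = (\<Sum>c\<in>UNIV. \<Sum>m<N c. (3 * (a c m \<bullet> w r c)) * (a c m \<bullet> x + b c m)\<^sup>2)"
      by (intro sum.cong refl) (simp add: w_def inner_vec_def sum_distrib_left sum_distrib_right mult_ac)
    finally show ?thesis unfolding sumP \<alpha>_def \<beta>_def .
  qed
  define q where "q r j k p = (3 * (\<alpha> p \<bullet> j + \<beta> p)\<^sup>2 - real CARD('d) / (4 * (real CARD('d) + 2)) * (6 * (\<alpha> p \<bullet> (k - j))\<^sup>2))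
     * (\<alpha> p \<bullet> w r (fst p))" for r j k p
  have source: "s j k (\<lambda>l. nodal_values T (advection A f) l $ r) = (\<Sum>p\<in>P. q r j k p)"
    if j: "j \<in> nodes T" and k: "k \<in> neighbours T j" for j k r
  proof -
    let ?Q = "\<lambda>x. \<Sum>p\<in>P. (3 * (\<alpha> p \<bullet> w r (fst p))) * (\<alpha> p \<bullet> x + \<beta> p)\<^sup>2"
    have st: "finite_stencil_functional T (s j k)"
      and exact: "\<And>q. q \<in> polynomials_upto 2 \<Longrightarrow> s j k (nodal_values T q) =
         q j - real CARD('d) / (4 * (real CARD('d) + 2)) * ((directional_deriv (k - j) ^^ 2) q) j"
      using S j k unfolding extended_Galerkin_def by blast+
    have "s j k (\<lambda>l. nodal_values T (advection A f) l $ r) = s j k (nodal_values T ?Q)"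
      by (rule stencil_agree[OF st]) (simp add: nodal_values_node adv)
    also have "\<dots> = ?Q j - real CARD('d) / (4 * (real CARD('d) + 2)) * ((directional_deriv (k - j) ^^ 2) ?Q) j"
      by (intro exact polynomials_upto_sum polynomials_upto_cmult polynomials_upto_affine_square finP)
    also have "\<dots> = (\<Sum>p\<in>P. q r j k p)"
    proof -
      have "(3 * \<alpha>) * Y - c * (2 * (3 * \<alpha>) * \<delta>) = (3 * Y - c * (6 * \<delta>)) * \<alpha>" for \<alpha> Y c \<delta> :: real
        by (simp add: algebra_simps)
      then show ?thesis
        unfolding second_directional_deriv_squares sum_distrib_left sum_subtractf[symmetric] q_def
        by (intro sum.cong refl)
    qed
    finally show ?thesis .
  qed
  \<comment> \<open>\<open>y\<close> is what the excesses of the two reconstructions contribute to the flux.\<close>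
  define B where "B j k = matrix_dot A (face_normal T j k)" for j k
  define h where "h j k = (\<chi> c. exact_edge_value (N c) (a c) (b c) j k)" for j k
  define ex where "ex j k = (\<chi> c. reconstruction_excess T G (N c) (a c) (b c) j k)" for j k
  define y where "y j k = (1/2) *\<^sub>R (B j k *v (ex j k + ex k j)) + (1/2) *\<^sub>R (matrix_abs (B j k) *v (ex j k - ex k j))" for j k
  have h_sym: "h k j = h j k" for j k by (simp add: h_def exact_edge_value_def edge_mean_commute)
  have recon: "reconstruction G j k (nodal_values T f) = h j k + ex j k" if j: "j \<in> nodes T" for j k
  proof -
    have Geq: "G (\<lambda>l. nodal_values T f l $ c) j = G (nodal_values T (\<lambda>x. \<Sum>m<N c. (a c m \<bullet> x + b c m)^3)) j" for c
      by (rule gradient_approximation_agree[OF G j]) (simp add: nodal_values_node fc)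
    show ?thesis
      by (simp add: Geq vec_eq_iff reconstruction_def h_def ex_def reconstruction_excess_def nodal_values_node[OF j] fc)
  qed
  have flux: "flux T A G j k (nodal_values T f) = B j k *v h j k + y j k" if k: "k \<in> neighbours T j" for j k
  proof -
    have "j \<in> nodes T" "k \<in> nodes T" using neighbour_node[OF k] by auto
    then show ?thesis
      unfolding flux_def Let_def recon B_def[symmetric] h_sym[of k j] y_def by (simp only: recon h_sym[of k j] upwind_flux_split)
  qed
  have y_sum: "(\<Sum>j\<in>N1. \<Sum>k\<in>neighbours T j. y j k) = 0"
  proof -
    have swap: "y k j = - y j k" if k: "k \<in> neighbours T j" for j k
    proof -
      have Bm: "B k j = - B j k" unfolding B_def face_normal_swap[OF T k] by (rule matrix_dot_uminus)
      have "matrix_abs (- B j k) = matrix_abs (B j k)"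
        by (rule matrix_abs_uminus) (simp add: B_def diag)
      then show ?thesis unfolding y_def Bm by (simp only: upwind_dissipation_antisymmetric[of "B j k"])
    qed
    have "(\<Sum>j\<in>N1. \<Sum>k\<in>neighbours T j. y j k) = (\<Sum>j\<in>N1. \<Sum>k\<in>neighbours T j. y k j)"
    proof (rule mass_transport[OF T R])
      fix j assume j: "j \<in> nodes T"
      show "finite (neighbours T j)" by (rule finite_neighbours[OF TC j])
      show "neighbours T j \<subseteq> nodes T" by (auto simp: neighbours_def nodes_def)
      fix k assume k: "k \<in> neighbours T j"
      show "j \<in> neighbours T k" using k neighbours_sym by blast
      fix z :: "real^'d" assume z: "integer_vector z"
      show "z + k \<in> neighbours T (z + j)" by (rule neighbours_translate[OF T z k])
      have kn: "k \<in> nodes T" using neighbour_node[OF k] by blast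
      have "ex (z + j) (z + k) = ex j k" "ex (z + k) (z + j) = ex k j"
        unfolding ex_def by (simp_all add: reconstruction_excess_periodic[OF T G z] j kn)
      moreover have "B (z + j) (z + k) = B j k" unfolding B_def face_normal_translate[OF T z k] ..
      ultimately show "y (z + j) (z + k) = y j k" unfolding y_def by simp
    qed
    also have "\<dots> = (\<Sum>j\<in>N1. \<Sum>k\<in>neighbours T j. - y j k)" by (intro sum.cong refl swap)
    finally have "(\<Sum>j\<in>N1. \<Sum>k\<in>neighbours T j. y j k) = - (\<Sum>j\<in>N1. \<Sum>k\<in>neighbours T j. y j k)"
      by (simp add: sum_negf)
    then show ?thesis by (simp add: eq_neg_iff_add_eq_0 scaleR_2[symmetric])
  qed
  \<comment> \<open>For each cube, \<open>D\<close> is the symmetric part of the flux minus the source.\<close>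
  define D where "D r j k p = edge_mean (\<alpha> p \<bullet> j + \<beta> p) (\<alpha> p \<bullet> k + \<beta> p) * (face_normal T j k \<bullet> w r (fst p))
      - volume_weight T j k * q r j k p" for r j k p
  have Bh: "(B j k *v h j k) $ r = (\<Sum>p\<in>P. edge_mean (\<alpha> p \<bullet> j + \<beta> p) (\<alpha> p \<bullet> k + \<beta> p) * (face_normal T j k \<bullet> w r (fst p)))"
    for j k r
  proof -
    have "B j k $ r $ c = face_normal T j k \<bullet> w r c" for c
      by (simp add: B_def matrix_dot_def w_def inner_vec_def)
    then have "(B j k *v h j k) $ r = (\<Sum>c\<in>UNIV. \<Sum>m<N c. edge_mean (a c m \<bullet> j + b c m) (a c m \<bullet> k + b c m) * (face_normal T j k \<bullet> w r c))"
      by (simp add: matrix_vector_mult_def h_def exact_edge_value_def sum_distrib_left mult.commute)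
    then show ?thesis unfolding sumP \<alpha>_def \<beta>_def .
  qed
  have local: "(measure lebesgue (control_volume T j) *\<^sub>R truncation_error T A G s f j) $ r =
      (\<Sum>k\<in>neighbours T j. \<Sum>p\<in>P. D r j k p) + (\<Sum>k\<in>neighbours T j. y j k) $ r" if j: "j \<in> nodes T" for j r
  proof -
    have eq: "measure lebesgue (control_volume T j) *\<^sub>R truncation_error T A G s f j =
      - (\<Sum>k\<in>neighbours T j. volume_weight T j k *\<^sub>R (\<chi> c. s j k (\<lambda>l. nodal_values T (advection A f) l $ c)))
      + (\<Sum>k\<in>neighbours T j. flux T A G j k (nodal_values T f))"
      unfolding truncation_error_def using control_volume_measure_pos[OF TC j] by simp
    have "(measure lebesgue (control_volume T j) *\<^sub>R truncation_error T A G s f j) $ r =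
      (\<Sum>k\<in>neighbours T j. (flux T A G j k (nodal_values T f)) $ r
        - volume_weight T j k * s j k (\<lambda>l. nodal_values T (advection A f) l $ r))"
      unfolding eq by (simp add: sum_subtractf)
    also have "\<dots> = (\<Sum>k\<in>neighbours T j. (\<Sum>p\<in>P. D r j k p) + y j k $ r)"
    proof (intro sum.cong refl)
      fix k assume k: "k \<in> neighbours T j"
      show "(flux T A G j k (nodal_values T f)) $ r - volume_weight T j k * s j k (\<lambda>l. nodal_values T (advection A f) l $ r) =
          (\<Sum>p\<in>P. D r j k p) + y j k $ r"
        unfolding flux[OF k] source[OF j k] vector_add_component Bh D_def
        by (simp add: sum_subtractf sum_distrib_left)
    qed
    finally show ?thesis by (simp add: sum.distrib)
  qed
  show ?thesis
  proof (subst vec_eq_iff, rule allI)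
    fix r
    have "(\<Sum>j\<in>N1. measure lebesgue (control_volume T j) *\<^sub>R truncation_error T A G s f j) $ r =
        (\<Sum>j\<in>N1. \<Sum>k\<in>neighbours T j. \<Sum>p\<in>P. D r j k p) + (\<Sum>j\<in>N1. \<Sum>k\<in>neighbours T j. y j k) $ r"
      using local RN by (simp add: sum.distrib)
    also have "(\<Sum>j\<in>N1. \<Sum>k\<in>neighbours T j. \<Sum>p\<in>P. D r j k p) = (\<Sum>p\<in>P. \<Sum>j\<in>N1. \<Sum>k\<in>neighbours T j. D r j k p)"
    proof -
      have "(\<Sum>k\<in>neighbours T j. \<Sum>p\<in>P. D r j k p) = (\<Sum>p\<in>P. \<Sum>k\<in>neighbours T j. D r j k p)" for j
        by (rule sum.swap)
      then show ?thesis by (simp add: sum.swap[of _ P N1])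
    qed
    also have "\<dots> = 0"
      unfolding D_def q_def by (intro sum.neutral ballI cube_defects_cancel[OF T R])
    finally show "(\<Sum>j\<in>N1. measure lebesgue (control_volume T j) *\<^sub>R truncation_error T A G s f j) $ r = 0 $ r"
      by (simp add: y_sum)
  qed
qed

end
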